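(* Let $X$ be a time frequency shifts invariant space, with associated polynomial weight function $v$ on $\mathbb R^{2d}$ and constant $C>0$, i.e. $\|\pi_zu\|_X\le C\,v(z)\|u\|_X$ for all $u\in X$, $z\in\mathbb R^{2d}$. Let $L\in GL(2d)$ and $p\in\mathcal D'(\mathbb T^{2d}_L)$. Assume that the Fourier coefficients $c_\kappa(p)$ of $p$ satisfy $$\|c_\kappa(p)\|_{\ell^1_{L,v}}:=\sum_{\kappa\in\mathbb Z^{2d}}v(\mathcal JL^{-T}\kappa)\,|c_\kappa(p)|<+\infty .$$ Then for any $\tau\in[0,1]$ the operator $\mathrm{Op}_\tau(p)$ is bounded on $X$ and $$\|\mathrm{Op}_\tau(p)\|_{\mathcal L(X)}\le C\,\|c_\kappa(p)\|_{\ell^1_{L,v}},$$ with the same constant $C$ as in the invariance inequality above.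
   Context: $GL(n)$ denotes the invertible real $n\times n$ matrices; $L^{-T}:=(L^{-1})^T$; $\langle x,y\rangle=x\cdot y$ is the Euclidean inner product; $\mathcal J=\begin{pmatrix}0&-I\\ I&0\end{pmatrix}\in GL(2d)$ with $d\times d$ blocks. Time frequency shifts. For $z=(x,\omega)\in\mathbb R^d\times\mathbb R^d$, $\pi_zf(t)=M_\omega T_xf(t)=e^{2\pi i\omega\cdot t}f(t-x)$, extended to distributions. Polynomial weight function: $v(z)=(1+|z|^2)^{s/2}$ for some $s\ge0$. Time frequency shifts invariant (tfs invariant) space: a Banach space $X$ with continuous embeddings $\mathcal S(\mathbb R^d)\hookrightarrow X\hookrightarrow\mathcal S'(\mathbb R^d)$, with $\mathcal S(\mathbb R^d)$ dense in $X$, such that for some polynomial weight function $v$ on $\mathbb R^{2d}$ and some $C>0$, $\|\pi_zu\|_X\le C\,v(z)\|u\|_X$ for all $u\in X$, $z\in\mathbb R^{2d}$. Periodic distributions. For $L\in GL(n)$, $\mathbb T^n_L=\mathbb R^n/L\mathbb Z^n$, and $\mathcal D'(\mathbb T^n_L)$ is identified with the space of $L$-periodic distributions: those $u\in\mathcal D'(\mathbb R^n)$ invariant under translation by $L\kappa$ for all $\kappa\in\mathbb Z^n$ (these are automatically tempered). The Fourier coefficients of $u\in\mathcal D'(\mathbb T^n_L)$ are $$c_\kappa(u)=\frac1{|\det L|}\langle u,e^{-2\pi i\langle L^{-T}\kappa,\cdot\rangle}\rangle_{\mathbb T^n_L}=\langle u(L\,\cdot),\phi\,e^{-2\pi i\langle\cdot,\kappa\rangle}\rangle,\qquad\kappa\in\mathbb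 Z^n,$$ where in the last expression the pairing is the bilinear distributional one on $\mathbb R^n$ and $\phi\in C_0^\infty(\mathbb R^n)$ is any function with $\sum_{\kappa\in\mathbb Z^n}\phi(x-\kappa)=1$ for all $x$ (the value does not depend on $\phi$). Pseudodifferential operators. For $0\le\tau\le1$ and $p\in\mathcal S'(\mathbb R^{2d})$, $\mathrm{Op}_\tau(p):\mathcal S(\mathbb R^d)\to\mathcal S'(\mathbb R^d)$ is given by $$\mathrm{Op}_\tau(p)u(x)=\int_{\mathbb R^d}\int_{\mathbb R^d}e^{2\pi i(x-y)\cdot\omega}\,p\big((1-\tau)x+\tau y,\omega\big)\,u(y)\,dy\,d\omega,$$ understood in the distribution sense, i.e. $\mathrm{Op}_\tau(p)$ is the operator with distributional Schwartz kernel $K(x,y)=(\mathcal F_2^{-1}p)((1-\tau)x+\tau y,\,x-y)$, where $\mathcal F_2^{-1}$ is the inverse Fourier transform in the second $d$ variables, with $\mathcal F f(\omega)=\int f(x)e^{-2\pi i x\cdot\omega}\,dx$. "$\mathrm{Op}_\tau(p)$ is bounded on $X$" means that $\mathrm{Op}_\tau(p)$, defined on $\mathcal S(\mathbb R^d)$, takes values in $X$ and extends (uniquely, by density) to a bounded linear operator on $X$, still denoted $\mathrm{Op}_\tau(p)$. $\mathcal L(X)$ is the Banach algebra of bounded linear operators on $X$ with the operator norm. *)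

theory Defs
  imports "HOL-Analysis.Analysis"
begin

text \<open>
  Euclidean space of dimension n is \<open>real ^ 'n\<close>; the phase space of dimension 2d is
  \<open>real ^ ('d + 'd)\<close>, with a point (x, \<omega>) written \<open>join x \<omega>\<close>.
\<close>

definition join :: "real ^ 'a::finite \<Rightarrow> real ^ 'b::finite \<Rightarrow> real ^ ('a + 'b)" where
  "join x y = (\<chi> i. case i of Inl a \<Rightarrow> x $ a | Inr b \<Rightarrow> y $ b)"

definition vfst :: "real ^ ('a::finite + 'b::finite) \<Rightarrow> real ^ 'a" where
  "vfst z = (\<chi> a. z $ Inl a)"

definition vsnd :: "real ^ ('a::finite + 'b::finite) \<Rightarrow> real ^ 'b" where
  "vsnd z = (\<chi> b. z $ Inr b)"

definition block ::
  "real ^ 'd ^ 'd \<Rightarrow> real ^ 'd ^ 'd \<Rightarrow> real ^ 'd ^ 'd \<Rightarrow> real ^ 'd ^ 'd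
    \<Rightarrow> real ^ ('d::finite + 'd) ^ ('d + 'd)" where
  "block A B C D =
    (\<chi> i. case i of Inl a \<Rightarrow> join (A $ a) (B $ a) | Inr a \<Rightarrow> join (C $ a) (D $ a))"

definition symplectic_mat :: "real ^ ('d::finite + 'd) ^ ('d + 'd)" where
  "symplectic_mat = block 0 (- mat 1) (mat 1) 0"

definition int_vec :: "int ^ 'n::finite \<Rightarrow> real ^ 'n" where
  "int_vec \<kappa> = (\<chi> i. of_int (\<kappa> $ i))"

definition inv_transpose :: "real ^ 'n ^ 'n \<Rightarrow> real ^ 'n::finite ^ 'n" where
  "inv_transpose L = transpose (matrix_inv L)"

definition partial :: "'n::finite \<Rightarrow> (real ^ 'n \<Rightarrow> complex) \<Rightarrow> real ^ 'n \<Rightarrow> complex" where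
  "partial i f x = frechet_derivative f (at x) (axis i 1)"

definition partials :: "'n::finite list \<Rightarrow> (real ^ 'n \<Rightarrow> complex) \<Rightarrow> real ^ 'n \<Rightarrow> complex" where
  "partials is f = foldr partial is f"

text \<open>
  Multi-indices are represented by lists of coordinate directions; since \<open>partials is f\<close> is
  required to be (Frechet) differentiable for every list, this is C-infinity.
\<close>

definition smooth :: "(real ^ 'n::finite \<Rightarrow> complex) \<Rightarrow> bool" where
  "smooth f \<longleftrightarrow> (\<forall>is x. partials is f differentiable (at x))"

definition sw_seminorm :: "nat \<Rightarrow> 'n::finite list \<Rightarrow> (real ^ 'n \<Rightarrow> complex) \<Rightarrow> real" where
  "sw_seminorm k is f = (SUP x. (1 + norm x) ^ k * cmod (partials is f x))"

definition schwartz :: "(real ^ 'n::finite \<Rightarrow> complex) set" where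
  "schwartz = {f. smooth f \<and>
     (\<forall>k is. bdd_above (range (\<lambda>x. (1 + norm x) ^ k * cmod (partials is f x))))}"

definition test_on :: "(real ^ 'n::finite) set \<Rightarrow> (real ^ 'n \<Rightarrow> complex) set" where
  "test_on K = {f. smooth f \<and> (\<forall>x. x \<notin> K \<longrightarrow> f x = 0)}"

definition test_functions :: "(real ^ 'n::finite \<Rightarrow> complex) set" where
  "test_functions = (\<Union>K\<in>{K. compact K}. test_on K)"

definition seminorm_topology ::
  "('a \<Rightarrow> complex) set \<Rightarrow> (('a \<Rightarrow> complex) \<Rightarrow> real) set \<Rightarrow> ('a \<Rightarrow> complex) topology" where
  "seminorm_topology V P =
     topology_generated_by {{g \<in> V. q (\<lambda>x. g x - f x) < e} | f q e. f \<in> V \<and> q \<in> P \<and> e > 0}"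

definition schwartz_topology :: "(real ^ 'n::finite \<Rightarrow> complex) topology" where
  "schwartz_topology = seminorm_topology schwartz (range (\<lambda>(k, is). sw_seminorm k is))"

text \<open>
  A (tempered) distribution is a functional on all functions that is zero outside the space of
  test (Schwartz) functions; this normalization makes equality of functionals the equality of
  distributions.
\<close>

type_synonym 'n functional = "(real ^ 'n \<Rightarrow> complex) \<Rightarrow> complex"

definition linear_form_on :: "('a \<Rightarrow> complex) set \<Rightarrow> (('a \<Rightarrow> complex) \<Rightarrow> complex) \<Rightarrow> bool" where
  "linear_form_on V u \<longleftrightarrow>
     (\<forall>f\<in>V. \<forall>g\<in>V. \<forall>a b. u (\<lambda>x. a * f x + b * g x) = a * u f + b * u g)"

text \<open>
  Continuity for the inductive limit topology on the test functions amounts, for a linear form,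
  to continuity on the test functions supported in each fixed compact set.
\<close>

definition distributions :: "'n::finite functional set" where
  "distributions = {u. (\<forall>\<phi>. \<phi> \<notin> test_functions \<longrightarrow> u \<phi> = 0) \<and> linear_form_on test_functions u \<and>
     (\<forall>K. compact K \<longrightarrow>
        continuous_map (seminorm_topology (test_on K) (range (sw_seminorm 0))) euclidean u)}"

definition tempered :: "'n::finite functional set" where
  "tempered = {u. (\<forall>\<phi>. \<phi> \<notin> schwartz \<longrightarrow> u \<phi> = 0) \<and> linear_form_on schwartz u \<and>
     continuous_map schwartz_topology euclidean u}"

text \<open>\<open>euclidean\<close> on functionals is the topology of pointwise convergence.\<close>

definition tempered_topology :: "'n::finite functional topology" where
  "tempered_topology = subtopology euclidean tempered"

definition schwartz_dist :: "(real ^ 'n::finite \<Rightarrow> complex) \<Rightarrow> 'n functional" where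
  "schwartz_dist f = (\<lambda>\<phi>. if \<phi> \<in> schwartz then \<integral>x. f x * \<phi> x \<partial>lborel else 0)"

text \<open>
  A periodic distribution is tempered: it extends, uniquely by density of the test functions, to
  the Schwartz space. The extension is needed since \<open>Op\<close> takes a tempered symbol.
\<close>

definition tempered_ext :: "'n::finite functional \<Rightarrow> 'n functional" where
  "tempered_ext u = (THE U. U \<in> tempered \<and> (\<forall>\<phi>\<in>test_functions. U \<phi> = u \<phi>))"

definition translation :: "real ^ 'n \<Rightarrow> (real ^ 'n \<Rightarrow> complex) \<Rightarrow> real ^ 'n \<Rightarrow> complex" where
  "translation x f = (\<lambda>t. f (t - x))"

definition modulation :: "real ^ 'n \<Rightarrow> (real ^ 'n::finite \<Rightarrow> complex) \<Rightarrow> real ^ 'n \<Rightarrow> complex" where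
  "modulation \<omega> f = (\<lambda>t. cis (2 * pi * (\<omega> \<bullet> t)) * f t)"

text \<open>Operations on distributions are the transposes for the bilinear pairing, without conjugation.\<close>

definition translation_dist :: "real ^ 'n \<Rightarrow> 'n functional \<Rightarrow> 'n functional" where
  "translation_dist x u = (\<lambda>\<phi>. u (translation (- x) \<phi>))"

definition modulation_dist :: "real ^ 'n \<Rightarrow> 'n::finite functional \<Rightarrow> 'n functional" where
  "modulation_dist \<omega> u = (\<lambda>\<phi>. u (modulation \<omega> \<phi>))"

definition tf_shift :: "real ^ ('d::finite + 'd) \<Rightarrow> 'd functional \<Rightarrow> 'd functional" where
  "tf_shift z u = modulation_dist (vsnd z) (translation_dist (vfst z) u)"

text \<open>The distribution u(A \<open>\<cdot>\<close>) for an invertible matrix A.\<close>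

definition compose_dist :: "'n::finite functional \<Rightarrow> real ^ 'n ^ 'n \<Rightarrow> 'n functional" where
  "compose_dist u A = (\<lambda>\<phi>. u (\<lambda>x. \<phi> (matrix_inv A *v x)) / of_real \<bar>det A\<bar>)"

definition periodic_distributions :: "real ^ 'n ^ 'n \<Rightarrow> 'n::finite functional set" where
  "periodic_distributions L =
     {u \<in> distributions. \<forall>\<kappa>. translation_dist (L *v int_vec \<kappa>) u = u}"

definition periodic_partition :: "(real ^ 'n::finite \<Rightarrow> complex) \<Rightarrow> bool" where
  "periodic_partition \<phi> \<longleftrightarrow> \<phi> \<in> test_functions \<and>
     (\<forall>x. ((\<lambda>\<kappa>. \<phi> (x - int_vec \<kappa>)) has_sum 1) UNIV)"

text \<open>The coefficient of a periodic distribution does not depend on the chosen partition.\<close>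

definition fourier_coeff ::
  "real ^ 'n ^ 'n \<Rightarrow> 'n::finite functional \<Rightarrow> int ^ 'n \<Rightarrow> complex" where
  "fourier_coeff L u \<kappa> =
     compose_dist u L (modulation (- int_vec \<kappa>) (SOME \<phi>. periodic_partition \<phi>))"

definition partial_inv_fourier ::
  "(real ^ ('d::finite + 'd) \<Rightarrow> complex) \<Rightarrow> real ^ ('d + 'd) \<Rightarrow> complex" where
  "partial_inv_fourier \<Phi> = (\<lambda>z. \<integral>y. cis (2 * pi * (y \<bullet> vsnd z)) * \<Phi> (join (vfst z) y) \<partial>lborel)"

definition partial_inv_fourier_dist ::
  "('d::finite + 'd) functional \<Rightarrow> ('d + 'd) functional" where
  "partial_inv_fourier_dist p =
     (\<lambda>\<Phi>. if \<Phi> \<in> schwartz then p (partial_inv_fourier \<Phi>) else 0)"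

text \<open>The block matrix is that of the map from (x, y) to ((1 - \<tau>) x + \<tau> y, x - y).\<close>

definition op_kernel :: "real \<Rightarrow> ('d::finite + 'd) functional \<Rightarrow> ('d + 'd) functional" where
  "op_kernel \<tau> p = compose_dist (partial_inv_fourier_dist p)
     (block (mat (1 - \<tau>)) (mat \<tau>) (mat 1) (- mat 1))"

text \<open>The operator with the above Schwartz kernel, with f in the second variable of the kernel.\<close>

definition Op ::
  "real \<Rightarrow> ('d::finite + 'd) functional \<Rightarrow> (real ^ 'd \<Rightarrow> complex) \<Rightarrow> 'd functional" where
  "Op \<tau> p f = (\<lambda>\<phi>. if \<phi> \<in> schwartz then op_kernel \<tau> p (\<lambda>z. \<phi> (vfst z) * f (vsnd z)) else 0)"

text \<open>
  The locale \<open>Metric_space\<close> demands symmetry and nonnegativity of the distance also outside the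
  carrier, where the norm is unconstrained; hence the case distinction.
\<close>

definition norm_dist ::
  "('a \<Rightarrow> complex) set \<Rightarrow> (('a \<Rightarrow> complex) \<Rightarrow> real) \<Rightarrow> ('a \<Rightarrow> complex) \<Rightarrow> ('a \<Rightarrow> complex) \<Rightarrow> real"
where
  "norm_dist X nrm u w = (if u \<in> X \<and> w \<in> X then nrm (\<lambda>\<phi>. u \<phi> - w \<phi>) else 0)"

definition norm_topology ::
  "('a \<Rightarrow> complex) set \<Rightarrow> (('a \<Rightarrow> complex) \<Rightarrow> real) \<Rightarrow> ('a \<Rightarrow> complex) topology" where
  "norm_topology X nrm = Metric_space.mtopology X (norm_dist X nrm)"

definition complex_banach :: "('a \<Rightarrow> complex) set \<Rightarrow> (('a \<Rightarrow> complex) \<Rightarrow> real) \<Rightarrow> bool" where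
  "complex_banach X nrm \<longleftrightarrow>
     (\<lambda>_. 0) \<in> X \<and>
     (\<forall>u\<in>X. \<forall>w\<in>X. (\<lambda>\<phi>. u \<phi> + w \<phi>) \<in> X) \<and>
     (\<forall>a. \<forall>u\<in>X. (\<lambda>\<phi>. a * u \<phi>) \<in> X) \<and>
     (\<forall>u\<in>X. 0 \<le> nrm u \<and> (nrm u = 0 \<longleftrightarrow> u = (\<lambda>_. 0))) \<and>
     (\<forall>u\<in>X. \<forall>w\<in>X. nrm (\<lambda>\<phi>. u \<phi> + w \<phi>) \<le> nrm u + nrm w) \<and>
     (\<forall>a. \<forall>u\<in>X. nrm (\<lambda>\<phi>. a * u \<phi>) = cmod a * nrm u) \<and>
     Metric_space.mcomplete X (norm_dist X nrm)"

definition polynomial_weight :: "(real ^ 'n::finite \<Rightarrow> real) \<Rightarrow> bool" where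
  "polynomial_weight v \<longleftrightarrow> (\<exists>s\<ge>0. \<forall>z. v z = (1 + (norm z)\<^sup>2) powr (s / 2))"

definition tf_shift_bound ::
  "'d::finite functional set \<Rightarrow> ('d functional \<Rightarrow> real) \<Rightarrow> (real ^ ('d + 'd) \<Rightarrow> real) \<Rightarrow> real \<Rightarrow> bool"
where
  "tf_shift_bound X nrm v C \<longleftrightarrow>
     (\<forall>u\<in>X. \<forall>z. tf_shift z u \<in> X \<and> nrm (tf_shift z u) \<le> C * v z * nrm u)"

definition tfs_invariant_space ::
  "'d::finite functional set \<Rightarrow> ('d functional \<Rightarrow> real) \<Rightarrow> bool" where
  "tfs_invariant_space X nrm \<longleftrightarrow>
     complex_banach X nrm \<and> X \<subseteq> tempered \<and>
     continuous_map schwartz_topology (norm_topology X nrm) schwartz_dist \<and>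
     continuous_map (norm_topology X nrm) tempered_topology (\<lambda>u. u) \<and>
     norm_topology X nrm closure_of (schwartz_dist ` schwartz) = X \<and>
     (\<exists>v C. polynomial_weight v \<and> C > 0 \<and> tf_shift_bound X nrm v C)"

text \<open>
  Operators are taken to be \<open>undefined\<close> outside X, so that a bounded extension is unique.
\<close>

definition bounded_operators ::
  "('a \<Rightarrow> complex) set \<Rightarrow> (('a \<Rightarrow> complex) \<Rightarrow> real)
    \<Rightarrow> (('a \<Rightarrow> complex) \<Rightarrow> ('a \<Rightarrow> complex)) set" where
  "bounded_operators X nrm = {A \<in> X \<rightarrow>\<^sub>E X.
     (\<forall>u\<in>X. \<forall>w\<in>X. \<forall>a b. A (\<lambda>\<phi>. a * u \<phi> + b * w \<phi>) = (\<lambda>\<phi>. a * A u \<phi> + b * A w \<phi>)) \<and>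
     (\<exists>B. \<forall>u\<in>X. nrm (A u) \<le> B * nrm u)}"

definition operator_norm ::
  "('a \<Rightarrow> complex) set \<Rightarrow> (('a \<Rightarrow> complex) \<Rightarrow> real)
    \<Rightarrow> (('a \<Rightarrow> complex) \<Rightarrow> ('a \<Rightarrow> complex)) \<Rightarrow> real" where
  "operator_norm X nrm A = (SUP u\<in>{u \<in> X. nrm u \<le> 1}. nrm (A u))"

definition is_bounded_extension ::
  "'d::finite functional set \<Rightarrow> ('d functional \<Rightarrow> real) \<Rightarrow> ((real ^ 'd \<Rightarrow> complex) \<Rightarrow> 'd functional)
    \<Rightarrow> ('d functional \<Rightarrow> 'd functional) \<Rightarrow> bool" where
  "is_bounded_extension X nrm T A \<longleftrightarrow>
     A \<in> bounded_operators X nrm \<and> (\<forall>f\<in>schwartz. A (schwartz_dist f) = T f)"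

definition bounded_on ::
  "'d::finite functional set \<Rightarrow> ('d functional \<Rightarrow> real) \<Rightarrow> ((real ^ 'd \<Rightarrow> complex) \<Rightarrow> 'd functional)
    \<Rightarrow> bool" where
  "bounded_on X nrm T \<longleftrightarrow> (\<forall>f\<in>schwartz. T f \<in> X) \<and> (\<exists>A. is_bounded_extension X nrm T A)"

definition extension_to ::
  "'d::finite functional set \<Rightarrow> ('d functional \<Rightarrow> real) \<Rightarrow> ((real ^ 'd \<Rightarrow> complex) \<Rightarrow> 'd functional)
    \<Rightarrow> 'd functional \<Rightarrow> 'd functional" where
  "extension_to X nrm T = (THE A. is_bounded_extension X nrm T A)"

end

theory Submission
  imports "HOL-Probability.Sinc_Integral" "HOL-Probability.Characteristic_Functions" Defs
begin

text \<open>
  Write \<open>\<zeta> \<kappa> = L\<^sup>-\<^sup>T \<kappa>\<close>. The idea is that the symbol is a superposition of the characters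
  \<open>z \<mapsto> exp (2 \<pi> i \<langle>\<zeta> \<kappa>, z\<rangle>)\<close> with coefficients \<open>c \<kappa>\<close>, and that \<open>Op\<close> turns the character with frequency
  \<open>\<zeta> = (a, b)\<close> into the operator \<open>u \<mapsto> exp (2 \<pi> i \<tau> \<langle>a, b\<rangle>) \<pi>\<^sub>z u\<close> with \<open>z = (- b, a) = J \<zeta>\<close>. The
  factor has modulus 1 and is the only trace of \<open>\<tau>\<close>. So the operator is the series of the terms
  \<open>c \<kappa> exp (2 \<pi> i \<tau> \<langle>a, b\<rangle>) \<pi>\<^sub>z\<close>, whose norms on \<open>X\<close> are at most \<open>C v(J (\<zeta> \<kappa>)) \<bar>c \<kappa>\<bar>\<close>. By
  completeness the series converges on all of \<open>X\<close>, with the asserted bound for the norm of the sum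
  (\<open>shift_series_converges\<close>), and density of the Schwartz functions makes it the only bounded extension
  (\<open>bounded_operators_unique\<close>).

  Two facts carry this argument. The first is that a periodic distribution with summable Fourier
  coefficients is the sum of its Fourier series (\<open>tempered_ext_eq_series\<close>). The difference of the two is
  a periodic distribution all of whose Fourier coefficients vanish, and such a distribution is zero
  (\<open>periodic_functional_eq_0\<close>): it sees only the periodization of a test function, and that is a limit of
  trigonometric polynomials together with all derivatives. The approximation is by convolution with the
  powers of a trigonometric polynomial that equals 1 on the lattice and is smaller elsewhere
  (\<open>approx_uniform\<close>). Since the symbol of \<open>Op\<close> is the tempered extension of the distribution, density of
  the test functions in the Schwartz space is needed as well (\<open>tempered_eqI\<close>).

  The second is the formula for a single character (\<open>Op_series\<close>). It amounts to Fourier inversion in the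
  frequency variable (\<open>fourier_inversion\<close>), once it is known that the partial Fourier transform
  preserves the Schwartz space (\<open>schwartz_partial_inv_fourier\<close>).
\<close>

section \<open>Smooth functions\<close>

lemma partial_eq: "(f has_derivative D) (at x) \<Longrightarrow> partial i f x = D (axis i 1)"
  unfolding partial_def by (metis frechet_derivative_at)

lemma derivative_eq_sum_partial:
  assumes "(f has_derivative D) (at x)"
  shows "D h = (\<Sum>i\<in>UNIV. of_real (h $ i) * partial i f x)"
proof -
  interpret bounded_linear D
    using assms by (rule has_derivative_bounded_linear)
  have "D h = D (\<Sum>i\<in>UNIV. (h $ i) *\<^sub>R axis i 1)"
    using basis_expansion[of h] by (simp add: scalar_mult_eq_scaleR)
  also have "\<dots> = (\<Sum>i\<in>UNIV. (h $ i) *\<^sub>R D (axis i 1))"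
    by (simp add: sum scaleR)
  finally show ?thesis
    by (simp add: partial_eq[OF assms] scaleR_conv_of_real)
qed

lemma has_derivative_partial:
  assumes "f differentiable (at x)"
  shows "(f has_derivative (\<lambda>h. \<Sum>i\<in>UNIV. of_real (h $ i) * partial i f x)) (at x)"
proof -
  obtain D where D: "(f has_derivative D) (at x)"
    using assms unfolding differentiable_def by blast
  then have "D = (\<lambda>h. \<Sum>i\<in>UNIV. of_real (h $ i) * partial i f x)"
    using derivative_eq_sum_partial by blast
  with D show ?thesis by simp
qed

lemma partials_Nil [simp]: "partials [] f = f"
  and partials_Cons: "partials (i # is) f = partial i (partials is f)"
  and partials_snoc: "partials (is @ [i]) f = partials is (partial i f)"
  by (simp_all add: partials_def)

lemma partial_const [simp]: "partial i (\<lambda>_. c) = (\<lambda>_. 0)"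
  by (rule ext) (rule partial_eq[where D = "\<lambda>_. 0"], simp)

lemma partial_add:
  assumes "f differentiable (at x)" "g differentiable (at x)"
  shows "partial i (\<lambda>x. f x + g x) x = partial i f x + partial i g x"
  by (subst partial_eq[OF has_derivative_add[OF assms[THEN has_derivative_partial]]])
     (simp add: axis_def if_distrib if_distribR cong: if_cong)

lemma partial_mult:
  assumes "f differentiable (at x)" "g differentiable (at x)"
  shows "partial i (\<lambda>x. f x * g x) x = f x * partial i g x + partial i f x * g x"
  by (subst partial_eq[OF has_derivative_mult[OF assms[THEN has_derivative_partial]]])
     (simp add: axis_def if_distrib if_distribR cong: if_cong)

lemma partial_cmult:
  assumes "f differentiable (at x)"
  shows "partial i (\<lambda>x. c * f x) x = c * partial i f x"
  using partial_mult[of "\<lambda>_. c" x f i] assms by simp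

lemma has_derivative_affine:
  "((\<lambda>x. A *v x + b) has_derivative (\<lambda>h. A *v h)) (at (x :: real ^ 'n::finite))"
  by (auto intro!: derivative_eq_intros bounded_linear_imp_has_derivative
      matrix_vector_mul_bounded_linear)

lemma partial_affine:
  fixes A :: "real ^ 'n::finite ^ 'm::finite"
  assumes "f differentiable (at (A *v x + b))"
  shows "partial j (\<lambda>x. f (A *v x + b)) x =
    (\<Sum>i\<in>UNIV. of_real (A $ i $ j) * partial i f (A *v x + b))"
  by (subst partial_eq[OF has_derivative_compose[OF has_derivative_affine
        has_derivative_partial[OF assms]]])
     (simp add: matrix_vector_mult_def axis_def if_distrib if_distribR cong: if_cong)

lemma differentiable_affine:
  fixes A :: "real ^ 'n::finite ^ 'm::finite" and f :: "real ^ 'm \<Rightarrow> complex"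
  assumes "f differentiable (at (A *v x + b))"
  shows "(\<lambda>x. f (A *v x + b)) differentiable (at x)"
  using has_derivative_compose[OF has_derivative_affine has_derivative_partial[OF assms]]
  unfolding differentiable_def by blast

lemma has_derivative_coord:
  "((\<lambda>x. complex_of_real (x $ i)) has_derivative (\<lambda>h. of_real (h $ i))) (at x)"
  by (intro bounded_linear_imp_has_derivative bounded_linear_of_real[THEN bounded_linear_compose]
      bounded_linear_vec_nth)

lemma differentiable_coord: "(\<lambda>x. complex_of_real (x $ i)) differentiable (at x)"
  using has_derivative_coord unfolding differentiable_def by blast

lemma partial_coord:
  "partial j (\<lambda>x. complex_of_real (x $ i)) = (\<lambda>_. if i = j then 1 else 0)"
  by (rule ext) (subst partial_eq[OF has_derivative_coord], simp add: axis_def)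

text \<open>
  A derivative of a product or of a composition is a sum of functions of the same kind. So
  smoothness is proved by coinduction up to finite sums: a class of differentiable functions whose
  partial derivatives are finite sums of members of the class consists of smooth functions.
\<close>

inductive_set sums_of :: "('a \<Rightarrow> complex) set \<Rightarrow> ('a \<Rightarrow> complex) set" for C where
  zero: "(\<lambda>_. 0) \<in> sums_of C"
| base: "f \<in> C \<Longrightarrow> f \<in> sums_of C"
| add: "f \<in> sums_of C \<Longrightarrow> g \<in> sums_of C \<Longrightarrow> (\<lambda>x. f x + g x) \<in> sums_of C"

lemma sums_of_sum:
  "(\<And>i. i \<in> I \<Longrightarrow> f i \<in> sums_of C) \<Longrightarrow> (\<lambda>x. \<Sum>i\<in>I. f i x) \<in> sums_of C"
  by (induction I rule: infinite_finite_induct) (auto intro: sums_of.intros)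

lemma sums_of_differentiable:
  assumes "\<And>f x. f \<in> C \<Longrightarrow> f differentiable (at x)" "f \<in> sums_of C"
  shows "f differentiable (at x)"
  using assms(2) by (induction) (auto intro: assms(1))

lemma sums_of_partial:
  assumes "\<And>f x. f \<in> C \<Longrightarrow> f differentiable (at x)"
    and "\<And>f i. f \<in> C \<Longrightarrow> partial i f \<in> sums_of C" and "f \<in> sums_of C"
  shows "partial i f \<in> sums_of C"
  using assms(3)
proof (induction)
  case (add f g)
  have "partial i (\<lambda>x. f x + g x) = (\<lambda>x. partial i f x + partial i g x)"
    using sums_of_differentiable[OF assms(1)] add.hyps by (intro ext partial_add) blast+
  then show ?case using add.IH by (simp add: sums_of.add)
qed (auto intro: sums_of.intros assms(2))

lemma sums_of_partials:
  assumes "\<And>f x. f \<in> C \<Longrightarrow> f differentiable (at x)"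
    and "\<And>f i. f \<in> C \<Longrightarrow> partial i f \<in> sums_of C" and "f \<in> sums_of C"
  shows "partials is f \<in> sums_of C"
  by (induction "is") (auto simp: partials_Cons intro: assms(3) sums_of_partial[OF assms(1,2)])

lemma smooth_coinduct:
  assumes "\<And>f x. f \<in> C \<Longrightarrow> f differentiable (at x)"
    and "\<And>f i. f \<in> C \<Longrightarrow> partial i f \<in> sums_of C" and "f \<in> sums_of C"
  shows "smooth f"
  unfolding smooth_def
  using sums_of_differentiable[OF assms(1) sums_of_partials[OF assms]] by blast

lemma smooth_differentiable: "smooth f \<Longrightarrow> f differentiable (at x)"
  unfolding smooth_def by (metis partials_Nil)

lemma smooth_partial: "smooth f \<Longrightarrow> smooth (partial i f)"
  unfolding smooth_def by (metis partials_snoc)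

lemma smooth_partials: "smooth f \<Longrightarrow> smooth (partials is f)"
  by (induction "is") (auto simp: partials_Cons smooth_partial)

lemma smooth_continuous: "smooth f \<Longrightarrow> continuous_on S f"
  by (meson continuous_at_imp_continuous_on differentiable_imp_continuous_within
      smooth_differentiable)

lemma smooth_measurable [measurable_dest]: "smooth f \<Longrightarrow> f \<in> borel_measurable borel"
  by (intro borel_measurable_continuous_onI smooth_continuous)

lemma smooth_const: "smooth (\<lambda>_. c)"
  by (rule smooth_coinduct[where C = "range (\<lambda>c _. c)"]) (auto intro: sums_of.intros)

lemma smooth_sums_of: "f \<in> sums_of {f. smooth f} \<Longrightarrow> smooth f"
  by (rule smooth_coinduct[where C = "{f. smooth f}"])
     (auto intro: sums_of.base smooth_partial smooth_differentiable)

lemma smooth_add: "smooth f \<Longrightarrow> smooth g \<Longrightarrow> smooth (\<lambda>x. f x + g x)"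
  by (intro smooth_sums_of) (simp add: sums_of.intros)

lemma smooth_sum: "(\<And>i. i \<in> I \<Longrightarrow> smooth (f i)) \<Longrightarrow> smooth (\<lambda>x. \<Sum>i\<in>I. f i x)"
  by (intro smooth_sums_of sums_of_sum) (simp add: sums_of.intros)

lemma smooth_mult:
  assumes "smooth f" "smooth g"
  shows "smooth (\<lambda>x. f x * g x)"
proof (rule smooth_coinduct[where C = "{\<lambda>x. f x * g x | f g. smooth f \<and> smooth g}"])
  fix h i
  assume "h \<in> {\<lambda>x. f x * g x | f g. smooth f \<and> smooth g}"
  then obtain f g where h: "h = (\<lambda>x. f x * g x)" "smooth f" "smooth g" by blast
  have "partial i h = (\<lambda>x. f x * partial i g x + partial i f x * g x)"
    unfolding h by (intro ext partial_mult smooth_differentiable h)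
  moreover have "(\<lambda>x. f x * partial i g x) \<in> {\<lambda>x. f x * g x | f g. smooth f \<and> smooth g}"
    using h smooth_partial by (intro CollectI exI[of _ f] exI[of _ "partial i g"]) auto
  moreover have "(\<lambda>x. partial i f x * g x) \<in> {\<lambda>x. f x * g x | f g. smooth f \<and> smooth g}"
    using h smooth_partial by (intro CollectI exI[of _ "partial i f"] exI[of _ g]) auto
  ultimately show "partial i h \<in> sums_of {\<lambda>x. f x * g x | f g. smooth f \<and> smooth g}"
    by (simp only: sums_of.intros)
qed (use assms in \<open>auto intro!: sums_of.base intro: differentiable_mult smooth_differentiable\<close>)

lemma smooth_cmult: "smooth f \<Longrightarrow> smooth (\<lambda>x. c * f x)"
  by (rule smooth_mult[OF smooth_const])

lemma smooth_minus: "smooth f \<Longrightarrow> smooth g \<Longrightarrow> smooth (\<lambda>x. f x - g x)"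
  using smooth_add[OF _ smooth_cmult[of g "-1"]] by simp

lemma smooth_prod: "(\<And>i. i \<in> I \<Longrightarrow> smooth (f i)) \<Longrightarrow> smooth (\<lambda>x. \<Prod>i\<in>I. f i x)"
  by (induction I rule: infinite_finite_induct) (auto intro: smooth_const smooth_mult)

lemma smooth_coord: "smooth (\<lambda>x. complex_of_real (x $ i))"
  by (rule smooth_coinduct[where C = "insert (\<lambda>x. of_real (x $ i)) (range (\<lambda>c _. c))"])
     (auto simp: partial_coord intro: sums_of.intros differentiable_coord)

lemma smooth_affine:
  fixes A :: "real ^ 'n::finite ^ 'm::finite"
  assumes "smooth f"
  shows "smooth (\<lambda>x. f (A *v x + b))"
proof (rule smooth_coinduct[where C = "{\<lambda>x. f (A *v x + b) | f. smooth f}"])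
  fix h j
  assume "h \<in> {\<lambda>x. f (A *v x + b) | f. smooth f}"
  then obtain f where h: "h = (\<lambda>x. f (A *v x + b))" "smooth f" by blast
  have "partial j h = (\<lambda>x. (\<lambda>y. \<Sum>i\<in>UNIV. of_real (A $ i $ j) * partial i f y) (A *v x + b))"
    unfolding h by (intro ext partial_affine smooth_differentiable h)
  moreover have "smooth (\<lambda>y. \<Sum>i\<in>UNIV. of_real (A $ i $ j) * partial i f y)"
    using h(2) by (intro smooth_sum smooth_cmult smooth_partial)
  ultimately show "partial j h \<in> sums_of {\<lambda>x. f (A *v x + b) | f. smooth f}"
    by (intro sums_of.base CollectI exI conjI)
qed (use assms in \<open>auto intro!: sums_of.base intro: differentiable_affine[OF smooth_differentiable]\<close>)

lemma smooth_linear: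
  "smooth f \<Longrightarrow> smooth (\<lambda>x. f (A *v x))" for A :: "real ^ 'n::finite ^ 'm::finite"
  using smooth_affine[of f A 0] by simp

lemma smooth_translation: "smooth f \<Longrightarrow> smooth (\<lambda>x. f (x + b))"
  using smooth_affine[of f "mat 1" b] by simp

lemma has_derivative_cis_inner:
  "((\<lambda>x. cis (2 * pi * (w \<bullet> x))) has_derivative
    (\<lambda>h. of_real (2 * pi * (w \<bullet> h)) * \<i> * cis (2 * pi * (w \<bullet> x)))) (at x)"
proof -
  have *: "((\<lambda>x. \<i> * complex_of_real (2 * pi * (w \<bullet> x))) has_derivative
      (\<lambda>h. \<i> * complex_of_real (2 * pi * (w \<bullet> h)))) (at x)"
    by (auto intro!: derivative_eq_intros)
  show ?thesis
    unfolding cis_conv_exp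
    by (rule has_derivative_eq_rhs[OF has_derivative_compose[OF *
          DERIV_exp[THEN has_field_derivative_imp_has_derivative]]]) (simp add: fun_eq_iff mult_ac)
qed

lemma partial_cis:
  "partial j (\<lambda>x. cis (2 * pi * (w \<bullet> x))) =
    (\<lambda>x. (of_real (2 * pi * w $ j) * \<i>) * cis (2 * pi * (w \<bullet> x)))"
  by (rule ext) (subst partial_eq[OF has_derivative_cis_inner], simp add: inner_axis)

lemma differentiable_cis: "(\<lambda>x. cis (2 * pi * (w \<bullet> x))) differentiable (at x)"
  using has_derivative_cis_inner unfolding differentiable_def by blast

lemma smooth_cis: "smooth (\<lambda>x. cis (2 * pi * (w \<bullet> x)))"
proof (rule smooth_coinduct[where C = "range (\<lambda>c x. c * cis (2 * pi * (w \<bullet> x)))"])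
  fix h j
  assume "h \<in> range (\<lambda>c x. c * cis (2 * pi * (w \<bullet> x)))"
  then obtain c where h: "h = (\<lambda>x. c * cis (2 * pi * (w \<bullet> x)))" by blast
  have "partial j h = (\<lambda>x. (c * (of_real (2 * pi * w $ j) * \<i>)) * cis (2 * pi * (w \<bullet> x)))"
    unfolding h by (rule ext) (subst partial_cmult[OF differentiable_cis], simp add: partial_cis)
  then show "partial j h \<in> sums_of (range (\<lambda>c x. c * cis (2 * pi * (w \<bullet> x))))"
    by (intro sums_of.base) blast
next
  show "(\<lambda>x. cis (2 * pi * (w \<bullet> x))) \<in> sums_of (range (\<lambda>c x. c * cis (2 * pi * (w \<bullet> x))))"
    by (intro sums_of.base image_eqI[of _ _ 1]) auto
qed (auto intro!: differentiable_mult differentiable_cis)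

text \<open>
  The class of the functions \<open>h / g ^ m\<close> is stable under derivatives up to finite sums.
\<close>

lemma smooth_inverse:
  assumes g: "smooth g" "\<And>x. g x \<noteq> 0"
  shows "smooth (\<lambda>x. inverse (g x))"
proof -
  have D: "((\<lambda>x. inverse (g x)) has_derivative
      (\<lambda>h. - (inverse (g x) * (\<Sum>i\<in>UNIV. of_real (h $ i) * partial i g x) * inverse (g x)))) (at x)"
    for x
    by (intro Deriv.has_derivative_inverse g has_derivative_partial smooth_differentiable)
  have d: "(\<lambda>x. inverse (g x) ^ m) differentiable (at x)" for x m
    using D by (intro differentiable_power) (auto simp: differentiable_def)
  have p: "partial j (\<lambda>x. inverse (g x) ^ m) x =
      of_nat m * (- partial j g x) * inverse (g x) ^ Suc m" for j x m
  proof (induction m)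
    case (Suc m)
    have "partial j (\<lambda>x. inverse (g x)) x = - partial j g x * inverse (g x) ^ 2"
      by (subst partial_eq[OF D])
         (simp add: axis_def if_distrib if_distribR power2_eq_square cong: if_cong)
    then show ?case
      using partial_mult[OF d[of 1 x] d[of m x], of j] Suc
      by (simp add: algebra_simps power2_eq_square)
  qed simp
  let ?C = "{\<lambda>x. h x * inverse (g x) ^ m | h m. smooth h}"
  show ?thesis
  proof (rule smooth_coinduct[where C = ?C])
    fix f i
    assume "f \<in> ?C"
    then obtain h m where f: "f = (\<lambda>x. h x * inverse (g x) ^ m)" "smooth h" by blast
    define k where "k = (\<lambda>x. h x * (of_nat m * (- 1 * partial i g x)))"
    have "partial i f = (\<lambda>x. k x * inverse (g x) ^ Suc m + partial i h x * inverse (g x) ^ m)"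
      unfolding f k_def
      by (rule ext) (subst partial_mult[OF smooth_differentiable[OF f(2)] d], simp add: p)
    moreover have "smooth k"
      unfolding k_def using g f by (intro smooth_mult smooth_const smooth_partial)
    then have "(\<lambda>x. k x * inverse (g x) ^ Suc m) \<in> ?C" by blast
    moreover have "(\<lambda>x. partial i h x * inverse (g x) ^ m) \<in> ?C"
      using smooth_partial[OF f(2)] by blast
    ultimately show "partial i f \<in> sums_of ?C"
      by (simp only: sums_of.intros)
  next
    show "(\<lambda>x. inverse (g x)) \<in> sums_of ?C"
      by (intro sums_of.base CollectI exI[of _ "\<lambda>_. 1"] exI[of _ 1]) (simp add: smooth_const)
  qed (auto intro!: differentiable_mult d intro: smooth_differentiable)
qed

section \<open>Schwartz functions\<close>

lemma partials_add:
  assumes "smooth f" "smooth g"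
  shows "partials is (\<lambda>x. f x + g x) = (\<lambda>x. partials is f x + partials is g x)"
  using assms
  by (induction "is")
     (auto simp: partials_Cons intro!: ext partial_add smooth_differentiable smooth_partials)

lemma partials_cmult:
  assumes "smooth f"
  shows "partials is (\<lambda>x. c * f x) = (\<lambda>x. c * partials is f x)"
  using assms
  by (induction "is")
     (auto simp: partials_Cons intro!: ext partial_cmult smooth_differentiable smooth_partials)

lemma partials_minus:
  assumes "smooth f" "smooth g"
  shows "partials is (\<lambda>x. f x - g x) = (\<lambda>x. partials is f x - partials is g x)"
  using partials_add[OF assms(1) smooth_cmult[OF assms(2), of "-1"]]
    partials_cmult[OF assms(2), of "is" "-1"] by simp

lemma partials_zero [simp]: "partials is (\<lambda>_. 0) = (\<lambda>_. 0)"
  by (induction "is") (simp_all add: partials_Cons)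

lemma schwartzI:
  assumes "smooth f" "\<And>k is. \<exists>M. \<forall>x. (1 + norm x) ^ k * cmod (partials is f x) \<le> M"
  shows "f \<in> schwartz"
  using assms unfolding schwartz_def bdd_above_def by fast

lemma schwartz_smooth: "f \<in> schwartz \<Longrightarrow> smooth f"
  by (simp add: schwartz_def)

lemmas schwartz_differentiable = smooth_differentiable[OF schwartz_smooth]

lemma sw_seminorm_upper:
  assumes "f \<in> schwartz"
  shows "(1 + norm x) ^ k * cmod (partials is f x) \<le> sw_seminorm k is f"
  using assms unfolding schwartz_def sw_seminorm_def by (intro cSUP_upper) auto

lemma sw_seminorm_upper0:
  "f \<in> schwartz \<Longrightarrow> (1 + norm x) ^ k * cmod (f x) \<le> sw_seminorm k [] f"
  using sw_seminorm_upper[of f x k "[]"] by simp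

lemma sw_seminorm_nonneg: "f \<in> schwartz \<Longrightarrow> 0 \<le> sw_seminorm k is f"
  using sw_seminorm_upper[of f 0 k "is"] by (simp add: order_trans[OF norm_ge_zero])

lemma sw_seminorm_le:
  "(\<And>x. (1 + norm x) ^ k * cmod (partials is f x) \<le> M) \<Longrightarrow> sw_seminorm k is f \<le> M"
  unfolding sw_seminorm_def by (rule cSUP_least) auto

text \<open>
  The Schwartz space is the largest class of bounded differentiable functions that is stable under
  partial derivatives and under multiplication by the coordinates. As for smoothness, it is enough
  that the results be finite sums of members of the class.
\<close>

lemma schwartz_coinduct:
  assumes diff: "\<And>f x. f \<in> C \<Longrightarrow> f differentiable (at x)"
    and bdd: "\<And>f. f \<in> C \<Longrightarrow> \<exists>M. \<forall>x. cmod (f x) \<le> M"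
    and part: "\<And>f i. f \<in> C \<Longrightarrow> partial i f \<in> sums_of C"
    and coord: "\<And>f i. f \<in> C \<Longrightarrow> (\<lambda>x. of_real (x $ i) * f x) \<in> sums_of C"
    and f: "f \<in> sums_of C"
  shows "f \<in> schwartz"
proof (rule schwartzI)
  show "smooth f" by (rule smooth_coinduct[OF diff part f])
  have coords: "(\<lambda>x. of_real (x $ i) * g x) \<in> sums_of C" if "g \<in> sums_of C" for g i
    using that
  proof (induction)
    case zero
    show ?case by (simp add: sums_of.zero)
  next
    case (add f g)
    then show ?case by (simp add: distrib_left sums_of.add)
  qed (rule coord)
  have bounds: "\<exists>M. \<forall>x. cmod (g x) \<le> M" if "g \<in> sums_of C" for g
    using that
  proof (induction)
    case (add f g)
    then obtain M N where "\<forall>x. cmod (f x) \<le> M" "\<forall>x. cmod (g x) \<le> N" by blast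
    then have "\<forall>x. cmod (f x + g x) \<le> M + N" by (meson add_mono norm_triangle_le)
    then show ?case by blast
  qed (auto intro: bdd)
  have decay: "\<exists>M. \<forall>x. (1 + norm x) ^ k * cmod (g x) \<le> M" if "g \<in> sums_of C" for g k
    using that
  proof (induction k arbitrary: g)
    case 0
    then show ?case using bounds by simp
  next
    case (Suc k)
    obtain M where M: "\<And>x. (1 + norm x) ^ k * cmod (g x) \<le> M" using Suc by blast
    have "\<forall>i. \<exists>N. \<forall>x. (1 + norm x) ^ k * cmod (of_real (x $ i) * g x) \<le> N"
      using Suc.IH[OF coords[OF Suc.prems]] by blast
    then obtain N where N: "\<And>i x. (1 + norm x) ^ k * cmod (of_real (x $ i) * g x) \<le> N i"
      by metis
    have "(1 + norm x) ^ Suc k * cmod (g x) \<le> M + (\<Sum>i\<in>UNIV. N i)" for x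
    proof -
      have "(1 + norm x) ^ Suc k * cmod (g x) \<le>
          (1 + norm x) ^ k * cmod (g x) + norm x * ((1 + norm x) ^ k * cmod (g x))"
        by (simp add: algebra_simps)
      also have "norm x * ((1 + norm x) ^ k * cmod (g x)) \<le>
          (\<Sum>i\<in>UNIV. \<bar>x $ i\<bar>) * ((1 + norm x) ^ k * cmod (g x))"
        by (intro mult_right_mono norm_le_l1_cart) auto
      also have "\<dots> = (\<Sum>i\<in>UNIV. (1 + norm x) ^ k * cmod (of_real (x $ i) * g x))"
        by (simp add: sum_distrib_left sum_distrib_right norm_mult mult_ac)
      also have "\<dots> \<le> (\<Sum>i\<in>UNIV. N i)" by (intro sum_mono N)
      finally show ?thesis using M[of x] by linarith
    qed
    then show ?case by blast
  qed
  show "\<exists>M. \<forall>x. (1 + norm x) ^ k * cmod (partials is f x) \<le> M" for k "is"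
    by (rule decay[OF sums_of_partials[OF diff part f]])
qed

lemma schwartz_zero: "(\<lambda>_. 0) \<in> schwartz"
  by (rule schwartzI) (auto intro: smooth_const)

lemma schwartz_partial: "f \<in> schwartz \<Longrightarrow> partial i f \<in> schwartz"
  unfolding schwartz_def by (auto simp: smooth_partial simp flip: partials_snoc)

lemma schwartz_add:
  assumes "f \<in> schwartz" "g \<in> schwartz"
  shows "(\<lambda>x. f x + g x) \<in> schwartz"
proof (rule schwartzI)
  fix k "is"
  have "(1 + norm x) ^ k * cmod (partials is f x + partials is g x) \<le>
      sw_seminorm k is f + sw_seminorm k is g" for x
  proof -
    have "(1 + norm x) ^ k * cmod (partials is f x + partials is g x) \<le>
        (1 + norm x) ^ k * (cmod (partials is f x) + cmod (partials is g x))"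
      by (intro mult_left_mono norm_triangle_ineq) auto
    then show ?thesis
      using sw_seminorm_upper[OF assms(1), of x k "is"] sw_seminorm_upper[OF assms(2), of x k "is"]
      by (simp add: distrib_left)
  qed
  then show "\<exists>M. \<forall>x. (1 + norm x) ^ k * cmod (partials is (\<lambda>x. f x + g x) x) \<le> M"
    using assms by (auto simp: partials_add schwartz_smooth)
qed (use assms in \<open>auto intro: smooth_add schwartz_smooth\<close>)

lemma sw_seminorm_cmult_bound:
  assumes "f \<in> schwartz"
  shows "(1 + norm x) ^ k * cmod (partials is (\<lambda>x. c * f x) x) \<le> cmod c * sw_seminorm k is f"
  using mult_left_mono[OF sw_seminorm_upper[OF assms, of x k "is"], of "cmod c"]
  by (simp add: partials_cmult schwartz_smooth[OF assms] norm_mult mult_ac)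

lemma schwartz_cmult: "f \<in> schwartz \<Longrightarrow> (\<lambda>x. c * f x) \<in> schwartz"
  by (rule schwartzI) (auto intro: smooth_cmult schwartz_smooth sw_seminorm_cmult_bound)

lemma schwartz_minus:
  "f \<in> schwartz \<Longrightarrow> g \<in> schwartz \<Longrightarrow> (\<lambda>x. f x - g x) \<in> schwartz"
  using schwartz_add[OF _ schwartz_cmult[of g "-1"]] by simp

lemma schwartz_sum: "(\<And>i. i \<in> I \<Longrightarrow> f i \<in> schwartz) \<Longrightarrow> (\<lambda>x. \<Sum>i\<in>I. f i x) \<in> schwartz"
  by (induction I rule: infinite_finite_induct) (auto intro: schwartz_zero schwartz_add)

lemma sw_seminorm_triangle:
  assumes "f \<in> schwartz" "g \<in> schwartz"
  shows "sw_seminorm k is (\<lambda>x. f x + g x) \<le> sw_seminorm k is f + sw_seminorm k is g"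
proof (rule sw_seminorm_le)
  fix x
  have "(1 + norm x) ^ k * cmod (partials is f x + partials is g x) \<le>
      (1 + norm x) ^ k * (cmod (partials is f x) + cmod (partials is g x))"
    by (intro mult_left_mono norm_triangle_ineq) auto
  then show "(1 + norm x) ^ k * cmod (partials is (\<lambda>x. f x + g x) x) \<le>
      sw_seminorm k is f + sw_seminorm k is g"
    using sw_seminorm_upper[OF assms(1), of x k "is"] sw_seminorm_upper[OF assms(2), of x k "is"]
    by (simp add: distrib_left partials_add schwartz_smooth assms)
qed

text \<open>
  By the Leibniz rule a derivative of \<open>e \<cdot> f\<close> involves only finitely many derivatives of \<open>e\<close>, and
  the decay of \<open>f\<close> absorbs a growth of \<open>e\<close> of fixed order. The estimate is linear in the size
  \<open>\<epsilon>\<close> of these derivatives, so that it gives continuity as well.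
\<close>

lemma schwartz_mult_estimate:
  assumes "f \<in> schwartz"
  shows "\<exists>M J. finite J \<and> (\<forall>e \<epsilon> x. smooth e \<longrightarrow>
    (\<forall>js\<in>J. \<forall>x. cmod (partials js e x) \<le> \<epsilon> * (1 + norm x) ^ m) \<longrightarrow>
    (1 + norm x) ^ k * cmod (partials is (\<lambda>x. e x * f x) x) \<le> M * \<epsilon>)"
  using assms
proof (induction "is" arbitrary: f rule: rev_induct)
  case Nil
  have "(1 + norm x) ^ k * cmod (e x * f x) \<le> sw_seminorm (m + k) [] f * \<epsilon>"
    if "\<forall>x. cmod (e x) \<le> \<epsilon> * (1 + norm x) ^ m" for e \<epsilon> x
  proof -
    have "0 \<le> \<epsilon>"
      using order_trans[OF norm_ge_zero that[rule_format, of 0]] by simp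
    have "(1 + norm x) ^ k * cmod (e x * f x) \<le>
        (1 + norm x) ^ k * (\<epsilon> * (1 + norm x) ^ m * cmod (f x))"
      using that by (simp add: norm_mult mult_left_mono mult_right_mono)
    also have "\<dots> = \<epsilon> * ((1 + norm x) ^ (m + k) * cmod (f x))"
      by (simp add: power_add)
    also have "\<dots> \<le> \<epsilon> * sw_seminorm (m + k) [] f"
      using sw_seminorm_upper0[OF Nil] \<open>0 \<le> \<epsilon>\<close> by (rule mult_left_mono)
    finally show ?thesis by (simp add: mult.commute)
  qed
  then show ?case
    by (intro exI[of _ "sw_seminorm (m + k) [] f"] exI[of _ "{[]}"]) simp
next
  case (snoc i "is")
  obtain M1 J1 where 1: "finite J1" "\<forall>e \<epsilon> x. smooth e \<longrightarrow>
      (\<forall>js\<in>J1. \<forall>x. cmod (partials js e x) \<le> \<epsilon> * (1 + norm x) ^ m) \<longrightarrow>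
      (1 + norm x) ^ k * cmod (partials is (\<lambda>x. e x * f x) x) \<le> M1 * \<epsilon>"
    using snoc.IH[OF snoc.prems] by (elim exE conjE)
  obtain M2 J2 where 2: "finite J2" "\<forall>e \<epsilon> x. smooth e \<longrightarrow>
      (\<forall>js\<in>J2. \<forall>x. cmod (partials js e x) \<le> \<epsilon> * (1 + norm x) ^ m) \<longrightarrow>
      (1 + norm x) ^ k * cmod (partials is (\<lambda>x. e x * partial i f x) x) \<le> M2 * \<epsilon>"
    using snoc.IH[OF schwartz_partial[OF snoc.prems, of i]] by (elim exE conjE)
  show ?case
  proof (intro exI[of _ "M2 + M1"] exI[of _ "(\<lambda>js. js @ [i]) ` J1 \<union> J2"] conjI allI impI)
    fix e \<epsilon> x
    assume e: "smooth e"
      and le: "\<forall>js\<in>(\<lambda>js. js @ [i]) ` J1 \<union> J2. \<forall>x. cmod (partials js e x) \<le> \<epsilon> * (1 + norm x) ^ m"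
    have sm: "smooth (\<lambda>x. e x * partial i f x)" "smooth (\<lambda>x. partial i e x * f x)"
      by (intro smooth_mult smooth_partial schwartz_smooth[OF snoc.prems] e)+
    have eq: "partial i (\<lambda>x. e x * f x) = (\<lambda>x. e x * partial i f x + partial i e x * f x)"
      using e snoc.prems
      by (intro ext partial_mult smooth_differentiable) (auto intro: schwartz_smooth)
    have "(1 + norm x) ^ k * cmod (partials (is @ [i]) (\<lambda>x. e x * f x) x) \<le>
        (1 + norm x) ^ k * (cmod (partials is (\<lambda>x. e x * partial i f x) x)
          + cmod (partials is (\<lambda>x. partial i e x * f x) x))"
      unfolding partials_snoc eq partials_add[OF sm] by (intro mult_left_mono norm_triangle_ineq) auto
    moreover have "(1 + norm x) ^ k * cmod (partials is (\<lambda>x. e x * partial i f x) x) \<le> M2 * \<epsilon>"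
      using 2(2)[rule_format, OF e, of \<epsilon> x] le by simp
    moreover have "(1 + norm x) ^ k * cmod (partials is (\<lambda>x. partial i e x * f x) x) \<le> M1 * \<epsilon>"
    proof (rule 1(2)[rule_format, OF smooth_partial[OF e]])
      fix js y
      assume "js \<in> J1"
      then show "cmod (partials js (partial i e) y) \<le> \<epsilon> * (1 + norm y) ^ m"
        using le[rule_format, of "js @ [i]" y] by (simp add: partials_snoc)
    qed
    ultimately show "(1 + norm x) ^ k * cmod (partials (is @ [i]) (\<lambda>x. e x * f x) x) \<le> (M2 + M1) * \<epsilon>"
      by (simp add: distrib_left distrib_right)
  qed (use 1 2 in simp)
qed

lemma schwartz_mult:
  assumes f: "f \<in> schwartz" and e: "smooth e"
    and growth: "\<And>js. \<exists>M. \<forall>x. cmod (partials js e x) \<le> M * (1 + norm x) ^ m"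
  shows "(\<lambda>x. e x * f x) \<in> schwartz"
proof (rule schwartzI)
  fix k "is"
  obtain M J where J: "finite J" "\<forall>e \<epsilon> x. smooth e \<longrightarrow>
      (\<forall>js\<in>J. \<forall>x. cmod (partials js e x) \<le> \<epsilon> * (1 + norm x) ^ m) \<longrightarrow>
      (1 + norm x) ^ k * cmod (partials is (\<lambda>x. e x * f x) x) \<le> M * \<epsilon>"
    using schwartz_mult_estimate[OF f, of m k "is"] by (elim exE conjE)
  obtain N where N: "\<And>js x. cmod (partials js e x) \<le> N js * (1 + norm x) ^ m"
    using growth by metis
  have "cmod (partials js e x) \<le> (\<Sum>js\<in>J. \<bar>N js\<bar>) * (1 + norm x) ^ m" if "js \<in> J" for js x
  proof -
    have "N js \<le> (\<Sum>js\<in>J. \<bar>N js\<bar>)"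
      using member_le_sum[OF that, of "\<lambda>js. \<bar>N js\<bar>"] J(1) by auto
    then show ?thesis
      by (intro order_trans[OF N mult_right_mono]) auto
  qed
  then have "(1 + norm x) ^ k * cmod (partials is (\<lambda>x. e x * f x) x) \<le> M * (\<Sum>js\<in>J. \<bar>N js\<bar>)" for x
    by (intro J(2)[rule_format, OF e])
  then show "\<exists>M. \<forall>x. (1 + norm x) ^ k * cmod (partials is (\<lambda>x. e x * f x) x) \<le> M"
    by blast
qed (use f e in \<open>auto intro: smooth_mult schwartz_smooth\<close>)

lemma schwartz_coord:
  assumes "f \<in> schwartz"
  shows "(\<lambda>x. of_real (x $ i) * f x) \<in> schwartz"
proof (rule schwartz_mult[where m = 1])
  fix js
  have "partials js (\<lambda>x. complex_of_real (x $ i)) \<in>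
      insert (\<lambda>x. of_real (x $ i)) {\<lambda>_. c | c. cmod c \<le> 1}"
    by (induction js) (auto simp: partials_Cons partial_coord)
  then have "cmod (partials js (\<lambda>x. of_real (x $ i)) x) \<le> 1 * (1 + norm x) ^ 1" for x
    using component_le_norm_cart[of x i] by (auto intro: add_increasing2)
  then show "\<exists>M. \<forall>x. cmod (partials js (\<lambda>x. of_real (x $ i)) x) \<le> M * (1 + norm x) ^ 1"
    by blast
qed (use assms smooth_coord in auto)

lemma schwartz_bounded: "f \<in> schwartz \<Longrightarrow> \<exists>M. \<forall>x. cmod (f x) \<le> M"
  using sw_seminorm_upper0[of f _ 0] by auto

text \<open>
  A left inverse of \<open>A\<close> recovers the coordinates of \<open>x\<close> from those of \<open>A x + b\<close>, so the compositions with a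
  fixed affine map form a class as in the coinduction principle. Injective maps that are not onto are
  included since they give the restriction to an affine subspace.
\<close>

lemma schwartz_affine:
  fixes A :: "real ^ 'n::finite ^ 'm::finite"
  assumes "f \<in> schwartz" and A': "A' ** A = mat 1"
  shows "(\<lambda>x. f (A *v x + b)) \<in> schwartz"
proof (rule schwartz_coinduct[where C = "{\<lambda>x. f (A *v x + b) | f. f \<in> schwartz}"])
  fix h j
  assume "h \<in> {\<lambda>x. f (A *v x + b) | f. f \<in> schwartz}"
  then obtain f where h: "h = (\<lambda>x. f (A *v x + b))" "f \<in> schwartz" by blast
  let ?g = "\<lambda>y. \<Sum>i\<in>UNIV. of_real (A $ i $ j) * partial i f y"
  have "partial j h = (\<lambda>x. ?g (A *v x + b))"
    unfolding h by (intro ext partial_affine schwartz_differentiable h)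
  moreover have "?g \<in> schwartz"
    using h(2) by (intro schwartz_sum schwartz_cmult schwartz_partial)
  ultimately show "partial j h \<in> sums_of {\<lambda>x. f (A *v x + b) | f. f \<in> schwartz}"
    by (intro sums_of.base CollectI exI conjI)
  let ?k = "\<lambda>y. (\<Sum>l\<in>UNIV. of_real (A' $ j $ l) * (of_real (y $ l) * f y)) +
    - of_real ((A' *v b) $ j) * f y"
  have E: "x $ j = (\<Sum>l\<in>UNIV. A' $ j $ l * (A *v x + b) $ l) - (A' *v b) $ j" for x
  proof -
    have "x = A' *v (A *v x + b) - A' *v b"
      by (simp add: matrix_vector_right_distrib matrix_vector_mul_assoc A')
    then have "x $ j = (A' *v (A *v x + b)) $ j - (A' *v b) $ j"
      by (metis vector_minus_component)
    also have "(A' *v (A *v x + b)) $ j = (\<Sum>l\<in>UNIV. A' $ j $ l * (A *v x + b) $ l)"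
      unfolding matrix_vector_mult_def[of A'] by simp
    finally show ?thesis .
  qed
  have E': "complex_of_real (x $ j) =
      (\<Sum>l\<in>UNIV. of_real (A' $ j $ l) * of_real ((A *v x + b) $ l)) - of_real ((A' *v b) $ j)" for x
    using arg_cong[OF E[of x], of complex_of_real]
    by (simp only: of_real_diff of_real_mult of_real_sum)
  have "of_real (x $ j) * h x = ?k (A *v x + b)" for x
    unfolding h E'[of x] left_diff_distrib sum_distrib_right mult.assoc by simp
  then have "(\<lambda>x. of_real (x $ j) * h x) = (\<lambda>x. ?k (A *v x + b))" ..
  moreover have "?k \<in> schwartz"
    using h(2) by (intro schwartz_add schwartz_sum schwartz_cmult schwartz_coord)
  ultimately show "(\<lambda>x. of_real (x $ j) * h x) \<in> sums_of {\<lambda>x. f (A *v x + b) | f. f \<in> schwartz}"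
    by (intro sums_of.base CollectI exI conjI)
  show "\<exists>M. \<forall>x. cmod (h x) \<le> M"
    using schwartz_bounded[OF h(2)] unfolding h by blast
qed (use assms in \<open>auto intro!: sums_of.base intro: differentiable_affine[OF schwartz_differentiable]\<close>)

lemma schwartz_translation: "f \<in> schwartz \<Longrightarrow> (\<lambda>x. f (x + b)) \<in> schwartz"
  using schwartz_affine[of f "mat 1" "mat 1" b] by simp

lemma schwartz_modulation:
  assumes "f \<in> schwartz"
  shows "(\<lambda>x. cis (2 * pi * (w \<bullet> x)) * f x) \<in> schwartz"
proof (rule schwartz_mult[where m = 0])
  fix js
  have "partials js (\<lambda>x. cis (2 * pi * (w \<bullet> x))) \<in> range (\<lambda>c x. c * cis (2 * pi * (w \<bullet> x)))"
  proof (induction js)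
    case Nil
    then show ?case by (auto intro!: image_eqI[of _ _ 1])
  next
    case (Cons j js)
    then obtain c where "partials js (\<lambda>x. cis (2 * pi * (w \<bullet> x))) = (\<lambda>x. c * cis (2 * pi * (w \<bullet> x)))"
      by blast
    then have "partials (j # js) (\<lambda>x. cis (2 * pi * (w \<bullet> x))) =
        (\<lambda>x. (c * (of_real (2 * pi * w $ j) * \<i>)) * cis (2 * pi * (w \<bullet> x)))"
      by (intro ext) (simp add: partials_Cons partial_cmult[OF differentiable_cis] partial_cis)
    then show ?case by blast
  qed
  then show "\<exists>M. \<forall>x. cmod (partials js (\<lambda>x. cis (2 * pi * (w \<bullet> x))) x) \<le> M * (1 + norm x) ^ 0"
    by (auto simp: norm_mult)
qed (use assms smooth_cis in auto)

lemma vfst_eq: "vfst z = (\<chi> a. axis (Inl a) 1) *v z"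
  and vsnd_eq: "vsnd z = (\<chi> b. axis (Inr b) 1) *v z"
  by (simp_all add: vec_eq_iff vfst_def vsnd_def matrix_vector_mult_def axis_def
      if_distrib if_distribR cong: if_cong)

text \<open>
  A derivative in a coordinate direction, or the multiplication by a coordinate, acts on one of the two
  factors only.
\<close>

lemma schwartz_tensor:
  fixes f :: "real ^ 'a::finite \<Rightarrow> complex" and g :: "real ^ 'b::finite \<Rightarrow> complex"
  assumes "f \<in> schwartz" "g \<in> schwartz"
  shows "(\<lambda>z. f (vfst z) * g (vsnd z)) \<in> schwartz"
proof (rule schwartz_coinduct[where
      C = "{\<lambda>z :: real ^ ('a + 'b). f (vfst z) * g (vsnd z) | f g. f \<in> schwartz \<and> g \<in> schwartz}"])
  let ?C = "{\<lambda>z :: real ^ ('a + 'b). f (vfst z) * g (vsnd z) | f g. f \<in> schwartz \<and> g \<in> schwartz}"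
  let ?P = "(\<chi> a. axis (Inl a) 1) :: real ^ ('a + 'b) ^ 'a"
  let ?Q = "(\<chi> b. axis (Inr b) 1) :: real ^ ('a + 'b) ^ 'b"
  fix h :: "real ^ ('a + 'b) \<Rightarrow> complex" and x and i :: "'a + 'b"
  assume "h \<in> ?C"
  then obtain f g where h: "h = (\<lambda>z. f (vfst z) * g (vsnd z))" "f \<in> schwartz" "g \<in> schwartz"
    by blast
  have C: "(\<lambda>z. f (vfst z) * g (vsnd z)) \<in> ?C" if "f \<in> schwartz" "g \<in> schwartz"
    for f :: "real ^ 'a \<Rightarrow> complex" and g :: "real ^ 'b \<Rightarrow> complex"
    using that by (intro CollectI exI[of _ f] exI[of _ g]) auto
  have df: "(\<lambda>z. f (vfst z)) differentiable (at z)" and dg: "(\<lambda>z. g (vsnd z)) differentiable (at z)"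
    for z :: "real ^ ('a + 'b)"
    using smooth_differentiable[OF smooth_linear[OF schwartz_smooth[OF h(2)], of ?P], of z]
      smooth_differentiable[OF smooth_linear[OF schwartz_smooth[OF h(3)], of ?Q], of z]
    by (simp_all add: vfst_eq vsnd_eq)
  show "h differentiable (at x)" unfolding h by (intro differentiable_mult df dg)
  have pf: "partial i (\<lambda>z. f (vfst z)) z = (\<Sum>a\<in>UNIV. of_real (?P $ a $ i) * partial a f (vfst z))"
    and pg: "partial i (\<lambda>z. g (vsnd z)) z = (\<Sum>b\<in>UNIV. of_real (?Q $ b $ i) * partial b g (vsnd z))"
    for z :: "real ^ ('a + 'b)"
    using partial_affine[OF schwartz_differentiable[OF h(2)], where A = ?P and b = 0]
      partial_affine[OF schwartz_differentiable[OF h(3)], where A = ?Q and b = 0]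
    unfolding vfst_eq vsnd_eq by simp_all
  have "partial i h = (\<lambda>z. (\<lambda>x. f x) (vfst z) * (\<Sum>b\<in>UNIV. of_real (?Q $ b $ i) * partial b g (vsnd z)) +
      (\<Sum>a\<in>UNIV. of_real (?P $ a $ i) * partial a f (vfst z)) * g (vsnd z))"
    unfolding h by (rule ext) (simp only: partial_mult[OF df dg] pf pg)
  moreover have "(\<lambda>y. \<Sum>b\<in>UNIV. of_real (?Q $ b $ i) * partial b g y) \<in> schwartz"
      "(\<lambda>y. \<Sum>a\<in>UNIV. of_real (?P $ a $ i) * partial a f y) \<in> schwartz"
    using h(2,3)
    by (auto intro!: schwartz_sum schwartz_cmult schwartz_partial simp del: vec_lambda_beta)
  ultimately show "partial i h \<in> sums_of ?C"
    using sums_of.add[OF sums_of.base[OF C[OF h(2)]] sums_of.base[OF C[OF _ h(3)]]] by simp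
  show "(\<lambda>x. of_real (x $ i) * h x) \<in> sums_of ?C"
  proof (cases i)
    case (Inl a)
    have "(\<lambda>z. of_real (z $ i) * h z) = (\<lambda>z. (\<lambda>x. of_real (x $ a) * f x) (vfst z) * g (vsnd z))"
      by (simp add: h Inl vfst_def mult_ac)
    with sums_of.base[OF C[OF schwartz_coord[OF h(2), of a] h(3)]] show ?thesis
      by simp
  next
    case (Inr b)
    have "(\<lambda>z. of_real (z $ i) * h z) = (\<lambda>z. f (vfst z) * (\<lambda>x. of_real (x $ b) * g x) (vsnd z))"
      by (simp add: h Inr vsnd_def mult_ac)
    with sums_of.base[OF C[OF h(2) schwartz_coord[OF h(3), of b]]] show ?thesis
      by simp
  qed
  obtain M N where "\<And>x. cmod (f x) \<le> M" "\<And>x. cmod (g x) \<le> N"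
    using schwartz_bounded h by metis
  then have "\<forall>z. cmod (h z) \<le> M * N"
    unfolding h norm_mult by (meson mult_mono norm_ge_zero order_trans)
  then show "\<exists>M. \<forall>z. cmod (h z) \<le> M" by blast
qed (use assms in \<open>auto intro!: sums_of.base\<close>)

section \<open>Integration on coordinate space\<close>

lemma Basis_vec_real: "(Basis :: (real ^ 'n::finite) set) = range (\<lambda>i. axis i 1)"
  by (auto simp: Basis_vec_def)

lemma bij_betw_axis_Basis: "bij_betw (\<lambda>i. axis i 1) UNIV (Basis :: (real ^ 'n::finite) set)"
  unfolding bij_betw_def Basis_vec_real by (auto simp: inj_on_def axis_eq_axis)

lemma
  fixes f :: "'n::finite \<Rightarrow> real \<Rightarrow> 'c::{real_normed_field, banach, second_countable_topology}"
  assumes int: "\<And>i. integrable lborel (f i)"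
  shows integrable_prod_coords: "integrable lborel (\<lambda>x :: real ^ 'n. \<Prod>i\<in>UNIV. f i (x $ i))"
    and integral_prod_coords:
      "(\<integral>x. (\<Prod>i\<in>UNIV. f i (x $ i)) \<partial>(lborel :: (real ^ 'n) measure)) = (\<Prod>i\<in>UNIV. \<integral>t. f i t \<partial>lborel)"
proof -
  interpret product_sigma_finite "\<lambda>_ :: real ^ 'n. lborel :: real measure" by standard
  define F where "F b = f (inv (\<lambda>i. axis i 1) b)" for b :: "real ^ 'n"
  let ?T = "\<lambda>g. \<Sum>b\<in>(Basis :: (real ^ 'n) set). g b *\<^sub>R b"
  have inj: "inj (\<lambda>i. axis i 1 :: real ^ 'n)"
    by (auto simp: inj_on_def axis_eq_axis)
  have F: "F (axis i 1) = f i" for i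
    unfolding F_def by (simp add: inv_f_f[OF inj])
  have intF: "integrable lborel (F b)" if "b \<in> Basis" for b
    using that int unfolding Basis_vec_real by (auto simp: F)
  have [measurable]: "f i \<in> borel_measurable borel" for i
    using borel_measurable_integrable[OF int[of i]] by simp
  have eq: "(\<Prod>i\<in>UNIV. f i (x $ i)) = (\<Prod>b\<in>Basis. F b (x \<bullet> b))" for x
    by (subst prod.reindex_bij_betw[OF bij_betw_axis_Basis, symmetric])
       (simp add: F cart_eq_inner_axis)
  have T: "(\<Prod>b\<in>Basis. F b (?T g \<bullet> b)) = (\<Prod>b\<in>Basis. F b (g b))" for g
    by (intro prod.cong refl) (simp add: inner_sum_left_Basis)
  have meas: "(\<lambda>x :: real ^ 'n. \<Prod>i\<in>UNIV. f i (x $ i)) \<in> borel_measurable borel"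
    by (simp only: cart_eq_inner_axis) measurable
  have measT: "?T \<in> (\<Pi>\<^sub>M b\<in>Basis. lborel) \<rightarrow>\<^sub>M borel"
    by measurable
  have "integrable (\<Pi>\<^sub>M b\<in>(Basis :: (real ^ 'n) set). lborel) (\<lambda>g. \<Prod>b\<in>Basis. F b (g b))"
    by (rule product_integrable_prod) (auto intro: intF)
  then show "integrable lborel (\<lambda>x :: real ^ 'n. \<Prod>i\<in>UNIV. f i (x $ i))"
    by (subst lborel_eq, subst integrable_distr_eq[OF measT meas]) (simp only: eq T)
  have "(\<integral>x. (\<Prod>i\<in>UNIV. f i (x $ i)) \<partial>(lborel :: (real ^ 'n) measure)) =
      (\<integral>g. (\<Prod>b\<in>(Basis :: (real ^ 'n) set). F b (g b)) \<partial>(\<Pi>\<^sub>M b\<in>Basis. lborel))"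
    by (subst lborel_eq, subst integral_distr[OF measT meas]) (simp only: eq T)
  also have "\<dots> = (\<Prod>b\<in>(Basis :: (real ^ 'n) set). \<integral>t. F b t \<partial>lborel)"
    by (rule product_integral_prod) (auto intro: intF)
  also have "\<dots> = (\<Prod>i\<in>UNIV. \<integral>t. f i t \<partial>lborel)"
    by (subst prod.reindex_bij_betw[OF bij_betw_axis_Basis, symmetric]) (simp add: F)
  finally show "(\<integral>x. (\<Prod>i\<in>UNIV. f i (x $ i)) \<partial>(lborel :: (real ^ 'n) measure)) =
      (\<Prod>i\<in>UNIV. \<integral>t. f i t \<partial>lborel)" .
qed

lemma integrable_inverse_one_plus_square: "integrable lborel (\<lambda>t :: real. 1 / (1 + t\<^sup>2))"
proof -
  have 1: "set_integrable lborel {0<..} (\<lambda>t :: real. 1 / (1 + t\<^sup>2))"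
    using integrable_I0i_1_div_plus_square
    by (simp add: interval_lebesgue_integrable_def zero_ereal_def einterval_eq)
  have "integrable lborel (\<lambda>t. indicator {0<..} (0 + (- 1) * t) *\<^sub>R (1 / (1 + (0 + (- 1) * t)\<^sup>2)) :: real)"
    using 1 unfolding set_integrable_def by (rule lborel_integrable_real_affine) simp
  then have 2: "set_integrable lborel {..<0} (\<lambda>t :: real. 1 / (1 + t\<^sup>2))"
    unfolding set_integrable_def
    by (rule Bochner_Integration.integrable_cong[THEN iffD1, rotated -1])
       (auto simp: indicator_def)
  have "set_integrable lborel ({0<..} \<union> {..<0}) (\<lambda>t :: real. 1 / (1 + t\<^sup>2))"
    by (rule set_integrable_Un[OF 1 2]) auto
  moreover have "AE t in lborel. indicator ({0<..} \<union> {..<0}) t *\<^sub>R (1 / (1 + t\<^sup>2)) = (1 / (1 + t\<^sup>2) :: real)"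
    using AE_lborel_singleton[of "0 :: real"] by eventually_elim (auto simp: indicator_def)
  ultimately show ?thesis
    unfolding set_integrable_def by (subst (asm) integrable_cong_AE) auto
qed

text \<open>
  Compare with \<open>\<Prod>i. 1 / (1 + (x $ i)\<^sup>2)\<close>, whose integral factorizes; each factor \<open>1 + (x $ i)\<^sup>2\<close> is at most
  \<open>(1 + norm x)\<^sup>2\<close>.
\<close>

lemma integrable_decay:
  "integrable lborel (\<lambda>x :: real ^ 'n::finite. 1 / (1 + norm x) ^ (2 * CARD('n)))"
proof (rule Bochner_Integration.integrable_bound)
  show "integrable lborel (\<lambda>x :: real ^ 'n. \<Prod>i\<in>UNIV. 1 / (1 + (x $ i)\<^sup>2))"
    by (rule integrable_prod_coords[OF integrable_inverse_one_plus_square])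
  have le: "1 / (1 + norm x) ^ (2 * CARD('n)) \<le> (\<Prod>i\<in>UNIV. 1 / (1 + (x $ i)\<^sup>2))" for x :: "real ^ 'n"
  proof -
    have "(\<Prod>i\<in>UNIV. 1 + (x $ i)\<^sup>2) \<le> (\<Prod>i\<in>(UNIV :: 'n set). (1 + norm x)\<^sup>2)"
    proof (intro prod_mono conjI)
      fix i
      have "(x $ i)\<^sup>2 \<le> (norm x)\<^sup>2"
        using component_le_norm_cart[of x i] by (metis abs_le_square_iff abs_norm_cancel)
      also have "1 + (norm x)\<^sup>2 \<le> (1 + norm x)\<^sup>2" by (simp add: power2_eq_square algebra_simps)
      finally show "1 + (x $ i)\<^sup>2 \<le> (1 + norm x)\<^sup>2" by simp
    qed (simp add: add_nonneg_nonneg)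
    also have "\<dots> = (1 + norm x) ^ (2 * CARD('n))" by (simp add: power_mult)
    finally have "(\<Prod>i\<in>UNIV. 1 + (x $ i)\<^sup>2) \<le> (1 + norm x) ^ (2 * CARD('n))" .
    moreover have "0 < (\<Prod>i\<in>UNIV. 1 + (x $ i)\<^sup>2)"
      by (intro prod_pos) (simp add: add_pos_nonneg)
    ultimately show ?thesis
      by (simp add: prod_dividef frac_le)
  qed
  show "AE x :: real ^ 'n in lborel. norm (1 / (1 + norm x) ^ (2 * CARD('n))) \<le>
      norm (\<Prod>i\<in>UNIV. 1 / (1 + (x $ i)\<^sup>2))"
  proof (intro AE_I2)
    fix x :: "real ^ 'n"
    have "norm (1 / (1 + norm x) ^ (2 * CARD('n))) = 1 / (1 + norm x) ^ (2 * CARD('n))" by simp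
    also note le[of x]
    also have "(\<Prod>i\<in>UNIV. 1 / (1 + (x $ i)\<^sup>2)) \<le> norm (\<Prod>i\<in>UNIV. 1 / (1 + (x $ i)\<^sup>2))"
      unfolding real_norm_def by (rule abs_ge_self)
    finally show "norm (1 / (1 + norm x) ^ (2 * CARD('n))) \<le> norm (\<Prod>i\<in>UNIV. 1 / (1 + (x $ i)\<^sup>2))" .
  qed
qed measurable

definition decay_mass :: "'n::finite itself \<Rightarrow> real" where
  "decay_mass _ = (\<integral>x. 1 / (1 + norm x) ^ (2 * CARD('n)) \<partial>(lborel :: (real ^ 'n) measure))"

lemma
  fixes f :: "real ^ 'n::finite \<Rightarrow> complex"
  assumes [measurable]: "f \<in> borel_measurable borel"
    and M: "\<And>x. (1 + norm x) ^ (2 * CARD('n)) * cmod (f x) \<le> M"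
  shows integrable_if_decay: "integrable lborel f"
    and integral_norm_decay: "(\<integral>x. cmod (f x) \<partial>lborel) \<le> M * decay_mass TYPE('n)"
proof -
  have le: "cmod (f x) \<le> M * (1 / (1 + norm x) ^ (2 * CARD('n)))" for x
    using M[of x] by (simp add: field_simps add_pos_nonneg)
  have "0 \<le> M" using order_trans[OF norm_ge_zero le[of 0]] by simp
  show f: "integrable lborel f"
    by (rule Bochner_Integration.integrable_bound[OF integrable_mult_right[OF integrable_decay, of M]])
       (use le \<open>0 \<le> M\<close> in auto)
  show "(\<integral>x. cmod (f x) \<partial>lborel) \<le> M * decay_mass TYPE('n)"
    unfolding decay_mass_def integral_mult_right_zero[symmetric]
    by (intro integral_mono integrable_norm f integrable_mult_right integrable_decay le)
qed

lemma
  fixes f :: "real ^ 'n::finite \<Rightarrow> complex"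
  assumes "f \<in> schwartz"
  shows schwartz_integrable: "integrable lborel f"
    and schwartz_integral_norm:
      "(\<integral>x. cmod (f x) \<partial>lborel) \<le> sw_seminorm (2 * CARD('n)) [] f * decay_mass TYPE('n)"
proof -
  have m: "f \<in> borel_measurable borel" using assms by (intro smooth_measurable schwartz_smooth)
  show "integrable lborel f"
    "(\<integral>x. cmod (f x) \<partial>lborel) \<le> sw_seminorm (2 * CARD('n)) [] f * decay_mass TYPE('n)"
    by (rule integrable_if_decay[OF m sw_seminorm_upper0[OF assms]]
        integral_norm_decay[OF m sw_seminorm_upper0[OF assms]])+
qed

text \<open>
  A shear is a translation in one coordinate when the others are held fixed.
\<close>

lemma nn_integral_lborel_coord_shift:
  fixes h :: "real ^ 'n::finite \<Rightarrow> ennreal"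
  assumes [measurable]: "h \<in> borel_measurable borel" and mn: "m \<noteq> n"
  shows "(\<integral>\<^sup>+x. h (x + (x $ n) *\<^sub>R axis m 1) \<partial>lborel) = (\<integral>\<^sup>+x. h x \<partial>lborel)"
proof -
  interpret product_sigma_finite "\<lambda>_ :: real ^ 'n. lborel :: real measure" by standard
  let ?B = "Basis :: (real ^ 'n) set"
  let ?T = "\<lambda>g. \<Sum>b\<in>?B. g b *\<^sub>R b"
  let ?m = "axis m 1 :: real ^ 'n" and ?n = "axis n 1 :: real ^ 'n"
  have B: "?m \<in> ?B" "?n \<in> ?B" "?m \<noteq> ?n" using mn by (auto simp: axis_eq_axis)
  have ins: "insert ?m (?B - {?m}) = ?B" using B by auto
  have meas_shear [measurable]: "(\<lambda>x. h (x + (x $ n) *\<^sub>R ?m)) \<in> borel_measurable borel"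
    unfolding cart_eq_inner_axis by measurable
  have expand: "(\<integral>\<^sup>+x. k x \<partial>lborel) =
      (\<integral>\<^sup>+g. (\<integral>\<^sup>+t. k (?T (g(?m := t))) \<partial>lborel) \<partial>(\<Pi>\<^sub>M b\<in>?B - {?m}. lborel))"
    if [measurable]: "k \<in> borel_measurable borel" for k :: "real ^ 'n \<Rightarrow> ennreal"
  proof -
    have "(\<integral>\<^sup>+x. k x \<partial>lborel) = (\<integral>\<^sup>+g. k (?T g) \<partial>(\<Pi>\<^sub>M b\<in>?B. lborel))"
      by (subst lborel_eq, subst nn_integral_distr) auto
    also have "\<dots> = (\<integral>\<^sup>+g. k (?T g) \<partial>(\<Pi>\<^sub>M b\<in>insert ?m (?B - {?m}). lborel))"
      by (simp only: ins)
    also have "\<dots> = (\<integral>\<^sup>+g. (\<integral>\<^sup>+t. k (?T (g(?m := t))) \<partial>lborel) \<partial>(\<Pi>\<^sub>M b\<in>?B - {?m}. lborel))"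
      by (rule product_nn_integral_insert) (auto simp: ins)
    finally show ?thesis .
  qed
  have coord: "?T g $ n = g ?n" for g
    using inner_sum_left_Basis[OF B(2), of g] by (simp add: cart_eq_inner_axis)
  have split: "?T (g(?m := t)) = t *\<^sub>R ?m + (\<Sum>b\<in>?B - {?m}. g b *\<^sub>R b)" for g t
    by (subst sum.remove[OF _ B(1)]) (auto intro!: sum.cong)
  have shear: "?T (g(?m := t)) + (?T (g(?m := t)) $ n) *\<^sub>R ?m = ?T (g(?m := g ?n + t))" for g t
    unfolding coord unfolding split using B(3) by (simp add: scaleR_add_left)
  have [measurable]: "(\<lambda>t. h (?T (g(?m := t)))) \<in> borel_measurable borel" for g
    unfolding split by measurable
  have "(\<integral>\<^sup>+t. h (?T (g(?m := g ?n + t))) \<partial>lborel) = (\<integral>\<^sup>+t. h (?T (g(?m := t))) \<partial>lborel)" for g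
    by (subst (2) lborel_distr_plus[of "g ?n", symmetric], subst nn_integral_distr) auto
  then show ?thesis
    by (simp only: expand[OF meas_shear] expand[OF assms(1)] shear)
qed

lemma matrix_vector_component: "(A *v x) $ i = (\<Sum>j\<in>UNIV. A $ i $ j * x $ j)"
  by (simp add: matrix_vector_mult_def)

lemma borel_measurable_matrix_vector [measurable]:
  "(\<lambda>x. (A :: real ^ 'n::finite ^ 'm::finite) *v x) \<in> borel \<rightarrow>\<^sub>M borel"
  by (intro borel_measurable_continuous_onI linear_continuous_on matrix_vector_mul_bounded_linear)

text \<open>
  The determinant and the factor by which a linear map changes volumes are both multiplicative, so it
  suffices to compare them for elementary matrices.
\<close>

lemma nn_integral_lborel_linear:
  fixes A :: "real ^ 'n::finite ^ 'n" and f :: "real ^ 'n \<Rightarrow> ennreal"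
  assumes "det A \<noteq> 0" and "f \<in> borel_measurable borel"
  shows "(\<integral>\<^sup>+x. f x \<partial>lborel) = ennreal \<bar>det A\<bar> * (\<integral>\<^sup>+x. f (A *v x) \<partial>lborel)"
  using assms
proof (induction A arbitrary: f rule: induct_matrix_elementary_alt)
  case (1 A B)
  have nz: "det A \<noteq> 0" "det B \<noteq> 0" using 1(3) by (auto simp: det_mul)
  note [measurable] = 1(4)
  have "(\<integral>\<^sup>+x. f x \<partial>lborel) = ennreal \<bar>det A\<bar> * (\<integral>\<^sup>+x. f (A *v x) \<partial>lborel)"
    by (rule 1(1)[OF nz(1) 1(4)])
  also have "(\<integral>\<^sup>+x. f (A *v x) \<partial>lborel) = ennreal \<bar>det B\<bar> * (\<integral>\<^sup>+x. f (A *v (B *v x)) \<partial>lborel)"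
    by (rule 1(2)[OF nz(2), of "\<lambda>x. f (A *v x)"]) measurable
  finally show ?case
    by (simp add: det_mul abs_mult ennreal_mult' mult.assoc matrix_vector_mul_assoc)
next
  case (2 A i)
  then show ?case using det_zero_row by metis
next
  case (3 A)
  note [measurable] = 3(3)
  have det: "det A = (\<Prod>i\<in>UNIV. A $ i $ i)" by (rule det_diagonal) (rule 3(1))
  have nz: "A $ i $ i \<noteq> 0" for i using 3(2) unfolding det by simp
  define c where "c b = A $ (inv (\<lambda>i. axis i 1) b) $ (inv (\<lambda>i. axis i 1) b)" for b :: "real ^ 'n"
  have inj: "inj (\<lambda>i. axis i 1 :: real ^ 'n)"
    by (auto simp: inj_on_def axis_eq_axis)
  have c: "c (axis i 1) = A $ i $ i" for i
    unfolding c_def by (simp add: inv_f_f[OF inj])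
  have T: "0 + (\<Sum>b\<in>Basis. (c b * (x \<bullet> b)) *\<^sub>R b) = A *v x" for x
  proof -
    have "(\<Sum>b\<in>Basis. (c b * (x \<bullet> b)) *\<^sub>R b) $ i = A $ i $ i * x $ i" for i
      using inner_sum_left_Basis[of "axis i 1" "\<lambda>b. c b * (x \<bullet> b)"]
      by (simp add: cart_eq_inner_axis[symmetric] c)
    moreover have "(A *v x) $ i = A $ i $ i * x $ i" for i
      unfolding matrix_vector_component using 3(1)
      by (subst sum.remove[of _ i]) (auto intro!: sum.neutral)
    ultimately show ?thesis by (simp add: vec_eq_iff)
  qed
  have "lborel = density (distr lborel borel (\<lambda>x. 0 + (\<Sum>b\<in>Basis. (c b * (x \<bullet> b)) *\<^sub>R b)))
      (\<lambda>_. ennreal (\<Prod>b\<in>Basis. \<bar>c b\<bar>))"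
    by (rule lborel_affine_euclidean) (use nz in \<open>auto simp: Basis_vec_real c\<close>)
  also have "(\<Prod>b\<in>Basis. \<bar>c b\<bar>) = \<bar>det A\<bar>"
    by (subst prod.reindex_bij_betw[OF bij_betw_axis_Basis, symmetric]) (simp add: det c abs_prod)
  finally have eq: "lborel = density (distr lborel borel (\<lambda>x. A *v x)) (\<lambda>_. ennreal \<bar>det A\<bar>)"
    unfolding T .
  show ?case
    by (subst eq) (simp add: nn_integral_density nn_integral_distr nn_integral_cmult)
next
  case (4 m n)
  note [measurable] = 4(3)
  let ?S = "\<chi> i j. mat 1 $ i $ Transposition.transpose m n j :: real ^ 'n ^ 'n"
  have S: "?S *v x = (\<chi> i. x $ Transposition.transpose m n i)" for x
  proof -
    have "(?S *v x) $ i = x $ Transposition.transpose m n i" for i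
      unfolding matrix_vector_component
      by (subst sum.remove[of _ "Transposition.transpose m n i"])
         (auto simp: mat_def intro!: sum.neutral split: if_splits)
    then show ?thesis by (simp add: vec_eq_iff)
  qed
  have "?S ** ?S = mat 1"
  proof -
    have "(?S ** ?S) *v x = mat 1 *v x" for x
      by (simp add: matrix_vector_mul_assoc[symmetric] S vec_eq_iff)
    then show ?thesis using matrix_eq by blast
  qed
  then have "det ?S * det ?S = 1" by (metis det_I det_mul)
  then have abs_det: "\<bar>det ?S\<bar> = 1"
    using power2_eq_1_iff[of "det ?S"] by (auto simp: power2_eq_square)
  have distr: "lborel = distr lborel borel (\<lambda>x. ?S *v x)"
  proof (rule lborel_eqI)
    fix l u :: "real ^ 'n"
    assume lu: "\<And>b. b \<in> Basis \<Longrightarrow> l \<bullet> b \<le> u \<bullet> b"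
    have le: "l $ i \<le> u $ i" for i
      using lu[of "axis i 1"] by (simp add: inner_axis)
    have pre: "(\<lambda>x. ?S *v x) -` box l u = box (?S *v l) (?S *v u)"
    proof (rule set_eqI)
      fix x
      let ?P = "\<lambda>i. l $ i < x $ Transposition.transpose m n i \<and> x $ Transposition.transpose m n i < u $ i"
      have "(\<forall>i. ?P i) \<longleftrightarrow> (\<forall>i. ?P (Transposition.transpose m n i))"
      proof (intro iffI allI)
        fix i
        assume "\<forall>i. ?P (Transposition.transpose m n i)"
        from spec[OF this, of "Transposition.transpose m n i"] show "?P i" by simp
      qed blast
      then show "x \<in> (\<lambda>x. ?S *v x) -` box l u \<longleftrightarrow> x \<in> box (?S *v l) (?S *v u)"
        by (simp add: mem_box_cart S)
    qed
    have "emeasure (distr lborel borel (\<lambda>x. ?S *v x)) (box l u) = emeasure lborel (box (?S *v l) (?S *v u))"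
      by (simp add: emeasure_distr pre)
    also have "\<dots> = (\<Prod>b\<in>Basis. (?S *v u - ?S *v l) \<bullet> b)"
      by (rule emeasure_lborel_box) (use le in \<open>auto simp: S Basis_vec_real inner_axis\<close>)
    also have "(\<Prod>b\<in>Basis. (?S *v u - ?S *v l) \<bullet> b) = (\<Prod>i\<in>UNIV. (?S *v u - ?S *v l) $ i)"
      by (subst prod.reindex_bij_betw[OF bij_betw_axis_Basis, symmetric]) (simp add: inner_axis)
    also have "(\<Prod>i\<in>UNIV. (?S *v u - ?S *v l) $ i) = (\<Prod>i\<in>UNIV. (u - l) $ i)"
      using prod.reindex_bij_betw[of "Transposition.transpose m n" UNIV UNIV "\<lambda>i. (u - l) $ i"]
      by (simp add: S)
    also have "(\<Prod>i\<in>UNIV. (u - l) $ i) = (\<Prod>b\<in>Basis. (u - l) \<bullet> b)"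
      by (subst prod.reindex_bij_betw[OF bij_betw_axis_Basis, symmetric]) (simp add: inner_axis)
    finally show "emeasure (distr lborel borel (\<lambda>x. ?S *v x)) (box l u) = (\<Prod>b\<in>Basis. (u - l) \<bullet> b)" .
  qed simp
  show ?case
    unfolding abs_det by (subst distr) (simp add: nn_integral_distr)
next
  case (5 m n)
  let ?S = "\<chi> i j. of_bool (i = m \<and> j = n \<or> i = j) :: real ^ 'n ^ 'n"
  have S: "?S *v x = x + (x $ n) *\<^sub>R axis m 1" for x
  proof -
    have "(?S *v x) $ i = (x + (x $ n) *\<^sub>R axis m 1) $ i" for i
    proof (cases "i = m")
      case True
      then have "(?S *v x) $ i = (\<Sum>j\<in>UNIV. (if j = n then x $ j else 0) + (if j = m then x $ j else 0))"
        unfolding matrix_vector_component using 5(1) by (intro sum.cong) auto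
      then show ?thesis by (simp add: sum.distrib True axis_def)
    next
      case False
      then have "(?S *v x) $ i = (\<Sum>j\<in>UNIV. if j = i then x $ j else 0)"
        unfolding matrix_vector_component by (intro sum.cong) auto
      then show ?thesis using False by (simp add: axis_def)
    qed
    then show ?thesis by (simp add: vec_eq_iff)
  qed
  have "det ?S = 1"
  proof -
    have "det (\<chi> i. if i = m then row m (mat 1) + 1 *s row n (mat 1) else row i (mat 1) :: real ^ 'n ^ 'n) = det (mat 1 :: real ^ 'n ^ 'n)"
      by (rule det_row_operation) (rule 5(1))
    also have "(\<chi> i. if i = m then row m (mat 1) + 1 *s row n (mat 1) else row i (mat 1) :: real ^ 'n ^ 'n) = ?S"
      using 5(1) by (auto simp: vec_eq_iff row_def mat_def)
    finally show ?thesis by simp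
  qed
  then show ?case
    unfolding S by (simp add: nn_integral_lborel_coord_shift[OF 5(3) 5(1)])
qed

lemma lborel_linear:
  fixes A :: "real ^ 'n::finite ^ 'n"
  assumes "det A \<noteq> 0"
  shows "lborel = density (distr lborel borel (\<lambda>x. A *v x)) (\<lambda>_. ennreal \<bar>det A\<bar>)"
proof (rule measure_eqI)
  fix S :: "(real ^ 'n) set"
  assume "S \<in> sets lborel"
  then have [measurable]: "S \<in> sets borel" by simp
  show "emeasure lborel S = emeasure (density (distr lborel borel (\<lambda>x. A *v x)) (\<lambda>_. ennreal \<bar>det A\<bar>)) S"
  proof -
    have "(\<integral>\<^sup>+x. indicator S (A *v x) \<partial>lborel) = (\<integral>\<^sup>+x. indicator S x \<partial>distr lborel borel (\<lambda>x. A *v x))"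
      by (subst nn_integral_distr) auto
    then show ?thesis
      using nn_integral_lborel_linear[OF assms, of "indicator S"]
      by (simp add: emeasure_density nn_integral_cmult)
  qed
qed simp

lemma integral_lborel_linear:
  fixes A :: "real ^ 'n::finite ^ 'n" and f :: "real ^ 'n \<Rightarrow> complex"
  assumes "det A \<noteq> 0" and [measurable]: "f \<in> borel_measurable borel"
  shows "(\<integral>x. f x \<partial>lborel) = of_real \<bar>det A\<bar> * (\<integral>x. f (A *v x) \<partial>lborel)"
  by (subst lborel_linear[OF assms(1)])
     (simp add: integral_density integral_distr scaleR_conv_of_real)

lemma integral_lborel_shift:
  fixes f :: "'a::euclidean_space \<Rightarrow> 'b::{banach, second_countable_topology}"
  assumes [measurable]: "f \<in> borel_measurable borel"
  shows "(\<integral>x. f (c + x) \<partial>lborel) = (\<integral>x. f x \<partial>lborel)"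
  by (subst (2) lborel_distr_plus[of c, symmetric], subst integral_distr) auto

lemma integrable_lborel_shift:
  fixes f :: "'a::euclidean_space \<Rightarrow> 'b::{banach, second_countable_topology}"
  assumes "integrable lborel f"
  shows "integrable lborel (\<lambda>x. f (c + x))"
proof -
  have "f \<in> borel_measurable borel" using assms by simp
  then show ?thesis
    using assms integrable_distr_eq[of "(+) c" lborel borel f] lborel_distr_plus[of c] by simp
qed

lemma integral_lborel_affine:
  fixes f :: "'a::euclidean_space \<Rightarrow> complex"
  assumes "c > 0" and [measurable]: "f \<in> borel_measurable borel"
  shows "(\<integral>x. f x \<partial>lborel) = of_real (c ^ DIM('a)) * (\<integral>x. f (t + c *\<^sub>R x) \<partial>lborel)"
  by (subst lborel_affine[of c t])
     (use assms(1) in \<open>simp_all add: integral_density integral_distr scaleR_conv_of_real\<close>)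

section \<open>Fourier inversion\<close>

text \<open>
  The difference quotients minus the derivative converge to 0 for each \<open>y\<close>, and by the mean value theorem
  they are dominated by \<open>2 * b y\<close>.
\<close>

lemma has_derivative_integral:
  fixes K :: "'a::euclidean_space \<Rightarrow> 'b \<Rightarrow> complex"
  assumes r: "0 < r"
    and der: "\<And>x y. x \<in> ball x0 r \<Longrightarrow> ((\<lambda>x. K x y) has_derivative K' x y) (at x)"
    and int: "\<And>x. integrable M (K x)"
    and int': "\<And>h. integrable M (\<lambda>y. K' x0 y h)"
    and dom: "\<And>x y h. x \<in> ball x0 r \<Longrightarrow> cmod (K' x y h) \<le> b y * norm h"
    and b: "integrable M b"
  shows "((\<lambda>x. \<integral>y. K x y \<partial>M) has_derivative (\<lambda>h. \<integral>y. K' x0 y h \<partial>M)) (at x0)"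
proof -
  have x0: "x0 \<in> ball x0 r" using r by simp
  have lin: "bounded_linear (K' x0 y)" for y
    using der[OF x0] by (rule has_derivative_bounded_linear)
  have bl: "bounded_linear (\<lambda>h. \<integral>y. K' x0 y h \<partial>M)"
  proof (rule bounded_linear_intro)
    show "(\<integral>y. K' x0 y (h + k) \<partial>M) = (\<integral>y. K' x0 y h \<partial>M) + (\<integral>y. K' x0 y k \<partial>M)" for h k
      using int' by (simp add: linear_add[OF bounded_linear.linear[OF lin]])
    show "(\<integral>y. K' x0 y (c *\<^sub>R h) \<partial>M) = c *\<^sub>R (\<integral>y. K' x0 y h \<partial>M)" for c h
      by (simp add: linear_scale[OF bounded_linear.linear[OF lin]])
    show "cmod (\<integral>y. K' x0 y h \<partial>M) \<le> norm h * (\<integral>y. b y \<partial>M)" for h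
    proof -
      have "cmod (\<integral>y. K' x0 y h \<partial>M) \<le> (\<integral>y. cmod (K' x0 y h) \<partial>M)" by simp
      also have "\<dots> \<le> (\<integral>y. b y * norm h \<partial>M)"
        by (intro integral_mono integrable_norm int' integrable_mult_left b dom[OF x0])
      finally show ?thesis by (simp add: mult.commute)
    qed
  qed
  have lip: "cmod (K (x0 + h) y - K x0 y) \<le> b y * norm h" if "norm h < r" for h y
  proof -
    have "norm (K (x0 + h) y - K x0 y) \<le> b y * norm (x0 + h - x0)"
    proof (rule differentiable_bound[of "ball x0 r" "\<lambda>x. K x y" "\<lambda>x. K' x y"])
      show "((\<lambda>x. K x y) has_derivative K' x y) (at x within ball x0 r)" if "x \<in> ball x0 r" for x
        using der[OF that] by (rule has_derivative_at_withinI)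
      show "onorm (K' x y) \<le> b y" if "x \<in> ball x0 r" for x
        by (rule onorm_le) (rule dom[OF that])
    qed (use that x0 in \<open>auto simp: dist_norm\<close>)
    then show ?thesis by simp
  qed
  have lim: "((\<lambda>h. norm ((\<integral>y. K (x0 + h) y \<partial>M) - (\<integral>y. K x0 y \<partial>M) - (\<integral>y. K' x0 y h \<partial>M)) / norm h)
      \<longlongrightarrow> 0) (at 0)"
    unfolding tendsto_at_iff_sequentially
  proof (intro allI impI)
    fix X :: "nat \<Rightarrow> 'a"
    assume X: "\<forall>i. X i \<in> UNIV - {0}" "X \<longlonglongrightarrow> 0"
    have "eventually (\<lambda>n. norm (X n) < r) sequentially"
      using X(2) r by (auto simp: tendsto_iff)
    then obtain N where N: "\<And>n. n \<ge> N \<Longrightarrow> norm (X n) < r"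
      by (auto simp: eventually_sequentially)
    define Y where "Y n = X (n + N)" for n
    have Y: "Y \<longlonglongrightarrow> 0" "\<And>n. Y n \<noteq> 0" "\<And>n. norm (Y n) < r"
      using X N LIMSEQ_ignore_initial_segment[of X 0 N] unfolding Y_def by auto
    define Q where "Q n y = (K (x0 + Y n) y - K x0 y - K' x0 y (Y n)) /\<^sub>R norm (Y n)" for n y
    have "(\<lambda>n. \<integral>y. Q n y \<partial>M) \<longlonglongrightarrow> (\<integral>y. 0 \<partial>M)"
    proof (rule integral_dominated_convergence[where w = "\<lambda>y. 2 * b y"])
      show "integrable M (\<lambda>y. 2 * b y)" using b by simp
      show "Q n \<in> borel_measurable M" for n
        unfolding Q_def using int int'
        by (intro borel_measurable_scaleR borel_measurable_diff borel_measurable_const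
            borel_measurable_integrable)
      show "AE y in M. (\<lambda>n. Q n y) \<longlonglongrightarrow> 0"
      proof (intro AE_I2)
        fix y
        have "((\<lambda>h. norm (K (x0 + h) y - K x0 y - K' x0 y h) / norm h) \<longlongrightarrow> 0) (at 0)"
          using der[OF x0] unfolding has_derivative_at by blast
        then have "(\<lambda>n. norm (K (x0 + Y n) y - K x0 y - K' x0 y (Y n)) / norm (Y n)) \<longlonglongrightarrow> 0"
          using Y unfolding tendsto_at_iff_sequentially o_def by auto
        then show "(\<lambda>n. Q n y) \<longlonglongrightarrow> 0"
          unfolding Q_def by (subst tendsto_norm_zero_iff[symmetric]) (simp add: divide_inverse mult.commute)
      qed
      show "AE y in M. norm (Q n y) \<le> 2 * b y" for n
      proof (intro AE_I2)
        fix y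
        have "norm (K (x0 + Y n) y - K x0 y - K' x0 y (Y n)) \<le> b y * norm (Y n) + b y * norm (Y n)"
          by (intro order_trans[OF norm_triangle_ineq4] add_mono lip dom x0 Y)
        then show "norm (Q n y) \<le> 2 * b y"
          unfolding Q_def norm_scaleR using Y(2)[of n] by (simp add: field_simps)
      qed
    qed simp
    moreover have "(\<integral>y. Q n y \<partial>M) = ((\<integral>y. K (x0 + Y n) y \<partial>M) - (\<integral>y. K x0 y \<partial>M) - (\<integral>y. K' x0 y (Y n) \<partial>M)) /\<^sub>R norm (Y n)" for n
      unfolding Q_def using int int' by simp
    ultimately have "(\<lambda>n. norm ((\<integral>y. K (x0 + Y n) y \<partial>M) - (\<integral>y. K x0 y \<partial>M) - (\<integral>y. K' x0 y (Y n) \<partial>M)) / norm (Y n)) \<longlonglongrightarrow> 0"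
      using tendsto_norm_zero[of "\<lambda>n. \<integral>y. Q n y \<partial>M" sequentially]
      by (simp add: divide_inverse mult.commute)
    then show "((\<lambda>h. norm ((\<integral>y. K (x0 + h) y \<partial>M) - (\<integral>y. K x0 y \<partial>M) - (\<integral>y. K' x0 y h \<partial>M)) / norm h) \<circ> X) \<longlonglongrightarrow> 0"
      unfolding Y_def o_def by (rule LIMSEQ_offset)
  qed
  show ?thesis
    unfolding has_derivative_at using bl lim by blast
qed

lemma schwartz_decay:
  assumes "f \<in> schwartz"
  shows "cmod (f x) \<le> sw_seminorm k [] f * (1 / (1 + norm x) ^ k)"
  using sw_seminorm_upper0[OF assms, of x k] by (simp add: field_simps add_pos_nonneg)

text \<open>
  The integral of \<open>f\<close> shifted by \<open>t\<close> along a coordinate does not depend on \<open>t\<close>; differentiate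
  at 0.
\<close>

lemma integral_partial_eq_0:
  fixes f :: "real ^ 'n::finite \<Rightarrow> complex"
  assumes f: "f \<in> schwartz"
  shows "(\<integral>x. partial i f x \<partial>lborel) = 0"
proof -
  let ?e = "axis i 1 :: real ^ 'n" and ?k = "2 * CARD('n)"
  let ?S = "sw_seminorm ?k [] (partial i f)"
  have pf: "partial i f \<in> schwartz" using f by (rule schwartz_partial)
  have [measurable]: "f \<in> borel_measurable borel" using f by (intro smooth_measurable schwartz_smooth)
  have D: "((\<lambda>t. \<integral>x. f (t *\<^sub>R ?e + x) \<partial>lborel) has_derivative
      (\<lambda>h. \<integral>x. h *\<^sub>R partial i f (0 *\<^sub>R ?e + x) \<partial>lborel)) (at (0 :: real))"
  proof (rule has_derivative_integral[where r = 1 and b = "\<lambda>x. (?S * 2 ^ ?k) * (1 / (1 + norm x) ^ ?k)"])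
    fix t :: real and x :: "real ^ 'n" and h :: real
    have "((\<lambda>t. f (t *\<^sub>R ?e + x)) has_derivative
        (\<lambda>h. \<Sum>j\<in>UNIV. of_real ((h *\<^sub>R ?e) $ j) * partial j f (t *\<^sub>R ?e + x))) (at t)"
      by (rule has_derivative_compose[OF _ has_derivative_partial[OF schwartz_differentiable[OF f]]])
         (auto intro!: derivative_eq_intros)
    moreover have "(\<Sum>j\<in>UNIV. of_real ((h *\<^sub>R ?e) $ j) * partial j f y) = h *\<^sub>R partial i f y" for h y
      by (simp add: axis_def if_distrib if_distribR scaleR_conv_of_real[where 'a = complex] cong: if_cong)
    ultimately show "((\<lambda>t. f (t *\<^sub>R ?e + x)) has_derivative (\<lambda>h. h *\<^sub>R partial i f (t *\<^sub>R ?e + x))) (at t)"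
      by simp
    assume t: "t \<in> ball 0 1"
    \<comment> \<open>The shift has length at most 1, so the decay of the derivative is lost only up to \<open>2 ^ ?k\<close>.\<close>
    have "norm x \<le> norm (t *\<^sub>R ?e + x) + norm (t *\<^sub>R ?e)"
      using norm_triangle_ineq4[of "t *\<^sub>R ?e + x" "t *\<^sub>R ?e"] by simp
    moreover have "norm (t *\<^sub>R ?e) \<le> 1" using t by simp
    moreover have "0 \<le> norm (t *\<^sub>R ?e + x)" by simp
    moreover have "1 + a \<le> 2 * (1 + N)" if "a \<le> N + c" "c \<le> 1" "0 \<le> N" for a N c :: real
      using that by argo
    ultimately have "1 + norm x \<le> 2 * (1 + norm (t *\<^sub>R ?e + x))" by blast
    then have "(1 + norm x) ^ ?k \<le> 2 ^ ?k * (1 + norm (t *\<^sub>R ?e + x)) ^ ?k"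
      unfolding power_mult_distrib[symmetric] by (rule power_mono) simp
    then have "1 / (1 + norm (t *\<^sub>R ?e + x)) ^ ?k \<le> 2 ^ ?k * (1 / (1 + norm x) ^ ?k)"
      by (simp add: field_simps add_pos_nonneg)
    then have "cmod (partial i f (t *\<^sub>R ?e + x)) \<le> ?S * (2 ^ ?k * (1 / (1 + norm x) ^ ?k))"
      by (intro order_trans[OF schwartz_decay[OF pf, of _ ?k]] mult_left_mono sw_seminorm_nonneg[OF pf])
    then show "cmod (h *\<^sub>R partial i f (t *\<^sub>R ?e + x)) \<le> (?S * 2 ^ ?k) * (1 / (1 + norm x) ^ ?k) * norm h"
      unfolding norm_scaleR real_norm_def
      by (subst mult.commute) (intro mult_right_mono, simp_all only: mult.assoc abs_ge_zero)
  next
    show "integrable lborel (\<lambda>x :: real ^ 'n. (?S * 2 ^ ?k) * (1 / (1 + norm x) ^ ?k))"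
      by (intro integrable_mult_right integrable_decay)
    show "integrable lborel (\<lambda>x. f (t *\<^sub>R ?e + x))" for t
      by (intro integrable_lborel_shift schwartz_integrable f)
    show "integrable lborel (\<lambda>x. h *\<^sub>R partial i f (0 *\<^sub>R ?e + x))" for h
      using schwartz_integrable[OF pf] by simp
  qed simp
  have "((\<lambda>t. \<integral>x. f (t *\<^sub>R ?e + x) \<partial>lborel) has_derivative (\<lambda>h. 0)) (at (0 :: real))"
    by (simp add: integral_lborel_shift)
  from has_derivative_unique[OF D this]
  have "(\<integral>x. 1 *\<^sub>R partial i f (0 *\<^sub>R ?e + x) \<partial>lborel) = 0" by meson
  then show ?thesis by simp
qed

lemma integral_cis_partial:
  assumes f: "f \<in> schwartz"
  shows "(\<integral>x. cis (2 * pi * (w \<bullet> x)) * partial i f x \<partial>lborel) =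
    - (of_real (2 * pi * w $ i) * \<i>) * (\<integral>x. cis (2 * pi * (w \<bullet> x)) * f x \<partial>lborel)"
proof -
  have eq: "partial i (\<lambda>x. cis (2 * pi * (w \<bullet> x)) * f x) = (\<lambda>x. cis (2 * pi * (w \<bullet> x)) * partial i f x +
      (of_real (2 * pi * w $ i) * \<i>) * (cis (2 * pi * (w \<bullet> x)) * f x))"
    by (rule ext, subst partial_mult[OF differentiable_cis schwartz_differentiable[OF f]])
       (simp only: partial_cis, simp add: mult_ac)
  have i1: "integrable lborel (\<lambda>x. cis (2 * pi * (w \<bullet> x)) * partial i f x)"
    by (intro schwartz_integrable schwartz_modulation schwartz_partial f)
  have i2: "integrable lborel (\<lambda>x. (of_real (2 * pi * w $ i) * \<i>) * (cis (2 * pi * (w \<bullet> x)) * f x))"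
    by (intro integrable_mult_right schwartz_integrable schwartz_modulation f)
  have "0 = (\<integral>x. cis (2 * pi * (w \<bullet> x)) * partial i f x \<partial>lborel) +
      (\<integral>x. (of_real (2 * pi * w $ i) * \<i>) * (cis (2 * pi * (w \<bullet> x)) * f x) \<partial>lborel)"
    using integral_partial_eq_0[OF schwartz_modulation[OF f], of i w] unfolding eq
    by (simp only: Bochner_Integration.integral_add[OF i1 i2])
  then show ?thesis by (simp add: eq_neg_iff_add_eq_0 add.commute)
qed

subsection \<open>Gaussian regularization\<close>

lemma cis_sum: "cis (\<Sum>i\<in>I. f i) = (\<Prod>i\<in>I. cis (f i))"
  by (induction I rule: infinite_finite_induct) (auto simp: cis_mult[symmetric])

definition gauss :: "real ^ 'n::finite \<Rightarrow> real" where
  "gauss w = (\<Prod>i\<in>UNIV. std_normal_density (w $ i))"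

text \<open>
  The Fourier transform of \<open>gauss\<close>, see \<open>gauss_fourier\<close> below.
\<close>

definition gauss_dual :: "real ^ 'n::finite \<Rightarrow> real" where
  "gauss_dual \<xi> = (\<Prod>i\<in>UNIV. exp (- (2 * pi * \<xi> $ i)\<^sup>2 / 2))"

lemma borel_measurable_vec_nth [measurable]: "(\<lambda>x :: real ^ 'n::finite. x $ i) \<in> borel_measurable borel"
  unfolding cart_eq_inner_axis by measurable

lemma gauss_measurable [measurable]: "gauss \<in> borel_measurable borel"
  unfolding gauss_def[abs_def] by measurable

lemma gauss_dual_measurable [measurable]: "gauss_dual \<in> borel_measurable borel"
  unfolding gauss_dual_def[abs_def] by measurable

lemma gauss_nonneg: "0 \<le> gauss w"
  by (simp add: gauss_def prod_nonneg)

lemma gauss_le: "gauss w \<le> gauss (0 :: real ^ 'n)" for w :: "real ^ 'n::finite"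
  unfolding gauss_def
  by (intro prod_mono) (auto simp: std_normal_density_def intro!: divide_right_mono)

lemma gauss_0_pos: "0 < gauss (0 :: real ^ 'n::finite)"
  unfolding gauss_def by (intro prod_pos ballI normal_density_pos) simp

lemma integrable_gauss_dual_1: "integrable lborel (\<lambda>t. exp (- (2 * pi * t)\<^sup>2 / 2))"
  and integral_gauss_dual_1: "(\<integral>t. exp (- (2 * pi * t)\<^sup>2 / 2) \<partial>lborel) = std_normal_density 0"
proof -
  have eq: "exp (- (2 * pi * t)\<^sup>2 / 2) = std_normal_density 0 * normal_density 0 (1 / (2 * pi)) t" for t
  proof -
    have "sqrt (2 * pi) * sqrt (2 * pi * (1 / (2 * pi))\<^sup>2) = 1"
      by (simp add: real_sqrt_mult[symmetric] power2_eq_square)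
    then have "(1 / sqrt (2 * pi)) * (1 / sqrt (2 * pi * (1 / (2 * pi))\<^sup>2)) = 1"
      by (metis mult.right_neutral times_divide_times_eq div_self zero_neq_one)
    moreover have "- (t - 0)\<^sup>2 / (2 * (1 / (2 * pi))\<^sup>2) = - (2 * pi * t)\<^sup>2 / 2"
      by (simp add: power2_eq_square field_simps)
    ultimately show ?thesis
      unfolding normal_density_def std_normal_density_def by simp
  qed
  show "integrable lborel (\<lambda>t. exp (- (2 * pi * t)\<^sup>2 / 2))"
    unfolding eq by (intro integrable_mult_right integrable_normal_density) simp
  show "(\<integral>t. exp (- (2 * pi * t)\<^sup>2 / 2) \<partial>lborel) = std_normal_density 0"
    unfolding eq by (subst integral_mult_right_zero, subst integral_normal_density) simp_all
qed

lemma integrable_gauss_dual: "integrable lborel gauss_dual"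
  unfolding gauss_dual_def[abs_def] by (rule integrable_prod_coords) (rule integrable_gauss_dual_1)

lemma integral_gauss_dual: "(\<integral>\<xi>. gauss_dual (\<xi> :: real ^ 'n::finite) \<partial>lborel) = gauss (0 :: real ^ 'n)"
  unfolding gauss_dual_def gauss_def
  by (subst integral_prod_coords[OF integrable_gauss_dual_1]) (simp only: integral_gauss_dual_1 zero_index)

lemma gauss_dual_nonneg: "0 \<le> gauss_dual w"
  by (simp add: gauss_dual_def prod_nonneg)

lemma gauss_fourier: "(\<integral>w. cis (2 * pi * (\<xi> \<bullet> w)) * of_real (gauss w) \<partial>lborel) = of_real (gauss_dual \<xi>)"
proof -
  have int: "integrable lborel (\<lambda>t. cis (2 * pi * s * t) * of_real (std_normal_density t))" for s
  proof (rule Bochner_Integration.integrable_bound[of _ std_normal_density])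
    have [measurable]: "(\<lambda>t. cis (2 * pi * s * t)) \<in> borel_measurable borel"
      by (intro borel_measurable_continuous_onI continuous_intros)
    show "(\<lambda>t. cis (2 * pi * s * t) * of_real (std_normal_density t)) \<in> borel_measurable lborel"
      by measurable
  qed (auto simp: norm_mult)
  have 1: "(\<integral>t. cis (2 * pi * s * t) * of_real (std_normal_density t) \<partial>lborel) =
      of_real (exp (- (2 * pi * s)\<^sup>2 / 2))" for s
  proof -
    have "(\<integral>t. cis (2 * pi * s * t) * of_real (std_normal_density t) \<partial>lborel) = char std_normal_distribution (2 * pi * s)"
      unfolding char_def
      by (subst integral_density) (auto simp: scaleR_conv_of_real cis_conv_exp mult_ac)
    then show ?thesis by (simp add: char_std_normal_distribution)
  qed
  have "(\<integral>w. cis (2 * pi * (\<xi> \<bullet> w)) * of_real (gauss w) \<partial>lborel) =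
      (\<integral>w. (\<Prod>i\<in>UNIV. cis (2 * pi * \<xi> $ i * w $ i) * of_real (std_normal_density (w $ i))) \<partial>lborel)"
    unfolding gauss_def inner_vec_def sum_distrib_left cis_sum of_real_prod prod.distrib[symmetric]
    by (simp add: mult.assoc)
  also have "\<dots> = (\<Prod>i\<in>UNIV. of_real (exp (- (2 * pi * \<xi> $ i)\<^sup>2 / 2)))"
    by (subst integral_prod_coords[OF int]) (simp only: 1)
  finally show ?thesis by (simp add: gauss_dual_def)
qed

text \<open>
  Multiplying the transform by a wide Gaussian amounts to averaging \<open>g\<close> against a narrow one. Both
  sides converge as the parameter tends to 0.
\<close>

theorem fourier_inversion:
  fixes g :: "real ^ 'n::finite \<Rightarrow> complex"
  assumes g: "integrable lborel g" and cont: "continuous_on UNIV g" and M: "\<And>y. cmod (g y) \<le> M"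
    and G: "integrable lborel (\<lambda>w. \<integral>y. cis (2 * pi * (y \<bullet> w)) * g y \<partial>lborel)"
  shows "(\<integral>w. cis (2 * pi * (b \<bullet> w)) * (\<integral>y. cis (2 * pi * (y \<bullet> w)) * g y \<partial>lborel) \<partial>lborel) = g (- b)"
proof -
  define G where "G w = (\<integral>y. cis (2 * pi * (y \<bullet> w)) * g y \<partial>lborel)" for w
  have intG: "integrable lborel G" using G unfolding G_def[abs_def] .
  have [measurable]: "g \<in> borel_measurable borel" "G \<in> borel_measurable borel"
    using g intG by auto
  have cis_meas [measurable]: "(\<lambda>w. cis (2 * pi * (x \<bullet> w))) \<in> borel_measurable borel" for x :: "real ^ 'n"
    by (intro borel_measurable_continuous_onI continuous_intros)
  have reg: "(\<integral>w. cis (2 * pi * (b \<bullet> w)) * of_real (gauss (e *\<^sub>R w)) * G w \<partial>lborel) =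
      (\<integral>u. g (- b + e *\<^sub>R u) * of_real (gauss_dual u) \<partial>lborel)" if e: "0 < e" for e
  proof -
    let ?n = "CARD('n)"
    let ?H = "\<lambda>w y. cis (2 * pi * ((b + y) \<bullet> w)) * of_real (gauss (e *\<^sub>R w)) * g y"
    have scaled: "integrable lborel (\<lambda>w :: real ^ 'n. gauss (e *\<^sub>R w))"
    proof -
      have "integrable lborel (\<lambda>t. std_normal_density (0 + e * t))"
        by (rule lborel_integrable_real_affine) (use e in auto)
      then show ?thesis
        unfolding gauss_def
        using integrable_prod_coords[of "\<lambda>(_ :: 'n) t. std_normal_density (e * t)"] by simp
    qed
    have "sets (lborel \<Otimes>\<^sub>M lborel) = sets (borel :: ((real ^ 'n) \<times> (real ^ 'n)) measure)"
      by (metis borel_prod sets_lborel sets_pair_measure_cong)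
    moreover have "(\<lambda>p. cis (2 * pi * ((b + snd p) \<bullet> fst p))) \<in> borel_measurable (borel :: ((real ^ 'n) \<times> (real ^ 'n)) measure)"
      by (intro borel_measurable_continuous_onI continuous_intros)
    ultimately have [measurable]: "(\<lambda>p. cis (2 * pi * ((b + snd p) \<bullet> fst p))) \<in> borel_measurable (lborel \<Otimes>\<^sub>M lborel)"
      using measurable_cong_sets by blast
    have [measurable]: "case_prod ?H \<in> borel_measurable (lborel \<Otimes>\<^sub>M lborel)"
      unfolding case_prod_beta' by measurable
    have norm_H: "cmod (?H w y) = gauss (e *\<^sub>R w) * cmod (g y)" for w y
      by (simp add: norm_mult gauss_nonneg)
    have int: "integrable (lborel \<Otimes>\<^sub>M lborel) (case_prod ?H)"
    proof (rule lborel_pair.Fubini_integrable)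
      show "integrable lborel (\<lambda>w. \<integral>y. norm (case_prod ?H (w, y)) \<partial>lborel)"
        unfolding prod.case norm_H using scaled by simp
      show "AE w in lborel. integrable lborel (\<lambda>y. case_prod ?H (w, y))"
      proof (intro AE_I2, unfold prod.case)
        fix w
        have [measurable]: "(\<lambda>y. cis (2 * pi * ((b + y) \<bullet> w))) \<in> borel_measurable borel"
          by (intro borel_measurable_continuous_onI continuous_intros)
        show "integrable lborel (?H w)"
          by (rule Bochner_Integration.integrable_bound[OF integrable_mult_right[OF integrable_norm[OF g], of "gauss (e *\<^sub>R w)"]])
             (simp, simp only: norm_H, simp add: gauss_nonneg)
      qed
    qed simp
    have inner: "(\<integral>w. cis (2 * pi * (\<xi> \<bullet> w)) * of_real (gauss (e *\<^sub>R w)) \<partial>lborel) =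
        of_real ((1 / e) ^ ?n * gauss_dual (\<xi> /\<^sub>R e))" for \<xi> :: "real ^ 'n"
      using e by (subst integral_lborel_affine[of "1 / e" _ 0])
        (use e gauss_fourier[of "\<xi> /\<^sub>R e"] in \<open>simp_all add: inverse_eq_divide\<close>)
    have "(\<integral>w. cis (2 * pi * (b \<bullet> w)) * of_real (gauss (e *\<^sub>R w)) * G w \<partial>lborel) =
        (\<integral>w. \<integral>y. ?H w y \<partial>lborel \<partial>lborel)"
      unfolding G_def by (simp add: inner_add_left distrib_left cis_mult[symmetric] mult_ac
          flip: integral_mult_right_zero)
    also have "\<dots> = (\<integral>y. \<integral>w. ?H w y \<partial>lborel \<partial>lborel)"
      by (rule lborel_pair.Fubini_integral[OF int, symmetric])
    also have "\<dots> = (\<integral>y. of_real ((1 / e) ^ ?n * gauss_dual ((b + y) /\<^sub>R e)) * g y \<partial>lborel)"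
      by (simp only: integral_mult_left_zero inner)
    also have "\<dots> = of_real (e ^ ?n) *
        (\<integral>u. of_real ((1 / e) ^ ?n * gauss_dual u) * g (- b + e *\<^sub>R u) \<partial>lborel)"
      using e by (subst integral_lborel_affine[of e _ "- b"]) simp_all
    also have "\<dots> = (\<integral>u. of_real (e ^ ?n) * (of_real ((1 / e) ^ ?n * gauss_dual u) * g (- b + e *\<^sub>R u)) \<partial>lborel)"
      by simp
    also have "\<dots> = (\<integral>u. g (- b + e *\<^sub>R u) * of_real (gauss_dual u) \<partial>lborel)"
    proof (rule Bochner_Integration.integral_cong[OF refl])
      fix u
      have "complex_of_real (e ^ ?n) * of_real ((1 / e) ^ ?n) = 1"
        using e by (simp only: of_real_mult[symmetric] power_mult_distrib[symmetric]) simp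
      then show "of_real (e ^ ?n) * (of_real ((1 / e) ^ ?n * gauss_dual u) * g (- b + e *\<^sub>R u)) =
          g (- b + e *\<^sub>R u) * of_real (gauss_dual u)"
        unfolding of_real_mult mult.assoc[symmetric] by simp
    qed
    finally show ?thesis .
  qed
  define eps where "eps k = 1 / real (Suc k)" for k
  have eps: "eps \<longlonglongrightarrow> 0" "\<And>k. 0 < eps k"
    unfolding eps_def using LIMSEQ_inverse_real_of_nat by (simp_all add: inverse_eq_divide)
  have 1: "(\<lambda>k. \<integral>w. cis (2 * pi * (b \<bullet> w)) * of_real (gauss (eps k *\<^sub>R w)) * G w \<partial>lborel) \<longlonglongrightarrow>
      (\<integral>w. cis (2 * pi * (b \<bullet> w)) * of_real (gauss (0 :: real ^ 'n)) * G w \<partial>lborel)"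
  proof (rule integral_dominated_convergence[where w = "\<lambda>w. gauss (0 :: real ^ 'n) * cmod (G w)"])
    show "integrable lborel (\<lambda>w. gauss (0 :: real ^ 'n) * cmod (G w))"
      using intG by simp
    have "(\<lambda>k. gauss (eps k *\<^sub>R w)) \<longlonglongrightarrow> gauss (0 :: real ^ 'n)" for w :: "real ^ 'n"
      unfolding gauss_def std_normal_density_def
      by (auto intro!: tendsto_eq_intros eps)
    then show "AE w in lborel. (\<lambda>k. cis (2 * pi * (b \<bullet> w)) * of_real (gauss (eps k *\<^sub>R w)) * G w)
        \<longlonglongrightarrow> cis (2 * pi * (b \<bullet> w)) * of_real (gauss (0 :: real ^ 'n)) * G w"
      by (intro AE_I2 tendsto_intros)
    show "AE w in lborel. cmod (cis (2 * pi * (b \<bullet> w)) * of_real (gauss (eps k *\<^sub>R w)) * G w) \<le>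
        gauss (0 :: real ^ 'n) * cmod (G w)" for k
      by (intro AE_I2) (auto simp: norm_mult gauss_nonneg intro!: mult_right_mono gauss_le)
  qed measurable
  have 2: "(\<lambda>k. \<integral>u. g (- b + eps k *\<^sub>R u) * of_real (gauss_dual u) \<partial>lborel) \<longlonglongrightarrow>
      (\<integral>u. g (- b) * of_real (gauss_dual (u :: real ^ 'n)) \<partial>lborel)"
  proof (rule integral_dominated_convergence[where w = "\<lambda>u :: real ^ 'n. M * gauss_dual u"])
    show "integrable lborel (\<lambda>u. M * gauss_dual (u :: real ^ 'n))"
      by (intro integrable_mult_right integrable_gauss_dual)
    have "(\<lambda>k. g (- b + eps k *\<^sub>R u)) \<longlonglongrightarrow> g (- b)" for u
    proof -
      have "isCont g (- b)" using cont by (simp add: continuous_on_eq_continuous_at)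
      moreover have "(\<lambda>k. - b + eps k *\<^sub>R u) \<longlonglongrightarrow> - b"
        by (auto intro!: tendsto_eq_intros eps)
      ultimately show ?thesis by (rule isCont_tendsto_compose)
    qed
    then show "AE u in lborel. (\<lambda>k. g (- b + eps k *\<^sub>R u) * of_real (gauss_dual u)) \<longlonglongrightarrow>
        g (- b) * of_real (gauss_dual u)"
      by (intro AE_I2 tendsto_intros)
    show "AE u in lborel. cmod (g (- b + eps k *\<^sub>R u) * of_real (gauss_dual u)) \<le> M * gauss_dual u" for k
      by (intro AE_I2) (auto simp: norm_mult gauss_dual_nonneg intro!: mult_right_mono M)
  qed measurable
  have "(\<integral>w. cis (2 * pi * (b \<bullet> w)) * of_real (gauss (0 :: real ^ 'n)) * G w \<partial>lborel) =
      (\<integral>u. g (- b) * of_real (gauss_dual (u :: real ^ 'n)) \<partial>lborel)"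
    by (rule LIMSEQ_unique[OF 1]) (simp only: reg[OF eps(2)] 2)
  also have "\<dots> = g (- b) * of_real (gauss (0 :: real ^ 'n))"
    by (subst integral_mult_right_zero) (simp only: integral_complex_of_real integral_gauss_dual)
  finally have "of_real (gauss (0 :: real ^ 'n)) * (\<integral>w. cis (2 * pi * (b \<bullet> w)) * G w \<partial>lborel) =
      of_real (gauss (0 :: real ^ 'n)) * g (- b)"
    by (simp add: mult_ac flip: integral_mult_right_zero)
  moreover have "complex_of_real (gauss (0 :: real ^ 'n)) \<noteq> 0"
    using gauss_0_pos[where 'n = 'n] by simp
  ultimately show ?thesis unfolding G_def by simp
qed

section \<open>The partial Fourier transform\<close>

lemma vfst_join [simp]: "vfst (join x y) = x"
  and vsnd_join [simp]: "vsnd (join x y) = y"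
  and join_vfst_vsnd [simp]: "join (vfst z) (vsnd z) = z"
  by (simp_all add: vec_eq_iff vfst_def vsnd_def join_def split: sum.split)

lemma join_component [simp]: "join x y $ Inl a = x $ a" "join x y $ Inr b = y $ b"
  by (simp_all add: join_def)

lemma sum_UNIV_Plus:
  fixes f :: "'a::finite + 'b::finite \<Rightarrow> 'c::comm_monoid_add"
  shows "(\<Sum>i\<in>UNIV. f i) = (\<Sum>a\<in>UNIV. f (Inl a)) + (\<Sum>b\<in>UNIV. f (Inr b))"
  by (subst UNIV_Plus_UNIV[symmetric], subst sum.Plus) (simp_all add: o_def)

lemma prod_UNIV_Plus:
  fixes f :: "'a::finite + 'b::finite \<Rightarrow> 'c::comm_monoid_mult"
  shows "(\<Prod>i\<in>UNIV. f i) = (\<Prod>a\<in>UNIV. f (Inl a)) * (\<Prod>b\<in>UNIV. f (Inr b))"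
  by (subst UNIV_Plus_UNIV[symmetric], subst prod.Plus) (simp_all add: o_def)

lemma inner_join: "z \<bullet> join x y = vfst z \<bullet> x + vsnd z \<bullet> y"
  by (simp add: inner_vec_def sum_UNIV_Plus vfst_def vsnd_def)

lemma continuous_join [continuous_intros]:
  fixes f :: "'a::topological_space \<Rightarrow> real ^ 'c::finite" and g :: "'a \<Rightarrow> real ^ 'd::finite"
  assumes "continuous_on S f" "continuous_on S g"
  shows "continuous_on S (\<lambda>x. join (f x) (g x))"
  unfolding join_def
proof (intro continuous_on_vec_lambda)
  fix i :: "'c + 'd"
  show "continuous_on S (\<lambda>x. case i of Inl a \<Rightarrow> f x $ a | Inr b \<Rightarrow> g x $ b)"
    by (cases i) (simp_all add: continuous_on_component assms)
qed

lemma measurable_join [measurable]: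
  "(\<lambda>p. join (fst p) (snd p)) \<in> lborel \<Otimes>\<^sub>M lborel \<rightarrow>\<^sub>M (borel :: (real ^ ('a::finite + 'b::finite)) measure)"
proof -
  have "(\<lambda>p. join (fst p) (snd p)) \<in>
      (borel :: ((real ^ 'a) \<times> (real ^ 'b)) measure) \<rightarrow>\<^sub>M (borel :: (real ^ ('a + 'b)) measure)"
    by (intro borel_measurable_continuous_onI continuous_intros)
  moreover have "sets (lborel \<Otimes>\<^sub>M lborel) = sets (borel :: ((real ^ 'a) \<times> (real ^ 'b)) measure)"
    by (metis borel_prod sets_lborel sets_pair_measure_cong)
  ultimately show ?thesis using measurable_cong_sets by blast
qed

lemma lborel_join:
  "(lborel :: (real ^ ('a::finite + 'b::finite)) measure) =
    distr (lborel \<Otimes>\<^sub>M lborel) borel (\<lambda>p. join (fst p) (snd p))"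
proof (rule lborel_eqI)
  fix l u :: "real ^ ('a + 'b)"
  assume lu: "\<And>b. b \<in> Basis \<Longrightarrow> l \<bullet> b \<le> u \<bullet> b"
  have le: "l $ i \<le> u $ i" for i
    using lu[of "axis i 1"] by (simp add: inner_axis)
  have box: "emeasure lborel (box k w) = ennreal (\<Prod>i\<in>UNIV. (w - k) $ i)" if "\<And>i. k $ i \<le> w $ i"
    for k w :: "real ^ 'n::finite"
  proof -
    have "emeasure lborel (box k w) = ennreal (\<Prod>b\<in>Basis. (w - k) \<bullet> b)"
      by (rule emeasure_lborel_box) (use that in \<open>auto simp: Basis_vec_real inner_axis\<close>)
    then show ?thesis
      by (subst (asm) prod.reindex_bij_betw[OF bij_betw_axis_Basis, symmetric]) (simp add: inner_axis)
  qed
  have pre: "(\<lambda>p. join (fst p) (snd p)) -` box l u = box (vfst l) (vfst u) \<times> box (vsnd l) (vsnd u)"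
  proof (rule set_eqI)
    fix p :: "(real ^ 'a) \<times> (real ^ 'b)"
    show "p \<in> (\<lambda>p. join (fst p) (snd p)) -` box l u \<longleftrightarrow> p \<in> box (vfst l) (vfst u) \<times> box (vsnd l) (vsnd u)"
      by (simp only: vimage_eq mem_box_cart split_sum_all mem_Times_iff) (simp add: vfst_def vsnd_def)
  qed
  have "emeasure (distr (lborel \<Otimes>\<^sub>M lborel) borel (\<lambda>p. join (fst p) (snd p))) (box l u) =
      emeasure (lborel \<Otimes>\<^sub>M lborel) (box (vfst l) (vfst u) \<times> box (vsnd l) (vsnd u))"
    by (subst emeasure_distr) (auto simp: pre space_pair_measure)
  also have "\<dots> = emeasure lborel (box (vfst l) (vfst u)) * emeasure lborel (box (vsnd l) (vsnd u))"
    by (rule lborel.emeasure_pair_measure_Times) auto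
  also have "\<dots> = ennreal (\<Prod>i\<in>UNIV. (u - l) $ i)"
    using le by (simp add: box vfst_def vsnd_def prod_UNIV_Plus ennreal_mult prod_nonneg)
  also have "(\<Prod>i\<in>UNIV. (u - l) $ i) = (\<Prod>b\<in>Basis. (u - l) \<bullet> b)"
    by (subst prod.reindex_bij_betw[OF bij_betw_axis_Basis, symmetric]) (simp add: inner_axis)
  finally show "emeasure (distr (lborel \<Otimes>\<^sub>M lborel) borel (\<lambda>p. join (fst p) (snd p))) (box l u) =
      ennreal (\<Prod>b\<in>Basis. (u - l) \<bullet> b)" .
qed simp

lemma integral_join:
  fixes f :: "real ^ ('a::finite + 'b::finite) \<Rightarrow> complex"
  assumes "integrable lborel f"
  shows "(\<integral>z. f z \<partial>lborel) = (\<integral>x. \<integral>y. f (join x y) \<partial>lborel \<partial>lborel)"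
proof -
  have m [measurable]: "f \<in> borel_measurable borel" using assms by simp
  have "integrable (lborel \<Otimes>\<^sub>M lborel) (\<lambda>p. f (join (fst p) (snd p)))"
    using assms by (subst (asm) lborel_join, subst (asm) integrable_distr_eq) auto
  from lborel_pair.integral_fst'[OF this]
  show ?thesis by (subst lborel_join, subst integral_distr) auto
qed

lemma sum_axis [simp]:
  fixes f :: "'n::finite \<Rightarrow> 'a::comm_ring_1"
  shows "(\<Sum>j\<in>UNIV. axis b 1 $ j * f j) = f b"
    and "(\<Sum>j\<in>UNIV. of_real (axis b 1 $ j) * g j) = (g b :: complex)"
    and "(\<Sum>j\<in>UNIV. of_real (axis j 1 $ b) * g j) = (g b :: complex)"
  by (simp_all add: axis_def if_distrib if_distribR cong: if_cong)

lemma vec_eq_Plus: "x = y \<longleftrightarrow> vfst x = vfst y \<and> vsnd x = vsnd y"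
  by (metis join_vfst_vsnd)

definition embed_snd :: "real ^ 'b::finite ^ ('a::finite + 'b)" where
  "embed_snd = (\<chi> i. case i of Inl a \<Rightarrow> 0 | Inr b \<Rightarrow> axis b 1)"

lemma embed_snd: "embed_snd *v y = join 0 y"
  by (simp add: vec_eq_Plus) (simp add: vec_eq_iff vfst_def vsnd_def embed_snd_def matrix_vector_component)

lemma embed_snd_join: "embed_snd *v y + join x 0 = join x y"
  unfolding embed_snd by (simp add: vec_eq_Plus) (simp add: vec_eq_iff vfst_def vsnd_def)

definition proj_fst :: "real ^ ('a::finite + 'b::finite) ^ ('a + 'b)" where
  "proj_fst = (\<chi> i. case i of Inl a \<Rightarrow> axis (Inl a) 1 | Inr b \<Rightarrow> 0)"

lemma proj_fst_join: "proj_fst *v z + join 0 y = join (vfst z) y"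
  by (simp add: vec_eq_Plus) (simp add: vec_eq_iff vfst_def vsnd_def proj_fst_def matrix_vector_component)

lemma schwartz_section:
  fixes F :: "real ^ ('a::finite + 'b::finite) \<Rightarrow> complex"
  assumes "F \<in> schwartz"
  shows "(\<lambda>y. F (join x y)) \<in> schwartz"
proof -
  have "(\<chi> b. axis (Inr b) 1) ** (embed_snd :: real ^ 'b ^ ('a + 'b)) = mat 1"
    unfolding matrix_eq
    by (simp add: matrix_vector_mul_assoc[symmetric] embed_snd vsnd_eq[symmetric])
  from schwartz_affine[OF assms this, of "join x 0"] show ?thesis by (simp only: embed_snd_join)
qed

lemma norm_vsnd_le: "norm y \<le> norm (join x y)"
  unfolding norm_eq_sqrt_inner inner_join by simp

lemma schwartz_section_decay:
  fixes F :: "real ^ ('a::finite + 'b::finite) \<Rightarrow> complex"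
  assumes "F \<in> schwartz"
  shows "(1 + norm y) ^ k * cmod (F (join x y)) \<le> sw_seminorm k [] F"
proof -
  have "(1 + norm y) ^ k * cmod (F (join x y)) \<le> (1 + norm (join x y)) ^ k * cmod (F (join x y))"
    by (intro mult_right_mono power_mono add_left_mono norm_vsnd_le) auto
  then show ?thesis using sw_seminorm_upper0[OF assms] by (rule order_trans)
qed

lemma partial_section:
  fixes F :: "real ^ ('a::finite + 'b::finite) \<Rightarrow> complex"
  assumes F: "F \<in> schwartz"
  shows "partial b (\<lambda>y. F (join x y)) y = partial (Inr b) F (join x y)"
    and "partial i (\<lambda>z. F (join (vfst z) y)) z = (case i of Inl a \<Rightarrow> partial i F (join (vfst z) y) | Inr _ \<Rightarrow> 0)"
    and "smooth (\<lambda>z :: real ^ ('a + 'b). F (join (vfst z) y))"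
proof -
  have "partial b (\<lambda>y. F (embed_snd *v y + join x 0)) y =
      (\<Sum>i\<in>UNIV. of_real (embed_snd $ i $ b) * partial i F (embed_snd *v y + join x 0))"
    by (rule partial_affine) (rule schwartz_differentiable[OF F])
  then have "partial b (\<lambda>y. F (join x y)) y = (\<Sum>i\<in>UNIV. of_real (embed_snd $ i $ b) * partial i F (join x y))"
    unfolding embed_snd_join .
  then show "partial b (\<lambda>y. F (join x y)) y = partial (Inr b) F (join x y)"
    by (simp add: sum_UNIV_Plus embed_snd_def)
  have "partial i (\<lambda>z. F (proj_fst *v z + join 0 y)) z =
      (\<Sum>j\<in>UNIV. of_real (proj_fst $ j $ i) * partial j F (proj_fst *v z + join 0 y))"
    by (rule partial_affine) (rule schwartz_differentiable[OF F])
  then have "partial i (\<lambda>z. F (join (vfst z) y)) z = (\<Sum>j\<in>UNIV. of_real (proj_fst $ j $ i) * partial j F (join (vfst z) y))"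
    unfolding proj_fst_join .
  then show "partial i (\<lambda>z. F (join (vfst z) y)) z = (case i of Inl a \<Rightarrow> partial i F (join (vfst z) y) | Inr _ \<Rightarrow> 0)"
    by (cases i) (simp_all add: sum_UNIV_Plus proj_fst_def axis_def if_distrib if_distribR cong: if_cong)
  show "smooth (\<lambda>z :: real ^ ('a + 'b). F (join (vfst z) y))"
    using smooth_affine[OF schwartz_smooth[OF F], of proj_fst "join 0 y"] unfolding proj_fst_join .
qed

text \<open>
  On the transformed side a derivative in the frequency variable is a multiplication on the original
  side, and multiplication by a frequency coordinate is a derivative. Hence the transforms of Schwartz
  functions form a class as in the coinduction principle above.
\<close>

lemma schwartz_partial_inv_fourier:
  fixes F :: "real ^ ('d::finite + 'd) \<Rightarrow> complex"
  assumes "F \<in> schwartz"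
  shows "partial_inv_fourier F \<in> schwartz"
proof (rule schwartz_coinduct[where C = "partial_inv_fourier ` schwartz"])
  fix h :: "real ^ ('d + 'd) \<Rightarrow> complex" and i :: "'d + 'd" and z0 :: "real ^ ('d + 'd)"
  assume "h \<in> partial_inv_fourier ` schwartz"
  then obtain F where F: "F \<in> schwartz" and h: "h = partial_inv_fourier F" by blast
  let ?k = "2 * CARD('d)"
  have sec: "(\<lambda>y. cis (2 * pi * (y \<bullet> w)) * F (join x y)) \<in> schwartz"
    if "F \<in> schwartz" for F :: "real ^ ('d + 'd) \<Rightarrow> complex" and x and w :: "real ^ 'd"
    using schwartz_modulation[OF schwartz_section[OF that], of w x] by (simp add: inner_commute)
  have sec_bound: "(\<integral>y. cmod (cis (2 * pi * (y \<bullet> w)) * F (join x y)) \<partial>lborel) \<le>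
      sw_seminorm ?k [] F * decay_mass TYPE('d)" for w x
  proof -
    have "(\<integral>y. cmod (F (join x y)) \<partial>lborel) \<le> sw_seminorm ?k [] F * decay_mass TYPE('d)"
      by (rule integral_norm_decay[OF smooth_measurable[OF schwartz_smooth[OF schwartz_section[OF F]]]
            schwartz_section_decay[OF F]])
    then show ?thesis by (simp add: norm_mult)
  qed
  have "cmod (h z) \<le> sw_seminorm ?k [] F * decay_mass TYPE('d)" for z
    unfolding h partial_inv_fourier_def
    by (rule order_trans[OF integral_norm_bound sec_bound])
  then show "\<exists>M. \<forall>z. cmod (h z) \<le> M" by blast
  have coord: "(\<lambda>z. of_real (z $ i) * h z) \<in> partial_inv_fourier ` schwartz" for i
  proof (cases i)
    case (Inl a)
    have "of_real (z $ i) * h z = partial_inv_fourier (\<lambda>z. of_real (z $ i) * F z) z" for z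
      unfolding h partial_inv_fourier_def Inl
      by (simp add: vfst_def mult.left_commute flip: integral_mult_right_zero)
    then show ?thesis using schwartz_coord[OF F, of i] by (intro image_eqI) auto
  next
    case (Inr b)
    let ?c = "\<i> / (2 * pi) :: complex"
    have "of_real (z $ i) * h z = partial_inv_fourier (\<lambda>z. ?c * partial i F z) z" for z
    proof -
      have "partial_inv_fourier (\<lambda>z. ?c * partial i F z) z =
          ?c * (\<integral>y. cis (2 * pi * (vsnd z \<bullet> y)) * partial b (\<lambda>y. F (join (vfst z) y)) y \<partial>lborel)"
        unfolding partial_inv_fourier_def partial_section(1)[OF F] Inr
        by (subst integral_mult_right_zero[symmetric]) (simp add: mult.left_commute inner_commute)
      also have "\<dots> = ?c * (- (of_real (2 * pi * vsnd z $ b) * \<i>)) *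
          ((\<integral>y. cis (2 * pi * (vsnd z \<bullet> y)) * F (join (vfst z) y) \<partial>lborel))"
        by (subst integral_cis_partial[OF schwartz_section[OF F]]) (simp only: mult.assoc)
      also have "?c * (- (of_real (2 * pi * vsnd z $ b) * \<i>)) = of_real (z $ i)"
        by (simp add: Inr vsnd_def complex_eq_iff)
      also have "of_real (z $ i) * (\<integral>y. cis (2 * pi * (vsnd z \<bullet> y)) * F (join (vfst z) y) \<partial>lborel) =
          of_real (z $ i) * h z"
        unfolding h partial_inv_fourier_def by (simp add: inner_commute)
      finally show ?thesis by simp
    qed
    then show ?thesis using schwartz_cmult[OF schwartz_partial[OF F, of i], of ?c] by (intro image_eqI) auto
  qed
  then show "(\<lambda>z. of_real (z $ i) * h z) \<in> sums_of (partial_inv_fourier ` schwartz)"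
    by (rule sums_of.base)
  \<comment> \<open>The functions whose transforms are the partial derivatives of the transform of \<open>F\<close>.\<close>
  define D where "D i = (case i of Inl a \<Rightarrow> partial i F | Inr b \<Rightarrow> (\<lambda>z. (2 * of_real pi * \<i>) * (of_real (z $ i) * F z)))"
    for i
  have D: "D i \<in> schwartz" for i
    unfolding D_def by (auto split: sum.split intro!: schwartz_partial schwartz_cmult schwartz_coord F)
  let ?K = "\<lambda>z y. cis (2 * pi * (y \<bullet> vsnd z)) * F (join (vfst z) y)"
  let ?K' = "\<lambda>z y h. \<Sum>i\<in>UNIV. of_real (h $ i) * (cis (2 * pi * (y \<bullet> vsnd z)) * D i (join (vfst z) y))"
  have cis_eq: "cis (2 * pi * (y \<bullet> vsnd z)) = cis (2 * pi * (join 0 y \<bullet> z))" for y and z :: "real ^ ('d + 'd)"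
    by (subst inner_commute[of "join 0 y"]) (simp add: inner_join inner_commute)
  have smooth_K: "smooth (\<lambda>z. ?K z y)" for y
    unfolding cis_eq by (intro smooth_mult smooth_cis partial_section(3) F)
  have part_K: "partial i (\<lambda>z. ?K z y) z = cis (2 * pi * (y \<bullet> vsnd z)) * D i (join (vfst z) y)" for i y z
    unfolding cis_eq
    by (subst partial_mult[OF differentiable_cis smooth_differentiable[OF partial_section(3)[OF F]]],
        simp only: partial_cis partial_section(2)[OF F])
       (cases i; simp add: D_def)
  have der: "((\<lambda>z. ?K z y) has_derivative ?K' z y) (at z)" for z y
    using has_derivative_partial[OF smooth_differentiable[OF smooth_K[of y]], of z] unfolding part_K .
  have int: "integrable lborel (\<lambda>y. cis (2 * pi * (y \<bullet> vsnd z)) * G (join (vfst z) y))" if "G \<in> schwartz"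
    for z and G :: "real ^ ('d + 'd) \<Rightarrow> complex"
    by (rule schwartz_integrable[OF sec[OF that]])
  have Dh: "(h has_derivative (\<lambda>k. \<integral>y. ?K' z y k \<partial>lborel)) (at z)" for z
    unfolding h partial_inv_fourier_def[abs_def]
  proof (rule has_derivative_integral[where r = 1 and
        b = "\<lambda>y. (\<Sum>i\<in>UNIV. sw_seminorm ?k [] (D i)) * (1 / (1 + norm y) ^ ?k)"])
    fix z y k
    have "cmod (?K' z y k) \<le> (\<Sum>i\<in>UNIV. norm k * (sw_seminorm ?k [] (D i) * (1 / (1 + norm y) ^ ?k)))"
    proof (rule sum_norm_le)
      fix i
      have "cmod (D i (join (vfst z) y)) \<le> sw_seminorm ?k [] (D i) * (1 / (1 + norm y) ^ ?k)"
        using schwartz_section_decay[OF D, of y ?k i "vfst z"] by (simp add: field_simps add_pos_nonneg)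
      then show "cmod (of_real (k $ i) * (cis (2 * pi * (y \<bullet> vsnd z)) * D i (join (vfst z) y))) \<le>
          norm k * (sw_seminorm ?k [] (D i) * (1 / (1 + norm y) ^ ?k))"
        unfolding norm_mult by (intro mult_mono[of "cmod (of_real (k $ i))"]) (simp_all add: component_le_norm_cart)
    qed
    then show "cmod (?K' z y k) \<le> (\<Sum>i\<in>UNIV. sw_seminorm ?k [] (D i)) * (1 / (1 + norm y) ^ ?k) * norm k"
      by (simp only: sum_distrib_left[symmetric] sum_distrib_right[symmetric] mult_ac)
  next
    show "integrable lborel (\<lambda>y :: real ^ 'd. (\<Sum>i\<in>UNIV. sw_seminorm ?k [] (D i)) * (1 / (1 + norm y) ^ ?k))"
      by (intro integrable_mult_right integrable_decay)
  qed (auto intro!: der int F D)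
  then show "h differentiable (at z0)" unfolding differentiable_def by blast
  have "partial i h z = partial_inv_fourier (D i) z" for z
    unfolding partial_eq[OF Dh] partial_inv_fourier_def
    by (simp add: axis_def if_distrib if_distribR cong: if_cong)
  then have "partial i h = partial_inv_fourier (D i)" ..
  then show "partial i h \<in> sums_of (partial_inv_fourier ` schwartz)"
    using D by (intro sums_of.base) simp
qed (use assms in \<open>auto intro!: sums_of.base\<close>)

section \<open>Continuity of functionals\<close>

text \<open>
  The subbasic sets are seminorm balls around arbitrary centres, so a sequence that converges in all
  seminorms enters each of them by the triangle inequality.
\<close>

lemma seminorm_topology_limit:
  assumes V: "V \<subseteq> schwartz" and P: "P \<noteq> {}" "P \<subseteq> range (\<lambda>(k, is). sw_seminorm k is)"
    and f: "\<And>n. f n \<in> V" "l \<in> V"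
    and lim: "\<And>k is. (\<lambda>n. sw_seminorm k is (\<lambda>x. f n x - l x)) \<longlonglongrightarrow> 0"
  shows "limitin (seminorm_topology V P) f l sequentially"
proof -
  let ?B = "{{g \<in> V. q (\<lambda>x. g x - f x) < e} | f q e. f \<in> V \<and> q \<in> P \<and> e > 0}"
  have zero: "sw_seminorm k is (\<lambda>x. 0) = 0" for k "is"
    by (simp add: sw_seminorm_def)
  obtain q where "q \<in> P" using P by blast
  moreover from this obtain k "is" where "q = sw_seminorm k is" using P(2) by auto
  ultimately have q: "sw_seminorm k is \<in> P" by simp
  have "l \<in> {g \<in> V. sw_seminorm k is (\<lambda>x. g x - l x) < 1}"
    using f(2) by (simp add: zero)
  moreover have "{g \<in> V. sw_seminorm k is (\<lambda>x. g x - l x) < 1} \<in> ?B"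
    using f(2) q zero_less_one by blast
  ultimately have top: "l \<in> topspace (topology_generated_by ?B)"
    unfolding topology_generated_by_topspace by (rule UnionI[rotated])
  have ev: "generate_topology_on ?B U \<Longrightarrow> l \<in> U \<longrightarrow> (\<forall>\<^sub>F n in sequentially. f n \<in> U)" for U
  proof (induction rule: generate_topology_on.induct)
    case (Int a b)
    then show ?case by (auto intro: eventually_conj)
  next
    case (UN K)
    show ?case
    proof
      assume "l \<in> \<Union> K"
      then obtain k where k: "k \<in> K" "l \<in> k" by blast
      then have "\<forall>\<^sub>F n in sequentially. f n \<in> k" using UN.IH by blast
      then show "\<forall>\<^sub>F n in sequentially. f n \<in> \<Union> K"
        by (rule eventually_mono) (use k in blast)
    qed
  next
    case (Basis s)
    then obtain h q e where s: "s = {g \<in> V. q (\<lambda>x. g x - h x) < e}" "h \<in> V" "q \<in> P" by blast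
    then have "q \<in> range (\<lambda>(k, is). sw_seminorm k is)" using P(2) by blast
    then obtain k "is" where q: "q = sw_seminorm k is" by auto
    show ?case
    proof
      assume "l \<in> s"
      then have d: "0 < e - q (\<lambda>x. l x - h x)" by (simp add: s)
      have "\<forall>\<^sub>F n in sequentially. sw_seminorm k is (\<lambda>x. f n x - l x) < e - q (\<lambda>x. l x - h x)"
        using order_tendstoD(2)[OF lim d] .
      then show "\<forall>\<^sub>F n in sequentially. f n \<in> s"
      proof (rule eventually_mono)
        fix n
        assume n: "sw_seminorm k is (\<lambda>x. f n x - l x) < e - q (\<lambda>x. l x - h x)"
        have "q (\<lambda>x. f n x - h x) = q (\<lambda>x. (f n x - l x) + (l x - h x))" by simp
        also have "\<dots> \<le> q (\<lambda>x. f n x - l x) + q (\<lambda>x. l x - h x)"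
          unfolding q using f s(2) V by (intro sw_seminorm_triangle schwartz_minus) auto
        finally show "f n \<in> s" using n f(1) unfolding s q by simp
      qed
    qed
  qed simp
  show ?thesis
    unfolding limitin_def seminorm_topology_def
    using top ev openin_topology_generated_by by blast
qed

lemma continuous_functional_tendsto:
  fixes u :: "'n::finite functional"
  assumes u: "continuous_map (seminorm_topology V P) euclidean u"
    and "V \<subseteq> schwartz" "P \<noteq> {}" "P \<subseteq> range (\<lambda>(k, is). sw_seminorm k is)"
    and "\<And>n. f n \<in> V" "l \<in> V"
    and "\<And>k is. (\<lambda>n. sw_seminorm k is (\<lambda>x. f n x - l x)) \<longlonglongrightarrow> 0"
  shows "(\<lambda>n. u (f n)) \<longlonglongrightarrow> u l"
  using continuous_map_limit[OF u seminorm_topology_limit[OF assms(2-7)]]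
  by (simp add: limitin_canonical_iff o_def)

lemma tempered_tendsto:
  assumes "U \<in> tempered" "\<And>n. f n \<in> schwartz" "l \<in> schwartz"
    and "\<And>k is. (\<lambda>n. sw_seminorm k is (\<lambda>x. f n x - l x)) \<longlonglongrightarrow> 0"
  shows "(\<lambda>n. U (f n)) \<longlonglongrightarrow> U l"
proof -
  have "continuous_map (seminorm_topology schwartz (range (\<lambda>(k, is). sw_seminorm k is))) euclidean U"
    using assms(1) unfolding tempered_def schwartz_topology_def by blast
  from continuous_functional_tendsto[OF this _ _ _ assms(2-4)] show ?thesis by auto
qed

text \<open>
  By linearity, the preimage of an open set contains a ball of the dominating seminorm around each of its
  points.
\<close>

lemma temperedI:
  fixes U :: "'n::finite functional"
  assumes zero: "\<And>\<phi>. \<phi> \<notin> schwartz \<Longrightarrow> U \<phi> = 0"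
    and lin: "linear_form_on schwartz U"
    and bound: "\<And>\<phi>. \<phi> \<in> schwartz \<Longrightarrow> cmod (U \<phi>) \<le> M * sw_seminorm k [] \<phi>"
  shows "U \<in> tempered"
proof -
  let ?B = "{{g \<in> schwartz. q (\<lambda>x. g x - f x) < e} | f q e.
      f \<in> schwartz \<and> q \<in> range (\<lambda>(k, is). sw_seminorm k is) \<and> e > 0}"
  have diff: "U (\<lambda>x. g x - f x) = U g - U f" if "f \<in> schwartz" "g \<in> schwartz" for f g
    using lin[unfolded linear_form_on_def, rule_format, OF that(2,1), of 1 "- 1"] by simp
  have top: "topspace schwartz_topology \<subseteq> schwartz"
    unfolding schwartz_topology_def seminorm_topology_def topology_generated_by_topspace by blast
  have "openin schwartz_topology {f \<in> topspace schwartz_topology. U f \<in> W}" if W: "open W" for W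
  proof (subst openin_subopen, intro ballI)
    fix f
    assume f: "f \<in> {f \<in> topspace schwartz_topology. U f \<in> W}"
    then have fs: "f \<in> schwartz" using top by blast
    obtain e where e: "0 < e" "\<And>w. dist w (U f) < e \<Longrightarrow> w \<in> W"
      using W f unfolding open_dist by blast
    let ?N = "{g \<in> schwartz. sw_seminorm k [] (\<lambda>x. g x - f x) < e / (\<bar>M\<bar> + 1)}"
    have NB: "?N \<in> ?B" using fs e(1) by (intro CollectI exI[of _ f] exI[of _ "sw_seminorm k []"] exI[of _ "e / (\<bar>M\<bar> + 1)"]) auto
    then have op: "openin schwartz_topology ?N"
      unfolding schwartz_topology_def seminorm_topology_def by (rule topology_generated_by_Basis)
    have "U g \<in> W" if "g \<in> ?N" for g
    proof (rule e(2))
      have g: "g \<in> schwartz" "sw_seminorm k [] (\<lambda>x. g x - f x) < e / (\<bar>M\<bar> + 1)" using that by auto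
      have gf: "(\<lambda>x. g x - f x) \<in> schwartz" using g fs by (intro schwartz_minus)
      have "dist (U g) (U f) = cmod (U (\<lambda>x. g x - f x))" by (simp add: diff[OF fs g(1)] dist_norm)
      also have "\<dots> \<le> M * sw_seminorm k [] (\<lambda>x. g x - f x)" by (rule bound[OF gf])
      also have "\<dots> \<le> (\<bar>M\<bar> + 1) * sw_seminorm k [] (\<lambda>x. g x - f x)"
        by (intro mult_right_mono sw_seminorm_nonneg gf) auto
      also have "\<dots> < e" using g(2) by (simp add: field_simps)
      finally show "dist (U g) (U f) < e" .
    qed
    moreover have "f \<in> ?N" using fs e(1) by (simp add: sw_seminorm_def)
    moreover have "?N \<subseteq> topspace schwartz_topology" using op by (rule openin_subset)
    ultimately show "\<exists>T. openin schwartz_topology T \<and> f \<in> T \<and> T \<subseteq> {f \<in> topspace schwartz_topology. U f \<in> W}"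
      using op by (intro exI[of _ ?N]) blast
  qed
  then have "continuous_map schwartz_topology euclidean U"
    unfolding continuous_map_def by auto
  then show ?thesis unfolding tempered_def using zero lin by auto
qed

section \<open>Test functions\<close>

lemma test_on_partial:
  assumes K: "compact K" and f: "f \<in> test_on K"
  shows "partial i f \<in> test_on K"
proof -
  have "partial i f x = 0" if "x \<notin> K" for x
  proof -
    have "open (- K)" using K by (simp add: compact_imp_closed open_Compl)
    then have "(f has_derivative (\<lambda>_. 0)) (at x)"
      using f that
      by (intro has_derivative_transform_within_open[of "\<lambda>_. 0" "\<lambda>_. 0" x UNIV "- K" f])
         (auto simp: test_on_def)
    from partial_eq[OF this] show ?thesis by simp
  qed
  then show ?thesis using f by (auto simp: test_on_def smooth_partial)
qed

lemma test_on_schwartz: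
  assumes K: "compact K" shows "test_on K \<subseteq> schwartz"
proof
  fix f assume "f \<in> test_on K"
  then show "f \<in> schwartz"
  proof (intro schwartz_coinduct[where C = "test_on K"] sums_of.base)
    fix f :: "real ^ 'a \<Rightarrow> complex" and i x
    assume f: "f \<in> test_on K"
    then show "f differentiable (at x)" by (simp add: test_on_def smooth_differentiable)
    have "bounded (f ` K)"
      using f by (intro compact_imp_bounded compact_continuous_image[OF _ K] smooth_continuous)
        (simp add: test_on_def)
    then obtain M where "\<forall>x\<in>K. cmod (f x) \<le> M" by (auto simp: bounded_iff)
    then have "cmod (f x) \<le> \<bar>M\<bar>" for x
      using f by (cases "x \<in> K") (auto simp: test_on_def intro: order_trans[OF _ abs_ge_self])
    then show "\<exists>M. \<forall>x. cmod (f x) \<le> M" by blast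
    show "partial i f \<in> test_on K" by (rule test_on_partial[OF K f])
    show "(\<lambda>x. of_real (x $ i) * f x) \<in> test_on K"
      using f by (auto simp: test_on_def intro: smooth_mult smooth_coord)
  qed
qed

lemma test_functions_schwartz: "f \<in> test_functions \<Longrightarrow> f \<in> schwartz"
  using test_on_schwartz unfolding test_functions_def by blast

lemma test_functions_smooth: "f \<in> test_functions \<Longrightarrow> smooth f"
  by (intro schwartz_smooth test_functions_schwartz)

lemma test_functionsI: "smooth f \<Longrightarrow> compact K \<Longrightarrow> (\<And>x. x \<notin> K \<Longrightarrow> f x = 0) \<Longrightarrow> f \<in> test_functions"
  by (auto simp: test_functions_def test_on_def)

lemma test_functionsD:
  "f \<in> test_functions \<Longrightarrow> \<exists>K. compact K \<and> smooth f \<and> (\<forall>x. x \<notin> K \<longrightarrow> f x = 0)"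
  by (auto simp: test_functions_def test_on_def)

lemma test_functions_partial: "f \<in> test_functions \<Longrightarrow> partial i f \<in> test_functions"
  using test_on_partial unfolding test_functions_def by blast

lemma test_functions_mult: "smooth e \<Longrightarrow> f \<in> test_functions \<Longrightarrow> (\<lambda>x. e x * f x) \<in> test_functions"
  using test_functionsD[of f] by (auto intro: test_functionsI smooth_mult)

lemma test_functions_add:
  assumes "f \<in> test_functions" "g \<in> test_functions"
  shows "(\<lambda>x. f x + g x) \<in> test_functions"
proof -
  obtain K L where "compact K" "smooth f" "\<forall>x. x \<notin> K \<longrightarrow> f x = 0"
    "compact L" "smooth g" "\<forall>x. x \<notin> L \<longrightarrow> g x = 0"
    using assms test_functionsD by meson
  then show ?thesis by (intro test_functionsI[of _ "K \<union> L"]) (auto intro: smooth_add)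
qed

lemma test_functions_zero: "(\<lambda>_. 0) \<in> test_functions"
  by (rule test_functionsI[of _ "{}"]) (auto intro: smooth_const)

lemma test_functions_sum:
  "(\<And>i. i \<in> I \<Longrightarrow> f i \<in> test_functions) \<Longrightarrow> (\<lambda>x. \<Sum>i\<in>I. f i x) \<in> test_functions"
  by (induction I rule: infinite_finite_induct) (auto intro: test_functions_zero test_functions_add)

lemma test_functions_translation:
  assumes "f \<in> test_functions" shows "(\<lambda>x. f (x + b)) \<in> test_functions"
proof -
  obtain K where K: "compact K" "smooth f" "\<And>x. x \<notin> K \<Longrightarrow> f x = 0"
    using test_functionsD[OF assms] by auto
  have "compact ((\<lambda>x. x - b) ` K)"
    by (intro compact_continuous_image K continuous_intros)
  moreover have "f (x + b) = 0" if "x \<notin> (\<lambda>x. x - b) ` K" for x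
    using that by (intro K) (auto simp: image_iff)
  ultimately show ?thesis using K by (intro test_functionsI smooth_translation)
qed

lemma test_functions_linear:
  fixes A :: "real ^ 'n::finite ^ 'n"
  assumes f: "f \<in> test_functions" and B: "B ** A = mat 1"
  shows "(\<lambda>x. f (A *v x)) \<in> test_functions"
proof -
  obtain K where K: "compact K" "smooth f" "\<And>x. x \<notin> K \<Longrightarrow> f x = 0"
    using test_functionsD[OF f] by auto
  have "compact ((\<lambda>x. B *v x) ` K)"
    by (intro compact_continuous_image K linear_continuous_on matrix_vector_mul_bounded_linear)
  moreover have "f (A *v x) = 0" if "x \<notin> (\<lambda>x. B *v x) ` K" for x
  proof (rule K(3))
    have "x = B *v (A *v x)" by (simp add: matrix_vector_mul_assoc B)
    then show "A *v x \<notin> K" using that by blast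
  qed
  ultimately show ?thesis using K by (intro test_functionsI smooth_linear)
qed

text \<open>
  The derivative of \<open>flat m\<close> is a combination of \<open>flat (m + 2)\<close> and \<open>flat (m + 1)\<close>, also at 0, where
  all of them vanish. So the whole family is smooth at once.
\<close>

definition flat :: "nat \<Rightarrow> real \<Rightarrow> real" where
  "flat m t = (if t \<le> 0 then 0 else exp (- 1 / t) / t ^ m)"

lemma flat_tendsto_0: "(flat m \<longlongrightarrow> 0) (at 0)"
proof -
  have "((\<lambda>t :: real. (inverse t) ^ m / exp (inverse t)) \<longlongrightarrow> 0) (at_right 0)"
    by (rule filterlim_compose[OF tendsto_power_div_exp_0 filterlim_inverse_at_top_right])
  then have r: "(flat m \<longlongrightarrow> 0) (at_right 0)"
    by (rule Lim_transform_eventually)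
       (auto simp: eventually_at_filter flat_def exp_minus field_simps intro!: always_eventually)
  have "(flat m \<longlongrightarrow> 0) (at_left 0)"
    by (rule Lim_transform_eventually[OF tendsto_const])
       (auto simp: eventually_at_filter flat_def intro!: always_eventually)
  with r show ?thesis by (simp add: filterlim_split_at)
qed

lemma DERIV_flat: "(flat m has_real_derivative (flat (m + 2) t - m * flat (m + 1) t)) (at t)"
proof -
  consider "t < 0" | "t = 0" | "t > 0" by linarith
  then show ?thesis
  proof cases
    case 1
    have "((\<lambda>_. 0) has_real_derivative 0) (at t)" by simp
    then have "(flat m has_real_derivative 0) (at t)"
      by (rule has_field_derivative_transform_within_open[of _ _ _ "{..<0}"]) (use 1 in \<open>auto simp: flat_def\<close>)
    then show ?thesis using 1 by (simp add: flat_def)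
  next
    case 2
    have "((\<lambda>h. (flat m (0 + h) - flat m 0) / h) \<longlongrightarrow> 0) (at 0)"
      by (rule Lim_transform_eventually[OF flat_tendsto_0[of "m + 1"]])
         (auto simp: eventually_at_filter flat_def field_simps intro!: always_eventually)
    then show ?thesis using 2 by (simp add: DERIV_def flat_def)
  next
    case 3
    have "((\<lambda>t. exp (- 1 / t) / t ^ m) has_real_derivative
        (exp (- 1 / t) * (1 / t\<^sup>2) * t ^ m - exp (- 1 / t) * (m * t ^ (m - 1))) / (t ^ m * t ^ m)) (at t)"
      using 3 by (auto intro!: derivative_eq_intros simp: power2_eq_square)
    also have "(exp (- 1 / t) * (1 / t\<^sup>2) * t ^ m - exp (- 1 / t) * (m * t ^ (m - 1))) / (t ^ m * t ^ m) =
        exp (- 1 / t) / t ^ (m + 2) - m * (exp (- 1 / t) / t ^ (m + 1))"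
      using 3 by (cases m) (simp_all add: field_simps power2_eq_square)
    finally have "((\<lambda>t. exp (- 1 / t) / t ^ m) has_real_derivative
        exp (- 1 / t) / t ^ (m + 2) - m * (exp (- 1 / t) / t ^ (m + 1))) (at t)" .
    then have "(flat m has_real_derivative
        exp (- 1 / t) / t ^ (m + 2) - m * (exp (- 1 / t) / t ^ (m + 1))) (at t)"
      by (rule has_field_derivative_transform_within_open[of _ _ _ "{0<..}"]) (use 3 in \<open>auto simp: flat_def\<close>)
    then show ?thesis using 3 by (simp add: flat_def)
  qed
qed

lemma smooth_flat: "smooth (\<lambda>x :: real ^ 'n::finite. complex_of_real (flat m (a * x $ i + b)))"
proof (rule smooth_coinduct[where C = "{\<lambda>x. complex_of_real (c * flat m (a * x $ i + b)) | c m. True}"])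
  let ?C = "{\<lambda>x :: real ^ 'n. complex_of_real (c * flat m (a * x $ i + b)) | c m. True}"
  have D: "((\<lambda>x :: real ^ 'n. complex_of_real (c * flat m (a * x $ i + b))) has_derivative
      (\<lambda>h. of_real (c * ((flat (m + 2) (a * x $ i + b) - m * flat (m + 1) (a * x $ i + b)) * (a * h $ i))))) (at x)"
    for c m and x :: "real ^ 'n"
  proof -
    have "((\<lambda>x :: real ^ 'n. a * x $ i + b) has_derivative (\<lambda>h. a * h $ i)) (at x)"
      by (auto intro!: derivative_eq_intros bounded_linear_imp_has_derivative bounded_linear_vec_nth)
    from has_derivative_compose[OF this DERIV_flat[THEN has_field_derivative_imp_has_derivative]]
    show ?thesis by (auto intro!: derivative_eq_intros)
  qed
  fix f j
  assume "f \<in> ?C"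
  then obtain c m where f: "f = (\<lambda>x. complex_of_real (c * flat m (a * x $ i + b)))" by blast
  show "f differentiable (at x)" for x unfolding f differentiable_def using D by blast
  have "partial j f = (\<lambda>x. complex_of_real ((c * (a * axis j 1 $ i)) * flat (m + 2) (a * x $ i + b)) +
      complex_of_real ((- c * m * (a * axis j 1 $ i)) * flat (m + 1) (a * x $ i + b)))"
    unfolding f by (rule ext, subst partial_eq[OF D]) (simp add: algebra_simps)
  moreover have "(\<lambda>x. complex_of_real (c * flat m (a * x $ i + b))) \<in> ?C" for c m by blast
  ultimately show "partial j f \<in> sums_of ?C"
    by (simp only: sums_of.add sums_of.base)
next
  show "(\<lambda>x. complex_of_real (flat m (a * x $ i + b))) \<in>
      sums_of {\<lambda>x :: real ^ 'n. complex_of_real (c * flat m (a * x $ i + b)) | c m. True}"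
    by (intro sums_of.base CollectI exI[of _ 1] exI[of _ m]) simp
qed

definition step :: "real \<Rightarrow> real" where
  "step t = flat 0 t / (flat 0 t + flat 0 (1 - t))"

lemma flat_nonneg: "0 \<le> flat m t" by (simp add: flat_def)

lemma step_denom_pos: "0 < flat 0 t + flat 0 (1 - t)"
  by (auto simp: flat_def add_pos_nonneg)

lemma step_bounds: "0 \<le> step t" "step t \<le> 1"
  using step_denom_pos[of t] flat_nonneg[of 0 t] flat_nonneg[of 0 "1 - t"]
  by (auto simp: step_def)

lemma step_0: "t \<le> 0 \<Longrightarrow> step t = 0" and step_1: "1 \<le> t \<Longrightarrow> step t = 1"
  by (auto simp: step_def flat_def)

lemma smooth_step: "smooth (\<lambda>x :: real ^ 'n::finite. complex_of_real (step (a * x $ i + b)))"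
proof -
  have eq: "complex_of_real (step (a * x $ i + b)) = of_real (flat 0 (a * x $ i + b)) *
      inverse (of_real (flat 0 (a * x $ i + b)) + of_real (flat 0 ((- a) * x $ i + (1 - b))))" for x :: "real ^ 'n"
    by (simp add: step_def divide_inverse algebra_simps)
  have "smooth (\<lambda>x :: real ^ 'n. inverse (complex_of_real (flat 0 (a * x $ i + b)) + of_real (flat 0 ((- a) * x $ i + (1 - b)))))"
  proof (rule smooth_inverse)
    show "complex_of_real (flat 0 (a * x $ i + b)) + of_real (flat 0 ((- a) * x $ i + (1 - b))) \<noteq> 0" for x :: "real ^ 'n"
    proof -
      have "1 - (a * x $ i + b) = (- a) * x $ i + (1 - b)" by simp
      then show ?thesis
        using step_denom_pos[of "a * x $ i + b"] by (metis less_irrefl of_real_add of_real_eq_0_iff)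
    qed
  qed (intro smooth_add smooth_flat)
  then show ?thesis unfolding eq by (intro smooth_mult smooth_flat)
qed

text \<open>
  Built so that its integer translates telescope: only two of them are nonzero at a given point, and the
  intermediate value of \<open>step\<close> cancels. The support is in \<open>{0..2}\<close>.
\<close>

definition tent :: "real \<Rightarrow> real" where "tent t = step t - step (t - 1)"

lemma tent_nonneg: "0 \<le> tent t"
  using step_bounds[of t] step_bounds[of "t - 1"] step_0[of "t - 1"] step_1[of t]
  by (cases "t \<le> 1") (auto simp: tent_def)

lemma tent_0: "t \<le> 0 \<or> 2 \<le> t \<Longrightarrow> tent t = 0"
  by (auto simp: tent_def step_0 step_1)

lemma tent_sum: "tent (t - of_int \<lfloor>t\<rfloor>) + tent (t - (of_int \<lfloor>t\<rfloor> - 1)) = 1"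
proof -
  have "step (t - \<lfloor>t\<rfloor> - 1) = 0" by (rule step_0) linarith
  moreover have "step (t - (\<lfloor>t\<rfloor> - 1)) = 1" by (rule step_1) linarith
  moreover have "t - (\<lfloor>t\<rfloor> - 1) - 1 = t - \<lfloor>t\<rfloor>" by simp
  ultimately show ?thesis unfolding tent_def by simp
qed

definition std_partition :: "real ^ 'n::finite \<Rightarrow> real" where
  "std_partition x = (\<Prod>i\<in>UNIV. tent (x $ i))"

lemma std_partition_nonneg: "0 \<le> std_partition x"
  by (simp add: std_partition_def prod_nonneg tent_nonneg)

lemma compact_cbox_vec: "compact (cbox (- (\<chi> i. 2)) (\<chi> i. 2) :: (real ^ 'n::finite) set)"
  by (rule compact_cbox)

lemma std_partition_test: "(\<lambda>x. complex_of_real (std_partition x)) \<in> test_functions"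
proof (rule test_functionsI[OF _ compact_cbox_vec])
  have "smooth (\<lambda>x :: real ^ 'a. complex_of_real (step (1 * x $ i + 0)) - complex_of_real (step (1 * x $ i + - 1)))" for i :: 'a
    by (intro smooth_minus smooth_step)
  then have "smooth (\<lambda>x :: real ^ 'a. \<Prod>i\<in>UNIV. complex_of_real (step (1 * x $ i + 0)) - complex_of_real (step (1 * x $ i + - 1)))"
    by (intro smooth_prod)
  then show "smooth (\<lambda>x :: real ^ 'a. complex_of_real (std_partition x))"
    by (simp add: std_partition_def tent_def)
  fix x :: "real ^ 'a"
  assume "x \<notin> cbox (- (\<chi> i. 2)) (\<chi> i. 2)"
  then obtain i where "\<not> (- 2 \<le> x $ i \<and> x $ i \<le> 2)" by (auto simp: mem_box_cart)
  then have "x $ i \<le> 0 \<or> 2 \<le> x $ i" by auto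
  then show "complex_of_real (std_partition x) = 0"
    by (auto simp: std_partition_def intro: tent_0)
qed

text \<open>
  Only the translates by \<open>\<kappa>\<close> with \<open>\<kappa> $ i \<in> {\<lfloor>x $ i\<rfloor> - 1, \<lfloor>x $ i\<rfloor>}\<close> contribute, and the sum of the products over
  this box is the product of the one-dimensional sums.
\<close>

lemma std_partition_sum:
  fixes x :: "real ^ 'n::finite"
  shows "((\<lambda>\<kappa>. std_partition (x - int_vec \<kappa>)) has_sum 1) UNIV"
proof -
  define A where "A i = {\<lfloor>x $ i\<rfloor>, \<lfloor>x $ i\<rfloor> - 1}" for i
  define S where "S = {\<kappa> :: int ^ 'n. \<forall>i. \<kappa> $ i \<in> A i}"
  have bij: "bij_betw (\<lambda>h. \<chi> i. h i) (PiE UNIV A) S"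
    by (rule bij_betwI[where g = "\<lambda>\<kappa> i. \<kappa> $ i"]) (auto simp: S_def)
  have "finite (PiE UNIV A)" by (rule finite_PiE) (auto simp: A_def)
  then have fin: "finite S" using bij bij_betw_finite by blast
  have "(\<Sum>\<kappa>\<in>S. std_partition (x - int_vec \<kappa>)) = (\<Sum>h\<in>PiE UNIV A. \<Prod>i\<in>UNIV. tent (x $ i - h i))"
    by (subst sum.reindex_bij_betw[OF bij, symmetric]) (simp add: std_partition_def int_vec_def)
  also have "\<dots> = (\<Prod>i\<in>UNIV. \<Sum>k\<in>A i. tent (x $ i - k))"
    by (rule prod_sum_PiE[symmetric]) (auto simp: A_def)
  also have "\<dots> = 1"
    using tent_sum by (intro prod.neutral) (simp add: A_def)
  finally have sum: "(\<Sum>\<kappa>\<in>S. std_partition (x - int_vec \<kappa>)) = 1" .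
  have "std_partition (x - int_vec \<kappa>) = 0" if "\<kappa> \<notin> S" for \<kappa>
  proof -
    obtain i where "\<kappa> $ i \<notin> A i" using \<open>\<kappa> \<notin> S\<close> by (auto simp: S_def)
    then have "\<lfloor>x $ i\<rfloor> + 1 \<le> \<kappa> $ i \<or> \<kappa> $ i \<le> \<lfloor>x $ i\<rfloor> - 2" by (auto simp: A_def)
    then have "x $ i - \<kappa> $ i \<le> 0 \<or> 2 \<le> x $ i - \<kappa> $ i" by linarith
    then have "tent ((x - int_vec \<kappa>) $ i) = 0" by (intro tent_0) (simp add: int_vec_def)
    then show ?thesis unfolding std_partition_def by (intro prod_zero) auto
  qed
  moreover have "((\<lambda>\<kappa>. std_partition (x - int_vec \<kappa>)) has_sum 1) S"
    using has_sum_finite[OF fin, of "\<lambda>\<kappa>. std_partition (x - int_vec \<kappa>)"] unfolding sum .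
  ultimately show ?thesis
    by (intro has_sum_cong_neutral[THEN iffD1, of UNIV S]) auto
qed

lemma periodic_partition_std: "periodic_partition (\<lambda>x :: real ^ 'n::finite. complex_of_real (std_partition x))"
  unfolding periodic_partition_def
  using std_partition_test has_sum_of_real[OF std_partition_sum] by auto

section \<open>Density of the test functions\<close>

lemma mat_scaleR: "mat c *v x = c *\<^sub>R x" for x :: "real ^ 'n::finite"
  by (simp add: vec_eq_iff matrix_vector_component mat_def if_distrib if_distribR cong: if_cong)

lemma partials_scale:
  assumes "smooth f"
  shows "partials js (\<lambda>x. f (c *\<^sub>R x)) = (\<lambda>x. of_real (c ^ length js) * partials js f (c *\<^sub>R x))"
proof (induction js)
  case (Cons j js)
  have d: "partials js f differentiable (at y)" for y
    using assms by (intro smooth_differentiable smooth_partials)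
  have p: "partial j (\<lambda>x. partials js f (c *\<^sub>R x)) x = of_real c * partial j (partials js f) (c *\<^sub>R x)" for x
  proof -
    have "(\<Sum>i\<in>UNIV. of_real ((mat c :: real ^ 'a ^ 'a) $ i $ j) * g i) = of_real c * g j"
      for g :: "'a \<Rightarrow> complex"
    proof -
      have "(\<Sum>i\<in>UNIV. of_real ((mat c :: real ^ 'a ^ 'a) $ i $ j) * g i) =
          (\<Sum>i\<in>UNIV. if i = j then of_real c * g j else 0)"
        by (intro sum.cong) (auto simp: mat_def)
      then show ?thesis by simp
    qed
    then show ?thesis
      using partial_affine[OF d, where A = "mat c" and b = 0, of j x] by (simp add: mat_scaleR)
  qed
  have "(\<lambda>x. partials js f (c *\<^sub>R x)) differentiable (at x)" for x
    using differentiable_affine[where A = "mat c" and b = 0, of "partials js f" x] d by (simp add: mat_scaleR)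
  then show ?case
    unfolding partials_Cons Cons by (intro ext) (simp add: partial_cmult p)
qed simp

text \<open>
  This is how all convergence in the Schwartz space is obtained below, for the cutoffs with \<open>m = 1\<close> and for
  the approximation of periodic functions with \<open>m = 0\<close>.
\<close>

lemma sw_seminorm_mult_tendsto_0:
  assumes f: "f \<in> schwartz" and e: "\<And>n. smooth (e n)"
    and small: "\<And>js. \<exists>\<epsilon>. \<epsilon> \<longlonglongrightarrow> 0 \<and> (\<forall>n x. cmod (partials js (e n) x) \<le> \<epsilon> n * (1 + norm x) ^ m)"
  shows "(\<lambda>n. sw_seminorm k is (\<lambda>x. e n x * f x)) \<longlonglongrightarrow> 0"
proof -
  have "\<forall>js. \<exists>\<epsilon>. \<epsilon> \<longlonglongrightarrow> 0 \<and> (\<forall>n x. cmod (partials js (e n) x) \<le> \<epsilon> n * (1 + norm x) ^ m)"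
    by (rule allI) (rule small)
  from choice[OF this] obtain \<epsilon> where
    "\<forall>js. \<epsilon> js \<longlonglongrightarrow> 0 \<and> (\<forall>n x. cmod (partials js (e n) x) \<le> \<epsilon> js n * (1 + norm x) ^ m)" ..
  then have eps: "\<epsilon> js \<longlonglongrightarrow> 0" "cmod (partials js (e n) x) \<le> \<epsilon> js n * (1 + norm x) ^ m"
    for js n x by simp_all
  have ef: "(\<lambda>x. e n x * f x) \<in> schwartz" for n
    by (rule schwartz_mult[OF f e, where m = m], rule exI, rule allI, rule eps(2))
  obtain M J where J: "finite J" "\<forall>e \<epsilon> x. smooth e \<longrightarrow>
      (\<forall>js\<in>J. \<forall>x. cmod (partials js e x) \<le> \<epsilon> * (1 + norm x) ^ m) \<longrightarrow>
      (1 + norm x) ^ k * cmod (partials is (\<lambda>x. e x * f x) x) \<le> M * \<epsilon>"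
    using schwartz_mult_estimate[OF f, of m k "is"] by (elim exE conjE)
  have le: "sw_seminorm k is (\<lambda>x. e n x * f x) \<le> M * (\<Sum>js\<in>J. \<bar>\<epsilon> js n\<bar>)" for n
  proof (rule sw_seminorm_le)
    fix x
    have "\<forall>js\<in>J. \<forall>x. cmod (partials js (e n) x) \<le> (\<Sum>js\<in>J. \<bar>\<epsilon> js n\<bar>) * (1 + norm x) ^ m"
    proof (intro ballI allI)
      fix js x
      assume js: "js \<in> J"
      have "\<epsilon> js n \<le> \<bar>\<epsilon> js n\<bar>" by (rule abs_ge_self)
      also have "\<dots> \<le> (\<Sum>js\<in>J. \<bar>\<epsilon> js n\<bar>)"
        by (rule member_le_sum[OF js]) (use J(1) in auto)
      finally show "cmod (partials js (e n) x) \<le> (\<Sum>js\<in>J. \<bar>\<epsilon> js n\<bar>) * (1 + norm x) ^ m"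
        by (intro order_trans[OF eps(2) mult_right_mono]) auto
    qed
    then show "(1 + norm x) ^ k * cmod (partials is (\<lambda>x. e n x * f x) x) \<le> M * (\<Sum>js\<in>J. \<bar>\<epsilon> js n\<bar>)"
      using J(2) e by simp
  qed
  have lim: "(\<lambda>n. M * (\<Sum>js\<in>J. \<bar>\<epsilon> js n\<bar>)) \<longlonglongrightarrow> 0"
    by (intro tendsto_mult_right_zero tendsto_null_sum tendsto_rabs_zero eps(1))
  show ?thesis
    by (rule tendsto_sandwich[OF _ _ tendsto_const lim]) (simp_all add: le sw_seminorm_nonneg[OF ef])
qed

definition cutoff :: "real ^ 'n::finite \<Rightarrow> complex" where
  "cutoff x = (\<Prod>i\<in>UNIV. of_real (step (x $ i + 2)) * of_real (step (2 - x $ i)))"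

lemma cutoff_test: "cutoff \<in> test_functions"
proof (rule test_functionsI[OF _ compact_cbox_vec])
  have "smooth (\<lambda>x :: real ^ 'a. \<Prod>i\<in>UNIV. complex_of_real (step (1 * x $ i + 2)) * of_real (step ((- 1) * x $ i + 2)))"
    by (intro smooth_prod smooth_mult smooth_step)
  then show "smooth (cutoff :: real ^ 'a \<Rightarrow> complex)"
    by (simp add: cutoff_def[abs_def])
  fix x :: "real ^ 'a"
  assume "x \<notin> cbox (- (\<chi> i. 2)) (\<chi> i. 2)"
  then obtain i where "\<not> (- 2 \<le> x $ i \<and> x $ i \<le> 2)" by (auto simp: mem_box_cart)
  then have "step (x $ i + 2) = 0 \<or> step (2 - x $ i) = 0"
    using step_0[of "x $ i + 2"] step_0[of "2 - x $ i"] by linarith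
  then show "cutoff x = 0" unfolding cutoff_def by (intro prod_zero) auto
qed

lemma cutoff_eq_1:
  assumes "norm x \<le> 1" shows "cutoff x = 1"
proof -
  have "step (x $ i + 2) = 1 \<and> step (2 - x $ i) = 1" for i
  proof -
    have "\<bar>x $ i\<bar> \<le> 1" using component_le_norm_cart[of x i] assms by (rule order_trans)
    then show ?thesis by (auto intro!: step_1)
  qed
  then show ?thesis by (simp add: cutoff_def)
qed

text \<open>
  Put \<open>c = cutoff - 1\<close>. A derivative of \<open>c (R x)\<close> carries at least one factor \<open>R\<close>; the function itself
  vanishes unless \<open>R * norm x > 1\<close>, so it is \<open>O (R * norm x)\<close>. In both cases the bound is \<open>R\<close> times a
  function of linear growth.
\<close>

lemma cutoff_tendsto:
  fixes f :: "real ^ 'n::finite \<Rightarrow> complex"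
  assumes f: "f \<in> schwartz"
  defines "R \<equiv> \<lambda>n. 1 / real (Suc n)"
  shows "(\<lambda>n. sw_seminorm k is (\<lambda>x. cutoff (R n *\<^sub>R x) * f x - f x)) \<longlonglongrightarrow> 0"
proof -
  define c where "c x = cutoff x - 1" for x :: "real ^ 'n"
  have sc: "smooth c"
    unfolding c_def[abs_def] by (intro smooth_minus smooth_const test_functions_smooth cutoff_test)
  have R: "0 < R n" "R n \<le> 1" for n by (simp_all add: R_def)
  have R0: "R \<longlonglongrightarrow> 0"
    unfolding R_def using LIMSEQ_inverse_real_of_nat by (simp add: inverse_eq_divide)
  have bdd: "\<exists>M\<ge>0. \<forall>x. cmod (partials js c x) \<le> M" for js
  proof -
    have "partials js c = (\<lambda>x. partials js cutoff x - partials js (\<lambda>_. 1) x)"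
      unfolding c_def[abs_def] by (rule partials_minus[OF test_functions_smooth[OF cutoff_test] smooth_const])
    moreover have "cmod (partials js (\<lambda>_. 1) x) \<le> 1" for x :: "real ^ 'n"
    proof -
      have "partials js (\<lambda>_ :: real ^ 'n. 1) \<in> {\<lambda>_. 1, \<lambda>_. 0}"
        by (induction js) (auto simp: partials_Cons)
      then show ?thesis by auto
    qed
    moreover have "cmod (partials js cutoff x) \<le> sw_seminorm 0 js cutoff" for x :: "real ^ 'n"
      using sw_seminorm_upper[OF test_functions_schwartz[OF cutoff_test], of x 0 js] by simp
    ultimately have "cmod (partials js c x) \<le> sw_seminorm 0 js (cutoff :: real ^ 'n \<Rightarrow> complex) + 1" for x
      by (simp add: order_trans[OF norm_triangle_ineq4 add_mono])
    then show ?thesis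
      using sw_seminorm_nonneg[OF test_functions_schwartz[OF cutoff_test], of 0 js]
      by (intro exI[of _ "sw_seminorm 0 js (cutoff :: real ^ 'n \<Rightarrow> complex) + 1"]) auto
  qed
  have "(\<lambda>n. sw_seminorm k is (\<lambda>x. c (R n *\<^sub>R x) * f x)) \<longlonglongrightarrow> 0"
  proof (rule sw_seminorm_mult_tendsto_0[OF f, where m = 1])
    show "smooth (\<lambda>x. c (R n *\<^sub>R x))" for n
      using smooth_linear[OF sc, of "mat (R n)"] by (simp add: mat_scaleR)
    fix js
    obtain M where M: "M \<ge> 0" "\<And>x. cmod (partials js c x) \<le> M" using bdd by blast
    have "cmod (partials js (\<lambda>x. c (R n *\<^sub>R x)) x) \<le> (M * R n) * (1 + norm x) ^ 1" for n x
    proof (cases js)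
      case Nil
      show ?thesis
      proof (cases "norm (R n *\<^sub>R x) \<le> 1")
        case True
        then show ?thesis using Nil M(1) R[of n] by (simp add: c_def cutoff_eq_1)
      next
        case False
        then have "1 \<le> R n * (1 + norm x)" using R[of n] by (simp add: distrib_left)
        then have "M * 1 \<le> M * (R n * (1 + norm x))" using M(1) by (rule mult_left_mono)
        then show ?thesis using M(2)[of "R n *\<^sub>R x"] Nil by (simp add: mult.assoc)
      qed
    next
      case (Cons j js')
      have "R n ^ length js * cmod (partials js c (R n *\<^sub>R x)) \<le> R n * M"
      proof (intro mult_mono M)
        show "R n ^ length js \<le> R n"
          using R[of n] power_decreasing[of 1 "length js" "R n"] Cons by simp
      qed (use R[of n] in auto)
      also have "\<dots> \<le> (M * R n) * (1 + norm x)"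
        using M(1) R[of n] mult_left_mono[of 1 "1 + norm x" "M * R n"] by (simp add: mult.commute)
      finally show ?thesis
        using R[of n] by (simp add: partials_scale[OF sc] norm_mult norm_power)
    qed
    moreover have "(\<lambda>n. M * R n) \<longlonglongrightarrow> 0" using tendsto_mult_right_zero[OF R0] .
    ultimately show "\<exists>\<epsilon>. \<epsilon> \<longlonglongrightarrow> 0 \<and> (\<forall>n x. cmod (partials js (\<lambda>x. c (R n *\<^sub>R x)) x) \<le> \<epsilon> n * (1 + norm x) ^ 1)"
      by blast
  qed
  then show ?thesis by (simp add: c_def left_diff_distrib)
qed

text \<open>
  The test functions \<open>cutoff (x / n) * f x\<close> converge to \<open>f\<close> in the Schwartz space.
\<close>

lemma tempered_eqI:
  assumes U: "U \<in> tempered" and V: "V \<in> tempered" and eq: "\<And>f. f \<in> test_functions \<Longrightarrow> U f = V f"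
  shows "U = V"
proof
  fix f
  show "U f = V f"
  proof (cases "f \<in> schwartz")
    case True
    define g where "g n = (\<lambda>x. cutoff ((1 / real (Suc n)) *\<^sub>R x) * f x)" for n
    have g: "g n \<in> test_functions" for n
    proof -
      have "mat (real (Suc n)) ** mat (1 / real (Suc n)) = (mat 1 :: real ^ 'a ^ 'a)"
        unfolding matrix_eq by (simp add: matrix_vector_mul_assoc[symmetric] mat_scaleR)
      from test_functions_linear[OF cutoff_test this]
      have "(\<lambda>x :: real ^ 'a. cutoff ((1 / real (Suc n)) *\<^sub>R x)) \<in> test_functions"
        by (simp only: mat_scaleR)
      from test_functions_mult[OF schwartz_smooth[OF True] this] show ?thesis
        by (simp add: g_def mult.commute)
    qed
    have lim: "(\<lambda>n. sw_seminorm k is (\<lambda>x. g n x - f x)) \<longlonglongrightarrow> 0" for k "is"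
      unfolding g_def by (rule cutoff_tendsto[OF True])
    have "(\<lambda>n. U (g n)) \<longlonglongrightarrow> U f" "(\<lambda>n. V (g n)) \<longlonglongrightarrow> V f"
      by (rule tempered_tendsto[OF U test_functions_schwartz[OF g] True lim]
          tempered_tendsto[OF V test_functions_schwartz[OF g] True lim])+
    then show ?thesis using LIMSEQ_unique by (simp add: eq[OF g])
  next
    case False
    then show ?thesis using U V by (simp add: tempered_def)
  qed
qed

lemma tempered_ext_eq:
  assumes "U \<in> tempered" "\<And>f. f \<in> test_functions \<Longrightarrow> U f = u f"
  shows "tempered_ext u = U"
  unfolding tempered_ext_def using assms by (intro the_equality) (auto intro!: tempered_eqI)

section \<open>Lattices and periodization\<close>

lemma int_vec_add: "int_vec (a + b) = int_vec a + int_vec b"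
  and int_vec_uminus: "int_vec (- a) = - int_vec a"
  and int_vec_zero [simp]: "int_vec 0 = 0"
  by (simp_all add: int_vec_def vec_eq_iff)

lemma finite_int_box: "finite {\<kappa> :: int ^ 'n::finite. \<forall>i. \<bar>\<kappa> $ i\<bar> \<le> m}"
proof -
  have "{\<kappa> :: int ^ 'n. \<forall>i. \<bar>\<kappa> $ i\<bar> \<le> m} \<subseteq> (\<lambda>h. \<chi> i. h i) ` PiE UNIV (\<lambda>_. {- m..m})"
  proof
    fix \<kappa> :: "int ^ 'n"
    assume "\<kappa> \<in> {\<kappa>. \<forall>i. \<bar>\<kappa> $ i\<bar> \<le> m}"
    then have "(\<lambda>i. \<kappa> $ i) \<in> PiE UNIV (\<lambda>_. {- m..m})" by (auto simp: abs_le_iff minus_le_iff)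
    then show "\<kappa> \<in> (\<lambda>h. \<chi> i. h i) ` PiE UNIV (\<lambda>_. {- m..m})"
      by (intro image_eqI[of _ _ "\<lambda>i. \<kappa> $ i"]) auto
  qed
  moreover have "finite (PiE (UNIV :: 'n set) (\<lambda>_. {- m..m}))" by (rule finite_PiE) auto
  ultimately show ?thesis by (meson finite_imageI finite_subset)
qed

lemma cis_2pi_int: "cis (2 * pi * of_int k) = 1"
  by (metis cis_multiple_2pi Ints_of_int)

lemma integrable_compact_support:
  fixes f :: "'a::euclidean_space \<Rightarrow> complex"
  assumes f: "f \<in> borel_measurable borel" and K: "compact K" and 0: "\<And>x. x \<notin> K \<Longrightarrow> f x = 0"
    and M: "\<And>x. cmod (f x) \<le> M"
  shows "integrable lborel f"
proof (rule Bochner_Integration.integrable_bound)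
  show "integrable lborel (\<lambda>x. M * indicator K x :: real)"
    using emeasure_compact_finite[OF K] K
    by (intro integrable_mult_right integrable_real_indicator) (auto simp: borel_compact)
  show "AE x in lborel. norm (f x) \<le> norm (M * indicator K x :: real)"
  proof (intro AE_I2)
    fix x
    show "norm (f x) \<le> norm (M * indicator K x :: real)"
      using 0[of x] order_trans[OF M abs_ge_self, of x] by (cases "x \<in> K") auto
  qed
qed (use f in simp)

text \<open>
  The lattice translates of such a function form a locally finite family, so the lattice sums below are
  finite near each point. The functions are measurable rather than continuous in order
  to include the indicator of a unit cube.
\<close>

definition bounded_compact :: "('a::euclidean_space \<Rightarrow> complex) \<Rightarrow> bool" where
  "bounded_compact f \<longleftrightarrow> f \<in> borel_measurable borel \<and> (\<exists>M. \<forall>x. cmod (f x) \<le> M) \<and>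
     (\<exists>K. compact K \<and> (\<forall>x. x \<notin> K \<longrightarrow> f x = 0))"

lemma bounded_compact_integrable: "bounded_compact f \<Longrightarrow> integrable lborel f"
  unfolding bounded_compact_def using integrable_compact_support by blast

lemma test_bounded_compact: "f \<in> test_functions \<Longrightarrow> bounded_compact f"
  using test_functionsD[of f] schwartz_bounded[OF test_functions_schwartz]
  by (auto simp: bounded_compact_def intro: smooth_measurable)

lemma bounded_compact_mult:
  assumes f: "bounded_compact f" and g: "g \<in> borel_measurable borel" "\<And>x. cmod (g x) \<le> N"
  shows "bounded_compact (\<lambda>x. g x * f x)"
proof -
  obtain M K where M: "\<And>x. cmod (f x) \<le> M" and K: "compact K" "\<And>x. x \<notin> K \<Longrightarrow> f x = 0"
    using f by (auto simp: bounded_compact_def)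
  have "cmod (g x * f x) \<le> N * M" for x
    unfolding norm_mult using g(2) M by (intro mult_mono) (auto intro: order_trans[OF norm_ge_zero])
  moreover have "(\<lambda>x. g x * f x) \<in> borel_measurable borel"
    using f g by (auto simp: bounded_compact_def)
  moreover have "\<forall>x. x \<notin> K \<longrightarrow> g x * f x = 0" using K(2) by simp
  ultimately show ?thesis unfolding bounded_compact_def using K(1) by blast
qed

lemma bounded_compact_translation:
  assumes "bounded_compact f" shows "bounded_compact (\<lambda>x. f (b + x))"
proof -
  obtain M K where M: "\<And>x. cmod (f x) \<le> M" and K: "compact K" "\<And>x. x \<notin> K \<Longrightarrow> f x = 0"
    and [measurable]: "f \<in> borel_measurable borel"
    using assms by (auto simp: bounded_compact_def)
  have "compact ((\<lambda>x. x - b) ` K)" by (intro compact_continuous_image K continuous_intros)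
  moreover have "\<forall>x. x \<notin> (\<lambda>x. x - b) ` K \<longrightarrow> f (b + x) = 0"
    using K(2) by (auto simp: image_iff) (metis add_diff_cancel_left')
  moreover have "(\<lambda>x. f (b + x)) \<in> borel_measurable borel" by measurable
  ultimately show ?thesis unfolding bounded_compact_def using M by blast
qed

locale lattice =
  fixes L :: "real ^ 'n::finite ^ 'n"
  assumes invertible_L: "invertible L"
begin

definition lat :: "int ^ 'n \<Rightarrow> real ^ 'n" where "lat \<kappa> = L *v int_vec \<kappa>"

definition dual :: "int ^ 'n \<Rightarrow> real ^ 'n" where "dual \<kappa> = inv_transpose L *v int_vec \<kappa>"

definition chr :: "int ^ 'n \<Rightarrow> real ^ 'n \<Rightarrow> complex" where
  "chr \<kappa> x = cis (2 * pi * (dual \<kappa> \<bullet> x))"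

definition per :: "(real ^ 'n \<Rightarrow> complex) \<Rightarrow> real ^ 'n \<Rightarrow> complex" where
  "per f x = (\<Sum>\<^sub>\<infinity>\<kappa>. f (x + lat \<kappa>))"

lemma inv_L: "matrix_inv L ** L = mat 1" "L ** matrix_inv L = mat 1"
proof -
  have "\<exists>A. L ** A = mat 1 \<and> A ** L = mat 1" using invertible_L by (simp add: invertible_def)
  from someI_ex[OF this] show "matrix_inv L ** L = mat 1" "L ** matrix_inv L = mat 1"
    by (simp_all add: matrix_inv_def)
qed

lemma inv_L_apply [simp]: "matrix_inv L *v (L *v x) = x" "L *v (matrix_inv L *v x) = x"
  by (simp_all add: matrix_vector_mul_assoc inv_L)

lemma det_L: "det L \<noteq> 0" using invertible_L invertible_det_nz by blast

lemma inv_lat [simp]: "matrix_inv L *v lat \<kappa> = int_vec \<kappa>" by (simp add: lat_def)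

lemma lat_add: "lat (a + b) = lat a + lat b"
  and lat_uminus: "lat (- a) = - lat a"
  and lat_zero [simp]: "lat 0 = 0"
  by (simp_all add: lat_def int_vec_add int_vec_uminus matrix_vector_right_distrib
      linear_neg[OF matrix_vector_mul_linear])

lemma dual_add: "dual (a + b) = dual a + dual b"
  and dual_uminus: "dual (- a) = - dual a"
  and dual_zero [simp]: "dual 0 = 0"
  by (simp_all add: dual_def int_vec_add int_vec_uminus matrix_vector_right_distrib
      linear_neg[OF matrix_vector_mul_linear])

lemma dual_inner: "dual \<kappa> \<bullet> x = int_vec \<kappa> \<bullet> (matrix_inv L *v x)"
  by (simp add: dual_def inv_transpose_def dot_lmul_matrix[symmetric])

lemma dual_inner_lat: "dual \<kappa> \<bullet> lat \<mu> = of_int (\<Sum>i\<in>UNIV. \<kappa> $ i * \<mu> $ i)"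
  unfolding dual_inner inv_lat by (simp add: inner_vec_def int_vec_def)

lemma chr_add: "chr \<kappa> (x + y) = chr \<kappa> x * chr \<kappa> y"
  by (simp add: chr_def cis_mult inner_add_right distrib_left)

lemma chr_lat [simp]: "chr \<kappa> (lat \<mu>) = 1"
  unfolding chr_def dual_inner_lat by (rule cis_2pi_int)

lemma chr_periodic: "chr \<kappa> (x + lat \<mu>) = chr \<kappa> x"
  by (simp add: chr_add)

lemma chr_mult: "chr (a + b) x = chr a x * chr b x"
  by (simp add: chr_def cis_mult dual_add inner_add_left distrib_left)

lemma chr_zero [simp]: "chr 0 x = 1" by (simp add: chr_def)

lemma cmod_chr [simp]: "cmod (chr \<kappa> x) = 1" by (simp add: chr_def)

lemma smooth_chr: "smooth (chr \<kappa>)"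
  unfolding chr_def[abs_def] by (rule smooth_cis)

lemma chr_measurable [measurable]: "chr \<kappa> \<in> borel_measurable borel"
  by (rule smooth_measurable[OF smooth_chr])

lemma finite_lat:
  assumes "bounded B" shows "finite {\<kappa>. lat \<kappa> \<in> B}"
proof -
  obtain R where R: "\<And>x. x \<in> B \<Longrightarrow> norm x \<le> R" using assms by (auto simp: bounded_iff)
  let ?N = "onorm ((*v) (matrix_inv L))"
  have "{\<kappa>. lat \<kappa> \<in> B} \<subseteq> {\<kappa>. \<forall>i. \<bar>\<kappa> $ i\<bar> \<le> \<lceil>?N * R\<rceil>}"
  proof (intro subsetI CollectI allI)
    fix \<kappa> i
    assume "\<kappa> \<in> {\<kappa>. lat \<kappa> \<in> B}"
    then have "norm (lat \<kappa>) \<le> R" using R by blast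
    have "\<bar>real_of_int (\<kappa> $ i)\<bar> = \<bar>int_vec \<kappa> $ i\<bar>" by (simp add: int_vec_def)
    also have "\<dots> \<le> norm (int_vec \<kappa>)" by (rule component_le_norm_cart)
    also have "\<dots> = norm (matrix_inv L *v lat \<kappa>)" by simp
    also have "\<dots> \<le> ?N * norm (lat \<kappa>)" by (rule onorm) (rule matrix_vector_mul_bounded_linear)
    also have "\<dots> \<le> ?N * R"
      using \<open>norm (lat \<kappa>) \<le> R\<close> by (intro mult_left_mono onorm_pos_le matrix_vector_mul_bounded_linear)
    finally show "\<bar>\<kappa> $ i\<bar> \<le> \<lceil>?N * R\<rceil>" by (simp add: le_ceiling_iff)
  qed
  then show ?thesis using finite_int_box finite_subset by blast
qed

lemma finite_meeting:
  assumes "bounded B" "compact K"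
  shows "finite {\<kappa>. \<exists>x\<in>B. x + lat \<kappa> \<in> K}"
proof -
  have "bounded {y - x | x y. x \<in> B \<and> y \<in> K}"
  proof -
    obtain R S where "\<forall>x\<in>B. norm x \<le> R" "\<forall>y\<in>K. norm y \<le> S"
      using assms compact_imp_bounded[of K] by (auto simp: bounded_iff)
    then have "norm (y - x) \<le> S + R" if "x \<in> B" "y \<in> K" for x y
      using that by (intro order_trans[OF norm_triangle_ineq4 add_mono]) auto
    then show ?thesis unfolding bounded_iff by blast
  qed
  moreover have "{\<kappa>. \<exists>x\<in>B. x + lat \<kappa> \<in> K} \<subseteq> {\<kappa>. lat \<kappa> \<in> {y - x | x y. x \<in> B \<and> y \<in> K}}"
    by (auto intro: exI[of _ "_ + _"]) (metis add_diff_cancel_left')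
  ultimately show ?thesis using finite_lat finite_subset by blast
qed

lemma per_eq_sum:
  assumes "finite F" "\<And>\<kappa>. \<kappa> \<notin> F \<Longrightarrow> f (x + lat \<kappa>) = 0"
  shows "per f x = (\<Sum>\<kappa>\<in>F. f (x + lat \<kappa>))"
proof -
  have "per f x = (\<Sum>\<^sub>\<infinity>\<kappa>\<in>F. f (x + lat \<kappa>))"
    unfolding per_def using assms(2) by (intro infsum_cong_neutral) auto
  then show ?thesis using assms(1) by simp
qed

lemma per_periodic: "per f (x + lat \<mu>) = per f x"
proof -
  have "bij (\<lambda>\<kappa>. \<mu> + \<kappa>)" by (rule bijI') (auto intro: exI[of _ "_ - \<mu>"])
  from infsum_reindex_bij_betw[OF this, of "\<lambda>\<kappa>. f (x + lat \<kappa>)"] show ?thesis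
    by (simp add: per_def lat_add add.assoc)
qed

lemma per_uminus: "(\<Sum>\<^sub>\<infinity>\<kappa>. f (x - lat \<kappa>)) = per f x"
proof -
  have "bij (\<lambda>\<kappa> :: int ^ 'n. - \<kappa>)" by (rule bij_uminus)
  from infsum_reindex_bij_betw[OF this, of "\<lambda>\<kappa>. f (x + lat \<kappa>)"] show ?thesis
    by (simp add: per_def lat_uminus)
qed

lemma per_mult_periodic:
  assumes "\<And>x \<kappa>. g (x + lat \<kappa>) = g x"
  shows "per (\<lambda>x. g x * f x) x = g x * per f x"
  by (simp add: per_def assms infsum_cmult_right')

text \<open>
  On a ball around \<open>x\<close> the periodization is a finite sum over a set of lattice points that serves for \<open>f\<close>
  and for all its partial derivatives.
\<close>

lemma per_derivative:
  assumes f: "f \<in> test_functions"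
  shows "(per f has_derivative (\<lambda>h. \<Sum>i\<in>UNIV. of_real (h $ i) * per (partial i f) x)) (at x)"
proof -
  obtain K where K: "compact K" "smooth f" "\<And>x. x \<notin> K \<Longrightarrow> f x = 0"
    using test_functionsD[OF f] by auto
  have pK: "partial i f x = 0" if "x \<notin> K" for i x
    using test_on_partial[OF K(1), of f i] K that by (auto simp: test_on_def)
  define F where "F = {\<kappa>. \<exists>y\<in>ball x 1. y + lat \<kappa> \<in> K}"
  have F: "finite F" unfolding F_def by (rule finite_meeting[OF bounded_ball K(1)])
  have sum: "per g y = (\<Sum>\<kappa>\<in>F. g (y + lat \<kappa>))" if "y \<in> ball x 1" "\<And>x. x \<notin> K \<Longrightarrow> g x = 0" for g y
    using that F by (intro per_eq_sum) (auto simp: F_def)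
  have "((\<lambda>y. \<Sum>\<kappa>\<in>F. f (y + lat \<kappa>)) has_derivative
      (\<lambda>h. \<Sum>\<kappa>\<in>F. \<Sum>i\<in>UNIV. of_real (h $ i) * partial i f (x + lat \<kappa>))) (at x)"
  proof (intro has_derivative_sum)
    fix \<kappa>
    have "((\<lambda>y. y + lat \<kappa>) has_derivative (\<lambda>h. h)) (at x)" by (auto intro!: derivative_eq_intros)
    from has_derivative_compose[OF this has_derivative_partial[OF smooth_differentiable[OF K(2)]]]
    show "((\<lambda>y. f (y + lat \<kappa>)) has_derivative
        (\<lambda>h. \<Sum>i\<in>UNIV. of_real (h $ i) * partial i f (x + lat \<kappa>))) (at x)" .
  qed
  then have "(per f has_derivative
      (\<lambda>h. \<Sum>\<kappa>\<in>F. \<Sum>i\<in>UNIV. of_real (h $ i) * partial i f (x + lat \<kappa>))) (at x)"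
    by (rule has_derivative_transform_within_open[of _ _ _ _ "ball x 1"]) (auto simp: sum K(3))
  also have "(\<lambda>h. \<Sum>\<kappa>\<in>F. \<Sum>i\<in>UNIV. of_real (h $ i) * partial i f (x + lat \<kappa>)) =
      (\<lambda>h. \<Sum>i\<in>UNIV. of_real (h $ i) * per (partial i f) x)"
    by (subst sum.swap) (simp add: sum[OF _ pK] sum_distrib_left)
  finally show ?thesis .
qed

lemma partial_per: "f \<in> test_functions \<Longrightarrow> partial i (per f) = per (partial i f)"
  by (rule ext, subst partial_eq[OF per_derivative])
     (simp_all add: axis_def if_distrib if_distribR cong: if_cong)

lemma smooth_per:
  assumes "f \<in> test_functions" shows "smooth (per f)"
proof (rule smooth_coinduct[where C = "per ` test_functions"])
  fix g i x
  assume "g \<in> per ` test_functions"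
  then obtain f where f: "f \<in> test_functions" "g = per f" by blast
  show "g differentiable (at x)" unfolding differentiable_def f(2) using per_derivative[OF f(1)] by blast
  show "partial i g \<in> sums_of (per ` test_functions)"
    using f test_functions_partial by (intro sums_of.base) (auto simp: partial_per)
qed (use assms in \<open>auto intro: sums_of.base\<close>)

lemma partials_per:
  "f \<in> test_functions \<Longrightarrow> partials js (per f) = per (partials js f) \<and> partials js f \<in> test_functions"
  by (induction js) (auto simp: partials_Cons partial_per test_functions_partial)

text \<open>
  Unfolding: in a sum or an integral against a periodization the lattice sum can be moved to the other
  factor, since both sides are the same finite sum up to translations by lattice points.
\<close>

lemma unfold_sum:
  assumes Ka: "compact Ka" "\<And>x. x \<notin> Ka \<Longrightarrow> a x = 0"
    and Kb: "compact Kb" "\<And>x. x \<notin> Kb \<Longrightarrow> b x = 0"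
  defines "F \<equiv> {\<kappa>. \<exists>x\<in>Ka. x + lat \<kappa> \<in> Kb}"
  shows "finite F" and "a x * per b x = (\<Sum>\<kappa>\<in>F. a x * b (x + lat \<kappa>))"
    and "per a x * b x = (\<Sum>\<kappa>\<in>F. a (x - lat \<kappa>) * b x)"
proof -
  show F: "finite F" unfolding F_def by (rule finite_meeting[OF compact_imp_bounded[OF Ka(1)] Kb(1)])
  show "a x * per b x = (\<Sum>\<kappa>\<in>F. a x * b (x + lat \<kappa>))"
  proof (cases "x \<in> Ka")
    case True
    then have "per b x = (\<Sum>\<kappa>\<in>F. b (x + lat \<kappa>))"
      using Kb(2) by (intro per_eq_sum F) (auto simp: F_def)
    then show ?thesis by (simp add: sum_distrib_left)
  qed (simp add: Ka)
  show "per a x * b x = (\<Sum>\<kappa>\<in>F. a (x - lat \<kappa>) * b x)"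
  proof (cases "x \<in> Kb")
    case True
    have "per a x = (\<Sum>\<kappa>\<in>uminus ` F. a (x + lat \<kappa>))"
    proof (rule per_eq_sum)
      fix \<kappa>
      assume "\<kappa> \<notin> uminus ` F"
      then have "- \<kappa> \<notin> F" by (metis image_eqI minus_minus)
      then have "x + lat \<kappa> \<notin> Ka" using True by (force simp: F_def lat_uminus)
      then show "a (x + lat \<kappa>) = 0" by (rule Ka)
    qed (use F in simp)
    also have "\<dots> = (\<Sum>\<kappa>\<in>F. a (x - lat \<kappa>))"
      by (subst sum.reindex) (auto simp: lat_uminus inj_on_def)
    finally show ?thesis by (simp add: sum_distrib_right)
  qed (simp add: Kb)
qed

lemma integral_unfold:
  assumes a: "bounded_compact a" and b: "bounded_compact b"
  shows "(\<integral>x. a x * per b x \<partial>lborel) = (\<integral>x. per a x * b x \<partial>lborel)"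
proof -
  obtain Ma Ka where Ma: "\<And>x. cmod (a x) \<le> Ma" and Ka: "compact Ka" "\<And>x. x \<notin> Ka \<Longrightarrow> a x = 0"
    and [measurable]: "a \<in> borel_measurable borel"
    using a by (auto simp: bounded_compact_def)
  obtain Mb Kb where Mb: "\<And>x. cmod (b x) \<le> Mb" and Kb: "compact Kb" "\<And>x. x \<notin> Kb \<Longrightarrow> b x = 0"
    and [measurable]: "b \<in> borel_measurable borel"
    using b by (auto simp: bounded_compact_def)
  define F where "F = {\<kappa>. \<exists>x\<in>Ka. x + lat \<kappa> \<in> Kb}"
  have 1: "a x * per b x = (\<Sum>\<kappa>\<in>F. a x * b (x + lat \<kappa>))" for x
    unfolding F_def by (rule unfold_sum(2)[OF Ka Kb])
  have 2: "per a x * b x = (\<Sum>\<kappa>\<in>F. a (x - lat \<kappa>) * b x)" for x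
    unfolding F_def by (rule unfold_sum(3)[OF Ka Kb])
  have i1: "integrable lborel (\<lambda>x. a x * b (x + lat \<kappa>))" for \<kappa>
  proof -
    have "bounded_compact (\<lambda>x. b (x + lat \<kappa>) * a x)"
      by (rule bounded_compact_mult[OF a _ Mb]) measurable
    from bounded_compact_integrable[OF this] show ?thesis by (simp add: mult.commute)
  qed
  have i2: "integrable lborel (\<lambda>x. a (x - lat \<kappa>) * b x)" for \<kappa>
    by (rule bounded_compact_integrable, rule bounded_compact_mult[OF b _ Ma]) measurable
  have "(\<integral>x. a x * b (x + lat \<kappa>) \<partial>lborel) = (\<integral>x. a (x - lat \<kappa>) * b x \<partial>lborel)" for \<kappa>
    using integral_lborel_shift[of "\<lambda>x. a (x - lat \<kappa>) * b x" "lat \<kappa>"] by (simp add: add.commute)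
  then show ?thesis
    unfolding 1 2 by (simp add: Bochner_Integration.integral_sum i1 i2)
qed

text \<open>
  This is the invariant integral of a periodic function over a fundamental region, written with a
  partition of unity in place of the region.
\<close>

lemma integral_partition_indep:
  assumes \<phi>: "bounded_compact \<phi>" "\<And>x. per \<phi> x = 1" and \<psi>: "bounded_compact \<psi>" "\<And>x. per \<psi> x = 1"
    and f: "f \<in> borel_measurable borel" "\<And>x. cmod (f x) \<le> M" "\<And>x \<kappa>. f (x + lat \<kappa>) = f x"
  shows "(\<integral>x. f x * \<phi> x \<partial>lborel) = (\<integral>x. f x * \<psi> x \<partial>lborel)"
  using integral_unfold[OF bounded_compact_mult[OF \<phi>(1) f(1,2)] \<psi>(1)]
  by (simp add: \<phi> \<psi> per_mult_periodic[of f, OF f(3)])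

text \<open>
  A translation of the partition by \<open>t\<close> does not change the integral and multiplies it by \<open>chr \<kappa> t\<close>; choose
  \<open>t\<close> with \<open>chr \<kappa> t = - 1\<close>.
\<close>

lemma integral_chr_partition:
  assumes \<phi>: "bounded_compact \<phi>" "\<And>x. per \<phi> x = 1" and \<kappa>: "\<kappa> \<noteq> 0"
  shows "(\<integral>x. chr \<kappa> x * \<phi> x \<partial>lborel) = 0"
proof -
  obtain i where i: "\<kappa> $ i \<noteq> 0" using \<kappa> by (auto simp: vec_eq_iff)
  define t where "t = L *v (axis i (1 / (2 * real_of_int (\<kappa> $ i))))"
  have d: "dual \<kappa> \<bullet> t = 1 / 2"
    using i by (simp add: dual_inner t_def inner_axis int_vec_def)
  have t: "chr \<kappa> t = - 1" unfolding chr_def d by simp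
  have [measurable]: "\<phi> \<in> borel_measurable borel" using \<phi> by (simp add: bounded_compact_def)
  have "(\<integral>x. chr \<kappa> x * \<phi> x \<partial>lborel) = (\<integral>x. chr \<kappa> x * \<phi> (- t + x) \<partial>lborel)"
  proof (rule integral_partition_indep[where M = 1])
    show "bounded_compact (\<lambda>x. \<phi> (- t + x))" by (rule bounded_compact_translation[OF \<phi>(1)])
    show "per (\<lambda>x. \<phi> (- t + x)) x = 1" for x
      using \<phi>(2)[of "- t + x"] by (simp add: per_def algebra_simps)
  qed (auto simp: \<phi> chr_periodic)
  also have "\<dots> = (\<integral>x. chr \<kappa> (t + x) * \<phi> x \<partial>lborel)"
    using integral_lborel_shift[of "\<lambda>x. chr \<kappa> x * \<phi> (- t + x)" t] by simp
  also have "\<dots> = - (\<integral>x. chr \<kappa> x * \<phi> x \<partial>lborel)"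
    by (simp add: chr_add t)
  finally show ?thesis by simp
qed

end

interpretation std: lattice "mat 1 :: real ^ 'n::finite ^ 'n"
  by unfold_locales (auto simp: invertible_def intro: exI[of _ "mat 1"])

text \<open>
  The indicator of the half-open unit cube is also a (discontinuous) partition for the integer lattice, so
  every partition has the same integral as this indicator.
\<close>

lemma integral_periodic_partition:
  fixes \<phi> :: "real ^ 'n::finite \<Rightarrow> complex"
  assumes "periodic_partition \<phi>"
  shows "(\<integral>x. \<phi> x \<partial>lborel) = 1"
proof -
  have lat: "std.lat \<kappa> = int_vec \<kappa>" for \<kappa> :: "int ^ 'n" by (simp add: std.lat_def)
  define q where "q x = (\<Prod>i\<in>UNIV. indicator {0..<1} (x $ i) :: complex)" for x :: "real ^ 'n"
  have \<phi>: "bounded_compact \<phi>" "std.per \<phi> x = 1" for x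
  proof -
    show "bounded_compact \<phi>"
      using assms by (auto simp: periodic_partition_def intro: test_bounded_compact)
    have "(\<Sum>\<^sub>\<infinity>\<kappa>. \<phi> (x - int_vec \<kappa>)) = 1"
      using assms by (intro infsumI) (simp add: periodic_partition_def)
    then show "std.per \<phi> x = 1" using std.per_uminus[of \<phi> x] by (simp add: lat)
  qed
  have q_bc: "bounded_compact q"
    unfolding bounded_compact_def
  proof (intro conjI exI allI impI)
    have "(\<lambda>x. indicator {0..<1} (x $ i) :: complex) \<in> borel_measurable (borel :: (real ^ 'n) measure)" for i
      by measurable
    then show "q \<in> borel_measurable borel" unfolding q_def[abs_def] by measurable
    show "cmod (q x) \<le> 1" for x
      unfolding q_def prod_norm[symmetric] by (rule prod_le_1) (auto simp: indicator_def)
    show "compact (cbox 0 (\<chi> i. 1) :: (real ^ 'n) set)" by (rule compact_cbox)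
    fix x :: "real ^ 'n"
    assume "x \<notin> cbox 0 (\<chi> i. 1)"
    then obtain i where "\<not> (0 \<le> x $ i \<and> x $ i \<le> 1)" by (auto simp: mem_box_cart)
    then have "indicator {0..<1} (x $ i) = (0 :: complex)" by auto
    then show "q x = 0" unfolding q_def by (subst prod_zero_iff) (simp, blast)
  qed
  have q_per: "std.per q x = 1" for x
  proof -
    define \<mu> where "\<mu> = (\<chi> i. - \<lfloor>x $ i\<rfloor>)"
    have q: "q (x + std.lat \<kappa>) = (if \<kappa> = \<mu> then 1 else 0)" for \<kappa>
    proof (cases "\<kappa> = \<mu>")
      case True
      have "(x + int_vec \<mu>) $ i \<in> {0..<1}" for i
        by (simp add: \<mu>_def int_vec_def) linarith
      then show ?thesis using True by (simp add: q_def lat)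
    next
      case False
      then obtain i where i: "\<kappa> $ i \<noteq> - \<lfloor>x $ i\<rfloor>" by (auto simp: vec_eq_iff \<mu>_def)
      have "(x + int_vec \<kappa>) $ i \<notin> {0..<1}"
      proof
        assume "(x + int_vec \<kappa>) $ i \<in> {0..<1}"
        then have "0 \<le> x $ i + \<kappa> $ i" "x $ i + \<kappa> $ i < 1" by (auto simp: int_vec_def)
        then have "\<lfloor>x $ i\<rfloor> = - \<kappa> $ i" by (intro floor_unique) auto
        with i show False by simp
      qed
      then have z: "indicator {0..<1} ((x + int_vec \<kappa>) $ i) = (0 :: complex)"
        by (rule indicator_simps(2))
      have "q (x + int_vec \<kappa>) = 0"
        unfolding q_def by (rule prod_zero) (simp, rule bexI[of _ i], rule z, simp)
      then show ?thesis using False by (simp add: lat)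
    qed
    then have "std.per q x = (\<Sum>\<kappa>\<in>{\<mu>}. q (x + std.lat \<kappa>))"
      by (intro std.per_eq_sum) auto
    then show ?thesis using q by simp
  qed
  have "(\<integral>x. 1 * \<phi> x \<partial>lborel) = (\<integral>x. 1 * q x \<partial>lborel)"
    by (rule std.integral_partition_indep[where M = 1]) (auto simp: \<phi> q_bc q_per)
  also have "\<dots> = (\<integral>x. (\<Prod>i\<in>UNIV. indicator {0..<1} (x $ i) :: complex) \<partial>(lborel :: (real ^ 'n) measure))"
    by (simp add: q_def)
  also have "\<dots> = (\<Prod>i\<in>(UNIV :: 'n set). \<integral>t. indicator {0..<1} (t :: real) \<partial>lborel)"
  proof (rule integral_prod_coords)
    have "indicator {0..<1} \<in> borel_measurable (borel :: real measure)" by measurable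
    then show "integrable lborel (\<lambda>t :: real. indicator {0..<1} t :: complex)"
      by (rule integrable_compact_support[where K = "{0..1}" and M = 1]) (auto split: split_indicator)
  qed
  also have "(\<integral>t. indicator {0..<1} (t :: real) \<partial>lborel) = (1 :: complex)"
  proof -
    have "(indicator {0..<1} :: real \<Rightarrow> complex) = (\<lambda>t. complex_of_real (indicator {0..<1} t))"
      by (auto simp: indicator_def fun_eq_iff)
    then show ?thesis by simp
  qed
  finally show ?thesis by simp
qed

context lattice
begin

lemma
  assumes "periodic_partition \<phi>"
  shows lattice_partition_test: "(\<lambda>x. \<phi> (matrix_inv L *v x)) \<in> test_functions"
    and per_lattice_partition: "per (\<lambda>x. \<phi> (matrix_inv L *v x)) x = 1"
    and integral_lattice_partition: "(\<integral>x. \<phi> (matrix_inv L *v x) \<partial>lborel) = of_real \<bar>det L\<bar>"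
proof -
  have \<phi>: "\<phi> \<in> test_functions" using assms by (simp add: periodic_partition_def)
  show t: "(\<lambda>x. \<phi> (matrix_inv L *v x)) \<in> test_functions"
    by (rule test_functions_linear[OF \<phi> inv_L(2)])
  have "(\<Sum>\<^sub>\<infinity>\<kappa>. \<phi> (matrix_inv L *v x - int_vec \<kappa>)) = 1"
    using assms by (intro infsumI) (simp add: periodic_partition_def)
  then show "per (\<lambda>x. \<phi> (matrix_inv L *v x)) x = 1"
    using per_uminus[of "\<lambda>x. \<phi> (matrix_inv L *v x)" x]
    by (simp add: linear_diff[OF matrix_vector_mul_linear])
  have "(\<lambda>x. \<phi> (matrix_inv L *v x)) \<in> borel_measurable borel"
    using test_bounded_compact[OF t] by (simp add: bounded_compact_def)
  from integral_lborel_linear[OF det_L this]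
  show "(\<integral>x. \<phi> (matrix_inv L *v x) \<partial>lborel) = of_real \<bar>det L\<bar>"
    by (simp add: integral_periodic_partition[OF assms])
qed

end

section \<open>Approximation by trigonometric polynomials\<close>

context lattice
begin

definition kern :: "real ^ 'n \<Rightarrow> real" where
  "kern x = (\<Sum>i\<in>UNIV. 1 + cos (2 * pi * (matrix_inv L *v x) $ i)) / (2 * real CARD('n))"

definition bump :: "real ^ 'n \<Rightarrow> real" where
  "bump x = std_partition (matrix_inv L *v x)"

definition mass :: "nat \<Rightarrow> real" where
  "mass N = (\<integral>y. bump y * kern y ^ N \<partial>lborel)"

lemma kern_bounds: "0 \<le> kern x" "kern x \<le> 1"
proof -
  show "0 \<le> kern x"
  proof -
    have "0 \<le> 1 + cos t" for t :: real using cos_ge_minus_one[of t] by argo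
    then show ?thesis unfolding kern_def by (intro divide_nonneg_nonneg sum_nonneg) auto
  qed
  have "(\<Sum>i\<in>UNIV. 1 + cos (2 * pi * (matrix_inv L *v x) $ i)) \<le> (\<Sum>i\<in>(UNIV :: 'n set). 2)"
    by (intro sum_mono) simp
  then show "kern x \<le> 1" by (simp add: kern_def divide_le_eq)
qed

lemma kern_lat: "kern (lat \<kappa>) = 1"
proof -
  have "cos (2 * pi * of_int k) = 1" for k
    using arg_cong[OF cis_2pi_int[of k], of Re] by simp
  then show ?thesis by (simp add: kern_def int_vec_def)
qed

lemma kern_eq_1:
  assumes "kern x = 1" shows "\<exists>\<kappa>. x = lat \<kappa>"
proof -
  let ?y = "matrix_inv L *v x"
  have "(\<Sum>i\<in>UNIV. 1 - cos (2 * pi * ?y $ i)) = 0"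
    using assms by (simp add: kern_def sum.distrib sum_subtractf divide_eq_eq)
  then have "1 - cos (2 * pi * ?y $ i) = 0" for i
    by (subst (asm) sum_nonneg_eq_0_iff) auto
  then have "cos (2 * pi * ?y $ i) = 1" for i by (simp add: eq_commute[of 1] right_minus_eq)
  then have "\<forall>i. \<exists>n :: int. 2 * pi * ?y $ i = of_int n * 2 * pi"
    by (simp add: cos_one_2pi_int)
  then have "\<forall>i. \<exists>n :: int. ?y $ i = of_int n" by simp
  then obtain k where "\<And>i. ?y $ i = of_int (k i)" by metis
  then have "?y = int_vec (\<chi> i. k i)" by (simp add: vec_eq_iff int_vec_def)
  then have "x = lat (\<chi> i. k i)" by (metis inv_L_apply(2) lat_def)
  then show ?thesis by blast
qed

lemma continuous_kern: "continuous_on UNIV kern"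
  unfolding kern_def[abs_def]
  by (intro continuous_intros linear_continuous_on matrix_vector_mul_bounded_linear
      continuous_on_component) simp

lemma bump_test: "(\<lambda>x. complex_of_real (bump x)) \<in> test_functions"
  and per_bump: "per (\<lambda>x. complex_of_real (bump x)) x = 1"
  using lattice_partition_test[OF periodic_partition_std] per_lattice_partition[OF periodic_partition_std]
  by (simp_all add: bump_def)

lemma bump_nonneg: "0 \<le> bump x" by (simp add: bump_def std_partition_nonneg)

lemma continuous_bump: "continuous_on UNIV bump"
  using continuous_on_Re[OF smooth_continuous[OF test_functions_smooth[OF bump_test]], of UNIV] by simp

lemma [measurable]: "kern \<in> borel_measurable borel" "bump \<in> borel_measurable borel"
  by (intro borel_measurable_continuous_onI continuous_kern continuous_bump)+

lemma integrable_bump: "integrable lborel bump"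
proof -
  have "integrable lborel (\<lambda>x. cmod (complex_of_real (bump x)))"
    by (intro integrable_norm bounded_compact_integrable test_bounded_compact bump_test)
  then show ?thesis by (simp add: bump_nonneg)
qed

lemma integrable_bump_mult:
  fixes g :: "real ^ 'n \<Rightarrow> real"
  assumes [measurable]: "g \<in> borel_measurable borel" and g: "\<And>x. \<bar>g x\<bar> \<le> M"
  shows "integrable lborel (\<lambda>x. bump x * kern x ^ N * g x)"
proof (rule Bochner_Integration.integrable_bound[OF integrable_mult_right[OF integrable_bump, of M]])
  show "AE x in lborel. norm (bump x * kern x ^ N * g x) \<le> norm (M * bump x)"
  proof (intro AE_I2)
    fix x
    have "bump x * kern x ^ N * \<bar>g x\<bar> \<le> bump x * 1 * M"
      by (intro mult_mono g power_le_one mult_nonneg_nonneg zero_le_power kern_bounds bump_nonneg) auto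
    moreover have "0 \<le> M" using g[of 0] abs_ge_zero order_trans by blast
    ultimately show "norm (bump x * kern x ^ N * g x) \<le> norm (M * bump x)"
      by (simp add: abs_mult bump_nonneg kern_bounds mult.commute)
  qed
qed measurable

lemma integrable_bump_kern: "integrable lborel (\<lambda>x. bump x * kern x ^ N)"
  using integrable_bump_mult[of "\<lambda>_. 1" 1 N] by simp

lemma bump_lat_pos: "\<exists>\<kappa>. 0 < bump (x + lat \<kappa>)"
proof (rule ccontr)
  assume "\<not> ?thesis"
  then have "bump (x + lat \<kappa>) = 0" for \<kappa> using bump_nonneg[of "x + lat \<kappa>"] by (metis less_eq_real_def)
  then have "per (\<lambda>x. complex_of_real (bump x)) x = 0" unfolding per_def by simp
  then show False by (simp add: per_bump)
qed

text \<open>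
  The function \<open>kern\<close> takes values in [0, 1] and equals 1 at the lattice points only. So its powers
  concentrate at the lattice: away from it they are at most \<open>g ^ N\<close> with \<open>g < 1\<close>, while near a lattice
  point they are at least \<open>q ^ N\<close> for any chosen \<open>q < 1\<close>.
\<close>

lemma mass_lower:
  assumes "0 < q" "q < 1"
  shows "\<exists>c>0. \<forall>N. c * q ^ N \<le> mass N"
proof -
  obtain \<kappa> where \<kappa>: "0 < bump (lat \<kappa>)" using bump_lat_pos[of 0] by auto
  let ?S = "{y. bump (lat \<kappa>) / 2 < bump y} \<inter> {y. q < kern y}"
  have "open ?S"
    by (intro open_Int open_Collect_less continuous_intros continuous_kern continuous_bump)
  moreover have "lat \<kappa> \<in> ?S" using \<kappa> assms by (simp add: kern_lat)
  ultimately obtain r where r: "0 < r" "ball (lat \<kappa>) r \<subseteq> ?S" by (meson open_contains_ball)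
  let ?B = "ball (lat \<kappa>) r"
  define c where "c = bump (lat \<kappa>) / 2 * measure lborel ?B"
  have "0 < c" unfolding c_def using \<kappa> content_ball_pos[OF r(1)] by simp
  moreover have "c * q ^ N \<le> mass N" for N
  proof -
    have "c * q ^ N = (\<integral>y. (bump (lat \<kappa>) / 2 * q ^ N) * indicator ?B y \<partial>lborel)"
      by (simp add: c_def)
    also have "\<dots> \<le> mass N"
      unfolding mass_def
    proof (intro integral_mono integrable_bump_kern)
      show "integrable lborel (\<lambda>y. (bump (lat \<kappa>) / 2 * q ^ N) * indicator ?B y)"
        by (intro integrable_mult_right integrable_real_indicator emeasure_bounded_finite bounded_ball) simp
      fix y
      show "bump (lat \<kappa>) / 2 * q ^ N * indicator ?B y \<le> bump y * kern y ^ N"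
      proof (cases "y \<in> ?B")
        case True
        then have "bump (lat \<kappa>) / 2 < bump y" "q < kern y" using r(2) by auto
        then show ?thesis
          using True assms mult_mono[of "bump (lat \<kappa>) / 2" "bump y" "q ^ N" "kern y ^ N"] bump_nonneg[of y]
          by (simp add: power_mono)
      qed (simp add: bump_nonneg kern_bounds)
    qed
    finally show ?thesis .
  qed
  ultimately show ?thesis by blast
qed

lemma mass_pos: "0 < mass N"
proof -
  obtain c where "c > 0" "\<forall>N. c * (1/2) ^ N \<le> mass N" using mass_lower[of "1/2"] by auto
  then have "0 < c * (1/2) ^ N" "c * (1/2) ^ N \<le> mass N" by auto
  then show ?thesis by (rule less_le_trans)
qed

lemma mass_concentrates:
  assumes V: "open V" and lat: "\<And>\<kappa>. lat \<kappa> \<in> V"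
  shows "(\<lambda>N. (\<integral>y. bump y * kern y ^ N * indicator (- V) y \<partial>lborel) / mass N) \<longlonglongrightarrow> 0"
proof -
  obtain K where K: "compact K" "\<And>x. x \<notin> K \<Longrightarrow> bump x = 0"
    using test_functionsD[OF bump_test] by auto
  have KV: "compact (K - V)" using K(1) V by (rule compact_diff)
  have "\<exists>g<1. 0 \<le> g \<and> (\<forall>y\<in>K - V. kern y \<le> g)"
  proof (cases "K - V = {}")
    case True
    then show ?thesis by (intro exI[of _ 0]) auto
  next
    case False
    then obtain y where y: "y \<in> K - V" "\<And>z. z \<in> K - V \<Longrightarrow> kern z \<le> kern y"
      using continuous_attains_sup[OF KV False continuous_on_subset[OF continuous_kern]] by auto
    have "kern y \<noteq> 1" using kern_eq_1[of y] y(1) lat by auto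
    then show ?thesis using y kern_bounds[of y] by (intro exI[of _ "kern y"]) auto
  qed
  then obtain g where g: "g < 1" "0 \<le> g" "\<And>y. y \<in> K - V \<Longrightarrow> kern y \<le> g" by blast
  \<comment> \<open>Any number strictly between \<open>g\<close> and 1 serves.\<close>
  define q where "q = (1 + g) / 2"
  have q: "0 < q" "q < 1" "g < q" using g unfolding q_def by auto
  obtain c where c: "0 < c" "\<And>N. c * q ^ N \<le> mass N" using mass_lower[OF q(1,2)] by blast
  have [measurable]: "V \<in> sets borel" using V by simp
  let ?J = "\<lambda>N. \<integral>y. bump y * kern y ^ N * indicator (- V) y \<partial>lborel"
  let ?b = "\<integral>y. bump y \<partial>lborel"
  have J0: "0 \<le> ?J N" for N
    by (intro Bochner_Integration.integral_nonneg) (simp add: bump_nonneg kern_bounds)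
  have J: "?J N \<le> g ^ N * ?b" for N
  proof -
    have "?J N \<le> (\<integral>y. g ^ N * bump y \<partial>lborel)"
    proof (intro integral_mono integrable_bump_mult[where M = 1] integrable_mult_right integrable_bump)
      fix y
      show "bump y * kern y ^ N * indicator (- V) y \<le> g ^ N * bump y"
      proof (cases "y \<in> K - V")
        case True
        have "kern y ^ N \<le> g ^ N" by (rule power_mono[OF g(3)[OF True] kern_bounds(1)])
        from mult_left_mono[OF this bump_nonneg[of y]] show ?thesis
          using True by (simp add: mult.commute)
      next
        case False
        then show ?thesis using K(2)[of y] g(2) by (auto simp: bump_nonneg indicator_def)
      qed
    qed (auto simp: indicator_def)
    then show ?thesis by simp
  qed
  have b0: "0 \<le> ?b" by (intro Bochner_Integration.integral_nonneg) (simp add: bump_nonneg)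
  have le: "?J N / mass N \<le> (?b / c) * (g / q) ^ N" for N
  proof -
    have "?J N / mass N \<le> (g ^ N * ?b) / (c * q ^ N)"
      using J J0 c q(1) b0 g(2) by (intro frac_le) auto
    then show ?thesis by (simp add: power_divide mult.commute)
  qed
  have lim: "(\<lambda>N. (?b / c) * (g / q) ^ N) \<longlonglongrightarrow> 0"
    using g(2) q by (intro tendsto_mult_right_zero LIMSEQ_power_zero) auto
  show ?thesis
    by (rule tendsto_sandwich[OF _ _ tendsto_const lim])
       (intro always_eventually allI le divide_nonneg_pos J0 mass_pos)+
qed

text \<open>
  Trigonometric polynomials, as an inductive class rather than as explicit finite sums: the statements below
  are linear in the polynomial, so they reduce to characters.
\<close>

inductive_set trig :: "(real ^ 'n \<Rightarrow> complex) set" where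
  chr: "chr \<kappa> \<in> trig"
| cmult: "f \<in> trig \<Longrightarrow> (\<lambda>x. c * f x) \<in> trig"
| add: "f \<in> trig \<Longrightarrow> g \<in> trig \<Longrightarrow> (\<lambda>x. f x + g x) \<in> trig"

lemma trig_const: "(\<lambda>_. c) \<in> trig"
  using trig.cmult[OF trig.chr[of 0], of c] by simp

lemma trig_sum: "(\<And>i. i \<in> I \<Longrightarrow> f i \<in> trig) \<Longrightarrow> (\<lambda>x. \<Sum>i\<in>I. f i x) \<in> trig"
  by (induction I rule: infinite_finite_induct) (auto intro: trig_const trig.add)

lemma trig_mult_chr:
  assumes "f \<in> trig" shows "(\<lambda>x. chr \<kappa> x * f x) \<in> trig"
  using assms
proof induction
  case (chr \<mu>)
  show ?case using trig.chr[of "\<kappa> + \<mu>"] by (simp add: chr_mult[abs_def])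
next
  case (cmult f c)
  then show ?case using trig.cmult[OF cmult.IH, of c] by (simp add: mult.left_commute)
next
  case (add f g)
  then show ?case by (simp add: distrib_left trig.add)
qed

lemma trig_mult:
  assumes "f \<in> trig" "g \<in> trig" shows "(\<lambda>x. f x * g x) \<in> trig"
  using assms(1)
proof induction
  case (chr \<kappa>)
  show ?case by (rule trig_mult_chr[OF assms(2)])
next
  case (cmult f c)
  then show ?case using trig.cmult[OF cmult.IH, of c] by (simp add: mult.assoc)
next
  case (add f h)
  then show ?case by (simp add: distrib_right trig.add)
qed

lemma trig_power: "f \<in> trig \<Longrightarrow> (\<lambda>x. f x ^ N) \<in> trig"
  by (induction N) (auto intro: trig_const trig_mult)

lemma kern_trig: "(\<lambda>x. complex_of_real (kern x)) \<in> trig"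
proof -
  define e where "e i = (axis i 1 :: int ^ 'n)" for i
  have "int_vec (e i) = axis i 1" for i
    by (simp add: e_def vec_eq_iff int_vec_def axis_def)
  then have "dual (e i) \<bullet> x = (matrix_inv L *v x) $ i" for i x
    by (simp add: dual_inner inner_axis' )
  then have "complex_of_real (1 + cos (2 * pi * (matrix_inv L *v x) $ i)) =
      1 + ((1 / 2) * chr (e i) x + (1 / 2) * chr (- e i) x)" for i x
    by (simp add: chr_def dual_uminus complex_eq_iff)
  then have "complex_of_real (kern x) = (1 / (2 * of_nat CARD('n))) *
      (\<Sum>i\<in>UNIV. 1 + ((1 / 2) * chr (e i) x + (1 / 2) * chr (- e i) x))" for x
    unfolding kern_def by (simp only: of_real_divide of_real_sum) simp
  moreover have "(\<lambda>x. (1 / (2 * of_nat CARD('n))) *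
      (\<Sum>i\<in>UNIV. 1 + ((1 / 2) * chr (e i) x + (1 / 2) * chr (- e i) x))) \<in> trig"
    by (intro trig.cmult trig_sum trig.add trig_const trig.chr)
  ultimately show ?thesis by simp
qed

lemma trig_smooth: "f \<in> trig \<Longrightarrow> smooth f"
  by (induction rule: trig.induct) (auto intro: smooth_chr smooth_cmult smooth_add)

lemma trig_bounded: "f \<in> trig \<Longrightarrow> \<exists>M. \<forall>x. cmod (f x) \<le> M"
proof (induction rule: trig.induct)
  case (cmult f c)
  then obtain M where "\<forall>x. cmod (f x) \<le> M" by blast
  then have "\<forall>x. cmod (c * f x) \<le> cmod c * M" by (simp add: norm_mult mult_left_mono)
  then show ?case by blast
next
  case (add f g)
  then obtain M N where "\<forall>x. cmod (f x) \<le> M" "\<forall>x. cmod (g x) \<le> N" by blast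
  then have "\<forall>x. cmod (f x + g x) \<le> M + N" by (meson add_mono norm_triangle_le)
  then show ?case by blast
qed auto

definition conv :: "(real ^ 'n \<Rightarrow> complex) \<Rightarrow> (real ^ 'n \<Rightarrow> complex) \<Rightarrow> real ^ 'n \<Rightarrow> complex" where
  "conv T \<psi> x = (\<integral>y. \<psi> y * T (x - y) \<partial>lborel)"

lemma integrable_conv:
  assumes T: "T \<in> trig" and \<psi>: "\<psi> \<in> test_functions"
  shows "integrable lborel (\<lambda>y. \<psi> y * T (x - y))"
proof -
  obtain M where M: "\<And>x. cmod (T x) \<le> M" using trig_bounded[OF T] by blast
  have [measurable]: "T \<in> borel_measurable borel" by (rule smooth_measurable[OF trig_smooth[OF T]])
  have "bounded_compact (\<lambda>y. T (x - y) * \<psi> y)"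
    by (rule bounded_compact_mult[OF test_bounded_compact[OF \<psi>] _ M]) measurable
  from bounded_compact_integrable[OF this] show ?thesis by (simp add: mult.commute)
qed

lemma conv_chr: "conv (chr \<kappa>) \<psi> x = (\<integral>y. cis (2 * pi * (- dual \<kappa> \<bullet> y)) * \<psi> y \<partial>lborel) * chr \<kappa> x"
proof -
  have "chr \<kappa> (x - y) = cis (2 * pi * (- dual \<kappa> \<bullet> y)) * chr \<kappa> x" for y
    by (simp add: chr_def cis_mult inner_diff_right algebra_simps)
  then have "conv (chr \<kappa>) \<psi> x = (\<integral>y. (cis (2 * pi * (- dual \<kappa> \<bullet> y)) * \<psi> y) * chr \<kappa> x \<partial>lborel)"
    unfolding conv_def by (simp add: mult_ac)
  then show ?thesis by simp
qed

lemma conv_cmult: "conv (\<lambda>x. c * T x) \<psi> = (\<lambda>x. c * conv T \<psi> x)"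
  unfolding conv_def by (simp add: mult.left_commute)

lemma conv_add:
  assumes "S \<in> trig" "T \<in> trig" "\<psi> \<in> test_functions"
  shows "conv (\<lambda>x. S x + T x) \<psi> = (\<lambda>x. conv S \<psi> x + conv T \<psi> x)"
  unfolding conv_def using integrable_conv[OF assms(1,3)] integrable_conv[OF assms(2,3)]
  by (simp add: distrib_left)

text \<open>
  Convolution with a character multiplies that character by a Fourier coefficient of \<open>\<psi>\<close>. A derivative of
  the character is the same as a derivative on \<open>\<psi>\<close>, by integration by parts.
\<close>

lemma conv_trig:
  assumes "T \<in> trig" and \<psi>: "\<psi> \<in> test_functions"
  shows "conv T \<psi> \<in> trig \<and> partial i (conv T \<psi>) = conv T (partial i \<psi>)"
  using assms(1)
proof induction
  case (chr \<kappa>)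
  let ?c = "\<lambda>\<psi>. \<integral>y. cis (2 * pi * (- dual \<kappa> \<bullet> y)) * \<psi> y \<partial>lborel"
  have eq: "conv (chr \<kappa>) \<psi> = (\<lambda>x. ?c \<psi> * chr \<kappa> x)" for \<psi> by (rule ext) (rule conv_chr)
  have "partial i (conv (chr \<kappa>) \<psi>) x = conv (chr \<kappa>) (partial i \<psi>) x" for x
  proof -
    have "partial i (conv (chr \<kappa>) \<psi>) x = ?c \<psi> * ((of_real (2 * pi * dual \<kappa> $ i) * \<i>) * chr \<kappa> x)"
      unfolding eq unfolding chr_def[abs_def] by (simp only: partial_cmult[OF differentiable_cis] partial_cis)
    moreover have "?c (partial i \<psi>) = (of_real (2 * pi * dual \<kappa> $ i) * \<i>) * ?c \<psi>"
      using integral_cis_partial[OF test_functions_schwartz[OF \<psi>], of "- dual \<kappa>" i] by simp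
    ultimately show ?thesis unfolding eq by (simp add: mult_ac)
  qed
  moreover have "conv (chr \<kappa>) \<psi> \<in> trig" unfolding eq by (intro trig.cmult trig.chr)
  ultimately show ?case by blast
next
  case (cmult T c)
  have "partial i (\<lambda>x. c * conv T \<psi> x) = (\<lambda>x. c * partial i (conv T \<psi>) x)"
    using cmult by (intro ext partial_cmult smooth_differentiable trig_smooth) blast
  then show ?case using cmult by (simp add: conv_cmult trig.cmult)
next
  case (add S T)
  have "partial i (\<lambda>x. conv S \<psi> x + conv T \<psi> x) = (\<lambda>x. partial i (conv S \<psi>) x + partial i (conv T \<psi>) x)"
    using add by (intro ext partial_add smooth_differentiable trig_smooth) blast+
  then show ?case
    using add \<psi> by (simp add: conv_add trig.add test_functions_partial)
qed

lemma integral_lborel_reflect: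
  fixes f :: "'a::euclidean_space \<Rightarrow> complex"
  assumes [measurable]: "f \<in> borel_measurable borel"
  shows "(\<integral>y. f (x - y) \<partial>lborel) = (\<integral>y. f y \<partial>lborel)"
  by (subst (2) lborel_affine[of "- 1" x])
     (simp_all add: density_1 integral_distr)

text \<open>
  Unfolding: the kernel is periodic, so that the lattice sum goes over to \<open>\<psi>\<close>, and the integral becomes one
  against the compactly supported weight \<open>bump y * kern y ^ N\<close>.
\<close>

lemma conv_kern:
  assumes \<psi>: "\<psi> \<in> test_functions"
  shows "conv (\<lambda>y. complex_of_real (kern y) ^ N) \<psi> x =
    (\<integral>y. per \<psi> (x - y) * of_real (bump y * kern y ^ N) \<partial>lborel)"
proof -
  let ?T = "\<lambda>y. complex_of_real (kern y) ^ N"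
  obtain M K where M: "\<And>x. cmod (\<psi> x) \<le> M" and K: "compact K" "\<And>x. x \<notin> K \<Longrightarrow> \<psi> x = 0"
    and [measurable]: "\<psi> \<in> borel_measurable borel"
    using test_bounded_compact[OF \<psi>] by (auto simp: bounded_compact_def)
  have T: "kern (y + lat \<kappa>) = kern y" for y \<kappa>
  proof -
    have "cos (2 * pi * (matrix_inv L *v (y + lat \<kappa>)) $ i) = cos (2 * pi * (matrix_inv L *v y) $ i)" for i
    proof -
      have "cis (2 * pi * (matrix_inv L *v (y + lat \<kappa>)) $ i) = cis (2 * pi * (matrix_inv L *v y) $ i)"
        by (simp add: matrix_vector_right_distrib int_vec_def distrib_left cis_mult[symmetric] cis_2pi_int)
      from arg_cong[OF this, of Re] show ?thesis by simp
    qed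
    then show ?thesis by (simp add: kern_def)
  qed
  have refl: "bounded_compact (\<lambda>y. \<psi> (x - y))"
    unfolding bounded_compact_def
  proof (intro conjI exI allI impI)
    show "compact ((\<lambda>y. x - y) ` K)" by (intro compact_continuous_image K continuous_intros)
    fix y assume "y \<notin> (\<lambda>y. x - y) ` K"
    then show "\<psi> (x - y) = 0" by (intro K) (metis diff_diff_eq2 diff_add_cancel add_diff_cancel_left' image_eqI)
  qed (use M in auto)
  have a: "bounded_compact (\<lambda>y. ?T y * \<psi> (x - y))"
    by (rule bounded_compact_mult[OF refl, of _ 1])
       (auto simp: norm_power kern_bounds intro!: power_le_one)
  have per_a: "per (\<lambda>y. ?T y * \<psi> (x - y)) y = ?T y * per \<psi> (x - y)" for y
  proof -
    have "per (\<lambda>y. \<psi> (x - y)) y = per \<psi> (x - y)"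
      using per_uminus[of \<psi> "x - y"] by (simp add: per_def diff_diff_eq)
    then show ?thesis by (subst per_mult_periodic) (simp_all add: T)
  qed
  have "conv ?T \<psi> x = (\<integral>y. ?T y * \<psi> (x - y) \<partial>lborel)"
    unfolding conv_def
    by (subst integral_lborel_reflect[of _ x, symmetric]) (simp_all add: mult.commute)
  also have "\<dots> = (\<integral>y. ?T y * \<psi> (x - y) * per (\<lambda>y. complex_of_real (bump y)) y \<partial>lborel)"
    by (simp add: per_bump)
  also have "\<dots> = (\<integral>y. ?T y * per \<psi> (x - y) * of_real (bump y) \<partial>lborel)"
    by (subst integral_unfold[OF a test_bounded_compact[OF bump_test]]) (simp add: per_a)
  finally show ?thesis by (simp add: mult_ac)
qed

text \<open>
  The translates of \<open>bump\<close> sum to 1, so every point has a lattice translate in the compact support of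
  \<open>bump\<close>.
\<close>

lemma per_bounded:
  assumes \<psi>: "\<psi> \<in> test_functions"
  shows "\<exists>M\<ge>0. \<forall>x. cmod (per \<psi> x) \<le> M"
proof -
  obtain K where K: "compact K" "\<And>x. x \<notin> K \<Longrightarrow> bump x = 0"
    using test_functionsD[OF bump_test] by auto
  have "bounded (per \<psi> ` K)"
    by (intro compact_imp_bounded compact_continuous_image smooth_continuous smooth_per \<psi> K)
  then obtain M where M: "\<And>x. x \<in> K \<Longrightarrow> cmod (per \<psi> x) \<le> M" by (auto simp: bounded_iff)
  have "cmod (per \<psi> x) \<le> \<bar>M\<bar>" for x
  proof -
    obtain \<kappa> where "0 < bump (x + lat \<kappa>)" using bump_lat_pos by blast
    then have "x + lat \<kappa> \<in> K" using K(2) by force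
    then have "cmod (per \<psi> (x + lat \<kappa>)) \<le> M" by (rule M)
    then show ?thesis by (simp add: per_periodic order_trans[OF _ abs_ge_self])
  qed
  then show ?thesis by (intro exI[of _ "\<bar>M\<bar>"]) auto
qed

text \<open>
  The partial derivatives of a periodization are periodizations of test functions, hence bounded.
\<close>

lemma per_lipschitz:
  assumes \<psi>: "\<psi> \<in> test_functions"
  shows "\<exists>B>0. \<forall>x y. cmod (per \<psi> x - per \<psi> y) \<le> B * norm (x - y)"
proof -
  have "\<forall>i. \<exists>M\<ge>0. \<forall>x. cmod (per (partial i \<psi>) x) \<le> M"
    using per_bounded test_functions_partial[OF \<psi>] by blast
  then obtain M where M: "\<And>i. 0 \<le> M i" "\<And>i x. cmod (per (partial i \<psi>) x) \<le> M i" by metis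
  let ?B = "(\<Sum>i\<in>UNIV. M i) + 1"
  have "cmod (per \<psi> x - per \<psi> y) \<le> ?B * norm (x - y)" for x y
  proof (rule differentiable_bound[of UNIV "per \<psi>" "\<lambda>x h. \<Sum>i\<in>UNIV. of_real (h $ i) * per (partial i \<psi>) x"])
    show "(per \<psi> has_derivative (\<lambda>h. \<Sum>i\<in>UNIV. of_real (h $ i) * per (partial i \<psi>) x)) (at x within UNIV)" for x
      using per_derivative[OF \<psi>] by simp
    show "onorm (\<lambda>h. \<Sum>i\<in>UNIV. of_real (h $ i) * per (partial i \<psi>) x) \<le> ?B" for x
    proof (rule onorm_le)
      fix h :: "real ^ 'n"
      have "cmod (\<Sum>i\<in>UNIV. of_real (h $ i) * per (partial i \<psi>) x) \<le> (\<Sum>i\<in>UNIV. M i * norm h)"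
      proof (rule sum_norm_le)
        fix i
        show "cmod (of_real (h $ i) * per (partial i \<psi>) x) \<le> M i * norm h"
          unfolding norm_mult using M component_le_norm_cart[of h i]
          by (subst mult.commute) (intro mult_mono, auto)
      qed
      also have "\<dots> \<le> ?B * norm h" by (simp add: sum_distrib_right[symmetric] distrib_right)
      finally show "cmod (\<Sum>i\<in>UNIV. of_real (h $ i) * per (partial i \<psi>) x) \<le> ?B * norm h" .
    qed
  qed auto
  moreover have "0 < ?B" using M(1) by (simp add: add_nonneg_pos sum_nonneg)
  ultimately show ?thesis by blast
qed

definition approx :: "nat \<Rightarrow> (real ^ 'n \<Rightarrow> complex) \<Rightarrow> real ^ 'n \<Rightarrow> complex" where
  "approx N \<psi> x = of_real (1 / mass N) * conv (\<lambda>y. complex_of_real (kern y) ^ N) \<psi> x"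

lemma approx_trig: "\<psi> \<in> test_functions \<Longrightarrow> approx N \<psi> \<in> trig"
  unfolding approx_def[abs_def] by (intro trig.cmult conjunct1[OF conv_trig] trig_power kern_trig)

lemma partial_approx:
  assumes \<psi>: "\<psi> \<in> test_functions" shows "partial i (approx N \<psi>) = approx N (partial i \<psi>)"
proof -
  have c: "conv (\<lambda>y. complex_of_real (kern y) ^ N) \<psi> \<in> trig"
    "partial i (conv (\<lambda>y. complex_of_real (kern y) ^ N) \<psi>) = conv (\<lambda>y. complex_of_real (kern y) ^ N) (partial i \<psi>)"
    using conv_trig[OF trig_power[OF kern_trig] \<psi>] by blast+
  show ?thesis
    unfolding approx_def[abs_def] c(2)[symmetric]
    by (intro ext partial_cmult smooth_differentiable trig_smooth c(1))
qed

lemma partials_approx: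
  "\<psi> \<in> test_functions \<Longrightarrow> partials js (approx N \<psi>) = approx N (partials js \<psi>)"
  by (induction js) (use partials_per in \<open>auto simp: partials_Cons partial_approx\<close>)

text \<open>
  The error is an average of \<open>per \<psi> (x - y) - per \<psi> x\<close> with weight \<open>bump y * kern y ^ N / mass N\<close>. The
  integrand is at most \<open>e\<close> on \<open>V\<close> and \<open>2 * M\<close> elsewhere.
\<close>

lemma approx_error:
  assumes \<psi>: "\<psi> \<in> test_functions" and V: "open V"
    and near: "\<And>x y. y \<in> V \<Longrightarrow> cmod (per \<psi> (x - y) - per \<psi> x) \<le> e"
    and M: "\<And>x. cmod (per \<psi> x) \<le> M" and "0 \<le> e"
  shows "cmod (approx N \<psi> x - per \<psi> x) \<le>
    e + 2 * M * ((\<integral>y. bump y * kern y ^ N * indicator (- V) y \<partial>lborel) / mass N)"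
proof -
  have [measurable]: "V \<in> sets borel" using V by simp
  have [measurable]: "per \<psi> \<in> borel_measurable borel" by (rule smooth_measurable[OF smooth_per[OF \<psi>]])
  have "0 \<le> M" using order_trans[OF norm_ge_zero M[of 0]] .
  let ?w = "\<lambda>y. bump y * kern y ^ N"
  have w0: "0 \<le> ?w y" for y by (simp add: bump_nonneg kern_bounds)
  have i1: "integrable lborel (\<lambda>y. per \<psi> (x - y) * of_real (?w y))"
  proof (rule Bochner_Integration.integrable_bound[OF integrable_mult_right[OF integrable_bump_kern, of M N]])
    show "AE y in lborel. norm (per \<psi> (x - y) * of_real (?w y)) \<le> norm (M * ?w y)"
    proof (intro AE_I2)
      fix y
      have "norm (per \<psi> (x - y) * of_real (?w y)) = cmod (per \<psi> (x - y)) * ?w y"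
        by (simp only: norm_mult norm_of_real abs_of_nonneg[OF w0])
      also have "\<dots> \<le> M * ?w y" by (rule mult_right_mono[OF M w0])
      also have "\<dots> \<le> norm (M * ?w y)" unfolding real_norm_def by (rule abs_ge_self)
      finally show "norm (per \<psi> (x - y) * of_real (?w y)) \<le> norm (M * ?w y)" .
    qed
  qed measurable
  have i2: "integrable lborel (\<lambda>y. per \<psi> x * of_real (?w y))"
    by (intro integrable_mult_right integrable_of_real integrable_bump_kern)
  have i3: "integrable lborel (\<lambda>y. ?w y * (e + 2 * M * indicator (- V) y))"
    by (rule integrable_bump_mult[where M = "e + 2 * M"])
       (use \<open>0 \<le> e\<close> \<open>0 \<le> M\<close> in \<open>auto simp: indicator_def\<close>)
  have i4: "integrable lborel (\<lambda>y. ?w y * indicator (- V) y)"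
    by (rule integrable_bump_mult[where M = 1]) (auto simp: indicator_def)
  have "approx N \<psi> x - per \<psi> x = of_real (1 / mass N) *
      ((\<integral>y. per \<psi> (x - y) * of_real (?w y) \<partial>lborel) - per \<psi> x * of_real (mass N))"
    using mass_pos[of N] by (simp add: approx_def conv_kern[OF \<psi>] field_simps)
  also have "per \<psi> x * of_real (mass N) = (\<integral>y. per \<psi> x * of_real (?w y) \<partial>lborel)"
    unfolding mass_def by (simp only: integral_mult_right_zero integral_complex_of_real)
  also have "(\<integral>y. per \<psi> (x - y) * of_real (?w y) \<partial>lborel) - (\<integral>y. per \<psi> x * of_real (?w y) \<partial>lborel) =
      (\<integral>y. (per \<psi> (x - y) - per \<psi> x) * of_real (?w y) \<partial>lborel)"
    by (subst Bochner_Integration.integral_diff[OF i1 i2, symmetric]) (simp add: left_diff_distrib)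
  finally have eq: "approx N \<psi> x - per \<psi> x =
      of_real (1 / mass N) * (\<integral>y. (per \<psi> (x - y) - per \<psi> x) * of_real (?w y) \<partial>lborel)" .
  have "cmod (\<integral>y. (per \<psi> (x - y) - per \<psi> x) * of_real (?w y) \<partial>lborel) \<le>
      (\<integral>y. ?w y * (e + 2 * M * indicator (- V) y) \<partial>lborel)"
  proof (rule order_trans[OF integral_norm_bound], rule integral_mono)
    show "integrable lborel (\<lambda>y. norm ((per \<psi> (x - y) - per \<psi> x) * of_real (?w y)))"
      using integrable_norm[OF Bochner_Integration.integrable_diff[OF i1 i2]] by (simp add: left_diff_distrib)
    fix y
    have "cmod (per \<psi> (x - y) - per \<psi> x) \<le> e + 2 * M * indicator (- V) y"
    proof (cases "y \<in> V")
      case False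
      have "cmod (per \<psi> (x - y) - per \<psi> x) \<le> M + M"
        by (intro order_trans[OF norm_triangle_ineq4] add_mono M)
      then show ?thesis using False \<open>0 \<le> e\<close> by simp
    qed (simp add: near)
    then show "norm ((per \<psi> (x - y) - per \<psi> x) * of_real (?w y)) \<le> ?w y * (e + 2 * M * indicator (- V) y)"
      unfolding norm_mult norm_of_real abs_of_nonneg[OF w0] by (subst mult.commute) (rule mult_left_mono[OF _ w0])
  qed (rule i3)
  also have "\<dots> = e * mass N + 2 * M * (\<integral>y. ?w y * indicator (- V) y \<partial>lborel)"
  proof -
    have "(\<integral>y. ?w y * (e + 2 * M * indicator (- V) y) \<partial>lborel) =
        (\<integral>y. e * ?w y + (2 * M) * (?w y * indicator (- V) y) \<partial>lborel)"
      by (intro Bochner_Integration.integral_cong) (simp_all add: algebra_simps)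
    then show ?thesis
      unfolding mass_def using integrable_bump_kern i4 by simp
  qed
  finally have "1 / mass N * cmod (\<integral>y. (per \<psi> (x - y) - per \<psi> x) * of_real (?w y) \<partial>lborel) \<le>
      1 / mass N * (e * mass N + 2 * M * (\<integral>y. ?w y * indicator (- V) y \<partial>lborel))"
    using mass_pos[of N] by (intro mult_left_mono) auto
  also have "\<dots> = e + 2 * M * ((\<integral>y. ?w y * indicator (- V) y \<partial>lborel) / mass N)"
    using mass_pos[of N] by (simp add: distrib_left)
  finally show ?thesis
    unfolding eq norm_mult norm_of_real using mass_pos[of N] by simp
qed

text \<open>
  Take for \<open>V\<close> a union of small balls around the lattice points: there the integrand is small since \<open>per \<psi>\<close> is
  periodic and Lipschitz, and the weight outside of \<open>V\<close> tends to 0.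
\<close>

lemma approx_uniform:
  assumes \<psi>: "\<psi> \<in> test_functions"
  shows "\<exists>\<delta>. \<delta> \<longlonglongrightarrow> 0 \<and> (\<forall>N x. cmod (approx N \<psi> x - per \<psi> x) \<le> \<delta> N)"
proof -
  obtain M where M: "0 \<le> M" "\<And>x. cmod (per \<psi> x) \<le> M" using per_bounded[OF \<psi>] by blast
  obtain B where B: "0 < B" "\<And>x y. cmod (per \<psi> x - per \<psi> y) \<le> B * norm (x - y)"
    using per_lipschitz[OF \<psi>] by blast
  define \<delta> where "\<delta> N = (SUP x. cmod (approx N \<psi> x - per \<psi> x))" for N
  have "cmod (approx N \<psi> x - per \<psi> x) \<le> 0 + 2 * M * ((\<integral>y. bump y * kern y ^ N * indicator (- {}) y \<partial>lborel) / mass N)" for N x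
    by (rule approx_error[OF \<psi>]) (use M in auto)
  then have bdd: "bdd_above (range (\<lambda>x. cmod (approx N \<psi> x - per \<psi> x)))" for N
    by (intro bdd_aboveI2)
  have le: "cmod (approx N \<psi> x - per \<psi> x) \<le> \<delta> N" for N x
    unfolding \<delta>_def by (rule cSUP_upper[OF _ bdd]) simp
  have "\<delta> \<longlonglongrightarrow> 0"
  proof (rule LIMSEQ_I)
    fix r :: real
    assume r: "0 < r"
    define V where "V = (\<Union>\<kappa>. ball (lat \<kappa>) (r / (2 * B)))"
    have "lat \<kappa> \<in> ball (lat \<kappa>) (r / (2 * B))" for \<kappa> using r B(1) by simp
    then have V: "open V" "\<And>\<kappa>. lat \<kappa> \<in> V" unfolding V_def by blast+
    have near: "cmod (per \<psi> (x - y) - per \<psi> x) \<le> r / 2" if y: "y \<in> V" for x y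
    proof -
      obtain \<kappa> where \<kappa>: "norm (y - lat \<kappa>) < r / (2 * B)"
        using y by (auto simp: V_def dist_norm norm_minus_commute)
      have "cmod (per \<psi> (x - y) - per \<psi> x) = cmod (per \<psi> (x - y + lat \<kappa>) - per \<psi> x)"
        by (simp only: per_periodic)
      also have "\<dots> \<le> B * norm (x - y + lat \<kappa> - x)" by (rule B(2))
      also have "norm (x - y + lat \<kappa> - x) = norm (y - lat \<kappa>)"
        using norm_minus_commute[of y "lat \<kappa>"] by simp
      also have "B * norm (y - lat \<kappa>) \<le> B * (r / (2 * B))"
        using \<kappa> B(1) by (intro mult_left_mono) auto
      finally show ?thesis using B(1) by simp
    qed
    let ?J = "\<lambda>N. (\<integral>y. bump y * kern y ^ N * indicator (- V) y \<partial>lborel) / mass N"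
    have "(\<lambda>N. 2 * M * ?J N) \<longlonglongrightarrow> 0"
      by (intro tendsto_mult_right_zero mass_concentrates V)
    from LIMSEQ_D[OF this, of "r / 2"] r obtain N0 where N0: "\<And>N. N \<ge> N0 \<Longrightarrow> norm (2 * M * ?J N - 0) < r / 2"
      by auto
    have "norm (\<delta> N - 0) < r" if "N \<ge> N0" for N
    proof -
      have "\<delta> N \<le> r / 2 + 2 * M * ?J N"
        unfolding \<delta>_def by (rule cSUP_least) (use approx_error[OF \<psi> V(1) near M(2)] r in auto)
      moreover have "0 \<le> \<delta> N" using order_trans[OF norm_ge_zero le[of N 0]] .
      moreover have "2 * M * ?J N < r / 2"
      proof -
        have "\<bar>2 * M * ?J N\<bar> < r / 2" using N0[OF that] by (simp only: real_norm_def diff_0_right)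
        then show ?thesis by (rule order_le_less_trans[OF abs_ge_self])
      qed
      ultimately have "\<delta> N < r" "0 \<le> \<delta> N" by argo+
      then show ?thesis by simp
    qed
    then show "\<exists>N0. \<forall>N\<ge>N0. norm (\<delta> N - 0) < r" by blast
  qed
  with le show ?thesis by blast
qed


section \<open>Fourier series of periodic distributions\<close>

lemma linear_form_zero:
  assumes "linear_form_on test_functions w" shows "w (\<lambda>_. 0) = 0"
  using assms[unfolded linear_form_on_def, rule_format, OF test_functions_zero test_functions_zero, of 0 0]
  by simp

lemma linear_form_add:
  assumes "linear_form_on test_functions w" "f \<in> test_functions" "g \<in> test_functions"
  shows "w (\<lambda>x. f x + g x) = w f + w g"
  using assms(1)[unfolded linear_form_on_def, rule_format, OF assms(2,3), of 1 1] by simp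

lemma linear_form_cmult:
  assumes "linear_form_on test_functions w" "f \<in> test_functions"
  shows "w (\<lambda>x. c * f x) = c * w f"
  using assms(1)[unfolded linear_form_on_def, rule_format, OF assms(2,2), of c 0] by simp

lemma linear_form_sum:
  assumes w: "linear_form_on test_functions w" and "\<And>i. i \<in> I \<Longrightarrow> f i \<in> test_functions"
  shows "w (\<lambda>x. \<Sum>i\<in>I. f i x) = (\<Sum>i\<in>I. w (f i))"
  using assms(2)
proof (induction I rule: infinite_finite_induct)
  case (insert i I)
  then show ?case
    using linear_form_add[OF w, of "f i" "\<lambda>x. \<Sum>i\<in>I. f i x"] by (simp add: test_functions_sum)
qed (simp_all add: linear_form_zero[OF w])

text \<open>
  A periodic functional sees only the periodization of a test function. The latter is a limit of
  trigonometric polynomials together with all its derivatives, so the functional is determined by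
  its Fourier coefficients.
\<close>

lemma periodic_functional_eq_0:
  assumes w: "linear_form_on test_functions w"
    and periodic: "\<And>\<kappa> \<psi>. \<psi> \<in> test_functions \<Longrightarrow> w (\<lambda>x. \<psi> (x + lat \<kappa>)) = w \<psi>"
    and cont: "\<And>K f l. compact K \<Longrightarrow> (\<And>n. f n \<in> test_on K) \<Longrightarrow> l \<in> test_on K \<Longrightarrow>
      (\<And>k is. (\<lambda>n. sw_seminorm k is (\<lambda>x. f n x - l x)) \<longlonglongrightarrow> 0) \<Longrightarrow> (\<lambda>n. w (f n)) \<longlonglongrightarrow> w l"
    and \<phi>: "\<phi> \<in> test_functions" "\<And>x. per \<phi> x = 1"
    and coeff: "\<And>\<kappa>. w (\<lambda>x. chr \<kappa> x * \<phi> x) = 0"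
    and \<psi>: "\<psi> \<in> test_functions"
  shows "w \<psi> = 0"
proof -
  obtain K where K: "compact K" "\<And>x. x \<notin> K \<Longrightarrow> \<phi> x = 0" using test_functionsD[OF \<phi>(1)] by auto
  obtain H where H: "compact H" "\<And>x. x \<notin> H \<Longrightarrow> \<psi> x = 0" using test_functionsD[OF \<psi>] by auto
  define F where "F = {\<kappa>. \<exists>x\<in>H. x + lat \<kappa> \<in> K}"
  have 1: "\<psi> x * per \<phi> x = (\<Sum>\<kappa>\<in>F. \<psi> x * \<phi> (x + lat \<kappa>))" for x
    unfolding F_def by (rule unfold_sum(2)[OF H K])
  have 2: "per \<psi> x * \<phi> x = (\<Sum>\<kappa>\<in>F. \<psi> (x - lat \<kappa>) * \<phi> x)" for x
    unfolding F_def by (rule unfold_sum(3)[OF H K])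
  have t1: "(\<lambda>x. \<psi> x * \<phi> (x + lat \<kappa>)) \<in> test_functions" for \<kappa>
    by (intro test_functions_mult test_functions_smooth \<psi> test_functions_translation \<phi>)
  have t2: "(\<lambda>x. \<psi> (x - lat \<kappa>) * \<phi> x) \<in> test_functions" for \<kappa>
    using smooth_translation[OF test_functions_smooth[OF \<psi>], of "- lat \<kappa>"]
    by (intro test_functions_mult \<phi>) simp
  have "w (\<lambda>x. \<psi> x * \<phi> (x + lat \<kappa>)) = w (\<lambda>x. \<psi> (x - lat \<kappa>) * \<phi> x)" for \<kappa>
    using periodic[OF t2[of \<kappa>], of \<kappa>] by simp
  then have "w (\<lambda>x. \<psi> x * per \<phi> x) = w (\<lambda>x. per \<psi> x * \<phi> x)"
    unfolding 1 2 by (simp add: linear_form_sum[OF w t1] linear_form_sum[OF w t2])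
  then have w_per: "w \<psi> = w (\<lambda>x. per \<psi> x * \<phi> x)" by (simp add: \<phi>(2))
  have trig0: "w (\<lambda>x. T x * \<phi> x) = 0" if "T \<in> trig" for T
    using that
  proof induction
    case (chr \<kappa>)
    then show ?case by (rule coeff)
  next
    case (cmult T c)
    have "w (\<lambda>x. c * (T x * \<phi> x)) = c * w (\<lambda>x. T x * \<phi> x)"
      using cmult.hyps by (intro linear_form_cmult[OF w] test_functions_mult trig_smooth \<phi>)
    then show ?case using cmult.IH by (simp add: mult.assoc)
  next
    case (add S T)
    have "w (\<lambda>x. S x * \<phi> x + T x * \<phi> x) = w (\<lambda>x. S x * \<phi> x) + w (\<lambda>x. T x * \<phi> x)"
      using add.hyps by (intro linear_form_add[OF w] test_functions_mult trig_smooth \<phi>)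
    then show ?case using add.IH by (simp add: distrib_right)
  qed
  have smooth_err: "smooth (\<lambda>x. approx N \<psi> x - per \<psi> x)" for N
    by (intro smooth_minus trig_smooth approx_trig smooth_per \<psi>)
  have "(\<lambda>N. w (\<lambda>x. approx N \<psi> x * \<phi> x)) \<longlonglongrightarrow> w (\<lambda>x. per \<psi> x * \<phi> x)"
  proof (rule cont[OF K(1)])
    show "(\<lambda>x. approx N \<psi> x * \<phi> x) \<in> test_on K" for N
      using K(2) by (simp add: test_on_def smooth_mult trig_smooth approx_trig \<psi> test_functions_smooth \<phi>)
    show "(\<lambda>x. per \<psi> x * \<phi> x) \<in> test_on K"
      using K(2) by (simp add: test_on_def smooth_mult smooth_per \<psi> test_functions_smooth \<phi>)
    fix k "is"
    have "(\<lambda>N. sw_seminorm k is (\<lambda>x. (approx N \<psi> x - per \<psi> x) * \<phi> x)) \<longlonglongrightarrow> 0"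
    proof (rule sw_seminorm_mult_tendsto_0[where m = 0])
      fix js
      have "partials js (\<lambda>x. approx N \<psi> x - per \<psi> x) = (\<lambda>x. approx N (partials js \<psi>) x - per (partials js \<psi>) x)" for N
        using \<psi> by (subst partials_minus) (simp_all add: trig_smooth approx_trig smooth_per partials_approx partials_per)
      moreover have "\<exists>\<delta>. \<delta> \<longlonglongrightarrow> 0 \<and> (\<forall>N x. cmod (approx N (partials js \<psi>) x - per (partials js \<psi>) x) \<le> \<delta> N)"
        using \<psi> by (intro approx_uniform) (simp add: partials_per)
      ultimately show "\<exists>\<epsilon>. \<epsilon> \<longlonglongrightarrow> 0 \<and> (\<forall>N x. cmod (partials js (\<lambda>x. approx N \<psi> x - per \<psi> x) x) \<le> \<epsilon> N * (1 + norm x) ^ 0)"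
        by simp
    qed (intro test_functions_schwartz \<phi> smooth_err)+
    then show "(\<lambda>N. sw_seminorm k is (\<lambda>x. approx N \<psi> x * \<phi> x - per \<psi> x * \<phi> x)) \<longlonglongrightarrow> 0"
      by (simp add: left_diff_distrib)
  qed
  then have "(\<lambda>N. 0) \<longlonglongrightarrow> w (\<lambda>x. per \<psi> x * \<phi> x)" by (simp add: trig0 approx_trig \<psi>)
  then show ?thesis unfolding w_per by (rule LIMSEQ_unique) simp
qed

definition series :: "(int ^ 'n \<Rightarrow> complex) \<Rightarrow> 'n functional" where
  "series c f = (if f \<in> schwartz then \<Sum>\<^sub>\<infinity>\<kappa>. c \<kappa> * (\<integral>x. chr \<kappa> x * f x \<partial>lborel) else 0)"

lemma schwartz_chr: "f \<in> schwartz \<Longrightarrow> (\<lambda>x. chr \<kappa> x * f x) \<in> schwartz"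
  unfolding chr_def by (rule schwartz_modulation)

lemma norm_integral_chr: "cmod (\<integral>x. chr \<kappa> x * f x \<partial>lborel) \<le> (\<integral>x. cmod (f x) \<partial>lborel)"
proof -
  have "cmod (\<integral>x. chr \<kappa> x * f x \<partial>lborel) \<le> (\<integral>x. cmod (chr \<kappa> x * f x) \<partial>lborel)"
    by (rule integral_norm_bound)
  then show ?thesis by (simp add: norm_mult)
qed

lemma series_summable:
  assumes c: "(\<lambda>\<kappa>. cmod (c \<kappa>)) summable_on UNIV"
  shows "(\<lambda>\<kappa>. cmod (c \<kappa> * (\<integral>x. chr \<kappa> x * f x \<partial>lborel))) summable_on UNIV"
  by (rule summable_on_comparison_test[OF summable_on_cmult_left[OF c, of "\<integral>x. cmod (f x) \<partial>lborel"]])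
     (auto simp: norm_mult intro: mult_left_mono norm_integral_chr)

text \<open>
  Each integral is at most the \<open>L\<^sup>1\<close> norm of \<open>f\<close>, which one Schwartz seminorm controls.
\<close>

lemma series_tempered:
  assumes c: "(\<lambda>\<kappa>. cmod (c \<kappa>)) summable_on UNIV"
  shows "series c \<in> tempered"
proof (rule temperedI)
  let ?k = "2 * CARD('n)"
  let ?S = "\<Sum>\<^sub>\<infinity>\<kappa>. cmod (c \<kappa>)"
  show "linear_form_on schwartz (series c)"
    unfolding linear_form_on_def
  proof (intro ballI allI)
    fix f g :: "real ^ 'n \<Rightarrow> complex" and a b
    assume f: "f \<in> schwartz" and g: "g \<in> schwartz"
    have "(\<lambda>x. a * f x + b * g x) \<in> schwartz" using f g by (intro schwartz_add schwartz_cmult)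
    moreover have "(\<integral>x. chr \<kappa> x * (a * f x + b * g x) \<partial>lborel) =
        a * (\<integral>x. chr \<kappa> x * f x \<partial>lborel) + b * (\<integral>x. chr \<kappa> x * g x \<partial>lborel)" for \<kappa>
    proof -
      have "(\<integral>x. chr \<kappa> x * (a * f x + b * g x) \<partial>lborel) =
          (\<integral>x. a * (chr \<kappa> x * f x) + b * (chr \<kappa> x * g x) \<partial>lborel)"
        by (simp add: algebra_simps)
      then show ?thesis
        by (simp add: schwartz_integrable schwartz_chr f g)
    qed
    moreover have "c \<kappa> * (a * u + b * v) = a * (c \<kappa> * u) + b * (c \<kappa> * v)" for \<kappa> u v
      by (simp add: algebra_simps)
    moreover have "(\<lambda>\<kappa>. c \<kappa> * (\<integral>x. chr \<kappa> x * h x \<partial>lborel)) summable_on UNIV" for h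
      by (rule abs_summable_summable[OF series_summable[OF c]])
    ultimately show "series c (\<lambda>x. a * f x + b * g x) = a * series c f + b * series c g"
      using f g by (simp add: series_def infsum_add summable_on_cmult_right infsum_cmult_right')
  qed
  fix f :: "real ^ 'n \<Rightarrow> complex"
  assume f: "f \<in> schwartz"
  have "cmod (series c f) \<le> (\<Sum>\<^sub>\<infinity>\<kappa>. cmod (c \<kappa> * (\<integral>x. chr \<kappa> x * f x \<partial>lborel)))"
    using f by (simp add: series_def norm_infsum_bound series_summable[OF c])
  also have "\<dots> \<le> (\<Sum>\<^sub>\<infinity>\<kappa>. cmod (c \<kappa>) * (\<integral>x. cmod (f x) \<partial>lborel))"
    by (intro infsum_mono series_summable[OF c] summable_on_cmult_left c)
       (simp add: norm_mult mult_left_mono norm_integral_chr)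
  also have "\<dots> = ?S * (\<integral>x. cmod (f x) \<partial>lborel)" by (rule infsum_cmult_left')
  also have "\<dots> \<le> ?S * (sw_seminorm ?k [] f * decay_mass TYPE('n))"
    by (intro mult_left_mono schwartz_integral_norm f infsum_nonneg) simp
  finally show "cmod (series c f) \<le> (?S * decay_mass TYPE('n)) * sw_seminorm ?k [] f"
    by (simp add: mult_ac)
qed (simp add: series_def)

lemma series_periodic:
  assumes "f \<in> schwartz" shows "series c (\<lambda>x. f (x + lat \<mu>)) = series c f"
proof -
  have [measurable]: "f \<in> borel_measurable borel" by (rule smooth_measurable[OF schwartz_smooth[OF assms]])
  have "(\<integral>x. chr \<kappa> x * f (x + lat \<mu>) \<partial>lborel) = (\<integral>x. chr \<kappa> x * f x \<partial>lborel)" for \<kappa>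
    using integral_lborel_shift[of "\<lambda>x. chr \<kappa> x * f x" "lat \<mu>"] by (simp add: chr_add add.commute)
  then show ?thesis using assms by (simp add: series_def schwartz_translation)
qed

text \<open>
  Orthogonality of the characters: only the term \<open>\<kappa> = \<mu>\<close> survives.
\<close>

lemma series_coeff:
  assumes \<phi>: "periodic_partition \<phi>"
  shows "series c (\<lambda>x. chr (- \<mu>) x * \<phi> (matrix_inv L *v x)) = of_real \<bar>det L\<bar> * c \<mu>"
proof -
  let ?\<phi> = "\<lambda>x. \<phi> (matrix_inv L *v x)"
  have I: "(\<integral>x. chr \<kappa> x * (chr (- \<mu>) x * ?\<phi> x) \<partial>lborel) = (if \<kappa> = \<mu> then of_real \<bar>det L\<bar> else 0)" for \<kappa>
  proof -
    have "(\<integral>x. chr \<kappa> x * (chr (- \<mu>) x * ?\<phi> x) \<partial>lborel) = (\<integral>x. chr (\<kappa> - \<mu>) x * ?\<phi> x \<partial>lborel)"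
      by (simp add: chr_mult[of \<kappa> "- \<mu>", simplified] mult.assoc)
    then show ?thesis
      using integral_chr_partition[OF test_bounded_compact[OF lattice_partition_test[OF \<phi>]]
          per_lattice_partition[OF \<phi>], of "\<kappa> - \<mu>"]
      by (simp add: integral_lattice_partition[OF \<phi>])
  qed
  have "(\<lambda>x. chr (- \<mu>) x * ?\<phi> x) \<in> schwartz"
    by (intro schwartz_chr test_functions_schwartz lattice_partition_test \<phi>)
  then have "series c (\<lambda>x. chr (- \<mu>) x * ?\<phi> x) = (\<Sum>\<^sub>\<infinity>\<kappa>. c \<kappa> * (if \<kappa> = \<mu> then of_real \<bar>det L\<bar> else 0))"
    by (simp add: series_def I)
  also have "\<dots> = (\<Sum>\<^sub>\<infinity>\<kappa>\<in>{\<mu>}. c \<kappa> * of_real \<bar>det L\<bar>)"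
    by (rule infsum_cong_neutral) auto
  finally show ?thesis by (simp add: mult.commute)
qed

text \<open>
  The difference of the distribution and its Fourier series is periodic and has vanishing Fourier
  coefficients.
\<close>

theorem tempered_ext_eq_series:
  assumes p: "p \<in> periodic_distributions L"
    and c: "(\<lambda>\<kappa>. cmod (fourier_coeff L p \<kappa>)) summable_on UNIV"
  shows "tempered_ext p = series (fourier_coeff L p)"
proof (rule tempered_ext_eq[OF series_tempered[OF c]])
  fix \<psi> :: "real ^ 'n \<Rightarrow> complex"
  assume \<psi>: "\<psi> \<in> test_functions"
  let ?U = "series (fourier_coeff L p)"
  have U: "?U \<in> tempered" by (rule series_tempered[OF c])
  define \<phi> where "\<phi> = (SOME \<phi> :: real ^ 'n \<Rightarrow> complex. periodic_partition \<phi>)"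
  have \<phi>: "periodic_partition \<phi>"
    unfolding \<phi>_def by (rule someI[of periodic_partition]) (rule periodic_partition_std)
  have lin_p: "linear_form_on test_functions p"
    using p by (simp add: periodic_distributions_def distributions_def)
  have "?U \<psi> - p \<psi> = 0"
  proof (rule periodic_functional_eq_0[where w = "\<lambda>\<psi>. ?U \<psi> - p \<psi>" and \<phi> = "\<lambda>x. \<phi> (matrix_inv L *v x)"])
    show "linear_form_on test_functions (\<lambda>\<psi>. ?U \<psi> - p \<psi>)"
      using U lin_p unfolding tempered_def linear_form_on_def
      by (auto simp: test_functions_schwartz algebra_simps)
    show "?U (\<lambda>x. \<psi> (x + lat \<kappa>)) - p (\<lambda>x. \<psi> (x + lat \<kappa>)) = ?U \<psi> - p \<psi>"
      if "\<psi> \<in> test_functions" for \<psi> \<kappa>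
    proof -
      have "translation_dist (L *v int_vec \<kappa>) p = p"
        using p by (simp add: periodic_distributions_def)
      from fun_cong[OF this, of \<psi>] have "p (\<lambda>x. \<psi> (x + lat \<kappa>)) = p \<psi>"
        by (simp add: translation_dist_def translation_def lat_def)
      then show ?thesis by (simp add: series_periodic test_functions_schwartz that)
    qed
    show "(\<lambda>n. ?U (f n) - p (f n)) \<longlonglongrightarrow> ?U l - p l"
      if K: "compact K" and f: "\<And>n. f n \<in> test_on K" "l \<in> test_on K"
        and lim: "\<And>k is. (\<lambda>n. sw_seminorm k is (\<lambda>x. f n x - l x)) \<longlonglongrightarrow> 0" for K f l
    proof (rule tendsto_diff)
      have "f n \<in> schwartz" "l \<in> schwartz" for n using f test_on_schwartz[OF K] by blast+
      then show "(\<lambda>n. ?U (f n)) \<longlonglongrightarrow> ?U l" by (rule tempered_tendsto[OF U _ _ lim])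
      have "continuous_map (seminorm_topology (test_on K) (range (sw_seminorm 0))) euclidean p"
        using p K by (simp add: periodic_distributions_def distributions_def)
      then show "(\<lambda>n. p (f n)) \<longlonglongrightarrow> p l"
        by (rule continuous_functional_tendsto) (use f lim test_on_schwartz[OF K] in auto)
    qed
    show "(\<lambda>x. \<phi> (matrix_inv L *v x)) \<in> test_functions" by (rule lattice_partition_test[OF \<phi>])
    show "per (\<lambda>x. \<phi> (matrix_inv L *v x)) x = 1" for x by (rule per_lattice_partition[OF \<phi>])
    show "?U (\<lambda>x. chr \<kappa> x * \<phi> (matrix_inv L *v x)) - p (\<lambda>x. chr \<kappa> x * \<phi> (matrix_inv L *v x)) = 0" for \<kappa>
    proof -
      have "fourier_coeff L p (- \<kappa>) = p (\<lambda>x. chr \<kappa> x * \<phi> (matrix_inv L *v x)) / of_real \<bar>det L\<bar>"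
        by (simp add: fourier_coeff_def compose_dist_def modulation_def \<phi>_def[symmetric] chr_def
            dual_inner int_vec_uminus)
      then show ?thesis
        using series_coeff[OF \<phi>, of "fourier_coeff L p" "- \<kappa>"] det_L by simp
    qed
  qed (rule \<psi>)
  then show "?U \<psi> = p \<psi>" by simp
qed

end

section \<open>Operators with periodic symbol\<close>

lemma join_eq_iff: "join x y = z \<longleftrightarrow> x = vfst z \<and> y = vsnd z"
  by auto

lemma block_apply:
  "block A B C D *v z = join (A *v vfst z + B *v vsnd z) (C *v vfst z + D *v vsnd z)"
proof -
  have "(block A B C D *v z) $ i = join (A *v vfst z + B *v vsnd z) (C *v vfst z + D *v vsnd z) $ i" for i
    by (cases i) (simp_all add: block_def matrix_vector_component sum_UNIV_Plus vfst_def vsnd_def)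
  then show ?thesis by (simp add: vec_eq_iff)
qed

lemma minus_mat_apply [simp]: "(- A) *v x = - (A *v x)" for A :: "real ^ 'n::finite ^ 'm::finite"
  by (simp add: vec_eq_iff matrix_vector_component sum_negf)

lemma zero_mat_apply [simp]: "(0 :: real ^ 'n::finite ^ 'm::finite) *v x = 0"
  by (simp add: vec_eq_iff matrix_vector_component)

lemma abs_det_involution:
  assumes "A ** A = (mat 1 :: real ^ 'n::finite ^ 'n)" shows "\<bar>det A\<bar> = 1"
proof -
  have "(det A)\<^sup>2 = 1" using arg_cong[OF assms, of det] by (simp add: det_mul power2_eq_square)
  then show ?thesis by (auto simp: power2_eq_1_iff)
qed

abbreviation kernel_mat :: "real \<Rightarrow> real ^ ('d::finite + 'd) ^ ('d + 'd)" where
  "kernel_mat \<tau> \<equiv> block (mat (1 - \<tau>)) (mat \<tau>) (mat 1) (- mat 1)"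

lemma kernel_mat_inverse:
  "block (mat 1) (mat \<tau>) (mat 1) (mat (\<tau> - 1)) ** kernel_mat \<tau> = mat 1"
  "kernel_mat \<tau> ** block (mat 1) (mat \<tau>) (mat 1) (mat (\<tau> - 1)) = mat 1"
  unfolding matrix_eq
  by (simp_all add: matrix_vector_mul_assoc[symmetric] block_apply mat_scaleR join_eq_iff algebra_simps)

lemma invertible_kernel_mat: "invertible (kernel_mat \<tau>)"
  unfolding invertible_def using kernel_mat_inverse by blast

lemma matrix_inv_kernel_mat: "matrix_inv (kernel_mat \<tau>) = block (mat 1) (mat \<tau>) (mat 1) (mat (\<tau> - 1))"
proof -
  interpret B: lattice "kernel_mat \<tau> :: real ^ ('a + 'a) ^ ('a + 'a)"
    by unfold_locales (rule invertible_kernel_mat)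
  have "matrix_inv (kernel_mat \<tau> :: real ^ ('a + 'a) ^ ('a + 'a)) =
      (matrix_inv (kernel_mat \<tau>) ** kernel_mat \<tau>) ** block (mat 1) (mat \<tau>) (mat 1) (mat (\<tau> - 1))"
    unfolding matrix_mul_assoc[symmetric] kernel_mat_inverse(2) by simp
  then show ?thesis unfolding B.inv_L(1) by simp
qed

text \<open>
  The map \<open>(x, y) \<mapsto> ((1 - \<tau>) x + \<tau> y, x - y)\<close> is a product of three involutions, each of which has
  determinant 1 or - 1.
\<close>

lemma abs_det_kernel_mat: "\<bar>det (kernel_mat \<tau> :: real ^ ('d::finite + 'd) ^ ('d + 'd))\<bar> = 1"
proof -
  let ?D = "block (mat 1) 0 0 (- mat 1) :: real ^ ('d + 'd) ^ ('d + 'd)"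
  let ?M = "block (mat 1) (mat (- \<tau>)) 0 (- mat 1) :: real ^ ('d + 'd) ^ ('d + 'd)"
  let ?E = "block (mat 1) 0 (mat 1) (- mat 1) :: real ^ ('d + 'd) ^ ('d + 'd)"
  have "?D ** ?D = mat 1" "?M ** ?M = mat 1" "?E ** ?E = mat 1"
    unfolding matrix_eq
    by (simp_all add: matrix_vector_mul_assoc[symmetric] block_apply mat_scaleR join_eq_iff algebra_simps)
  note dets = this[THEN abs_det_involution]
  have "kernel_mat \<tau> = (?D ** ?M) ** ?E"
    unfolding matrix_eq
    by (simp add: matrix_vector_mul_assoc[symmetric] block_apply mat_scaleR join_eq_iff algebra_simps)
  then show ?thesis by (simp add: det_mul abs_mult dets)
qed

lemma symplectic_mat_apply: "symplectic_mat *v z = join (- vsnd z) (vfst z)"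
  by (simp add: symplectic_mat_def block_apply)

lemma tf_shift_schwartz_dist:
  assumes "f \<in> schwartz" "\<phi> \<in> schwartz"
  shows "tf_shift (symplectic_mat *v z) (schwartz_dist f) \<phi> =
    (\<integral>x. cis (2 * pi * (vfst z \<bullet> x)) * \<phi> x * f (vsnd z + x) \<partial>lborel)"
proof -
  let ?a = "vfst z" and ?b = "vsnd z"
  let ?\<psi> = "\<lambda>t. cis (2 * pi * (?a \<bullet> (t + - ?b))) * \<phi> (t + - ?b)"
  have \<psi>: "?\<psi> \<in> schwartz"
    using schwartz_translation[OF schwartz_modulation[OF assms(2), of ?a], of "- ?b"] by simp
  have m: "(\<lambda>t. f t * ?\<psi> t) \<in> borel_measurable borel"
    by (intro smooth_measurable smooth_mult schwartz_smooth assms(1) \<psi>)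
  have "tf_shift (symplectic_mat *v z) (schwartz_dist f) \<phi> = schwartz_dist f ?\<psi>"
    by (simp add: tf_shift_def symplectic_mat_apply modulation_dist_def translation_dist_def
        translation_def modulation_def)
  also have "\<dots> = (\<integral>t. f t * ?\<psi> t \<partial>lborel)" using \<psi> by (simp add: schwartz_dist_def)
  also have "\<dots> = (\<integral>x. f (?b + x) * ?\<psi> (?b + x) \<partial>lborel)"
    by (rule integral_lborel_shift[OF m, symmetric])
  finally show ?thesis by (simp add: mult_ac)
qed

text \<open>
  The integral over the frequency variable is a Fourier inversion at the point \<open>- vsnd \<zeta>\<close>.
\<close>

lemma integral_cis_partial_inv_fourier:
  fixes F :: "real ^ ('d::finite + 'd) \<Rightarrow> complex"
  assumes F: "F \<in> schwartz"
  shows "(\<integral>z. cis (2 * pi * (\<zeta> \<bullet> z)) * partial_inv_fourier F z \<partial>lborel) =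
    (\<integral>s. cis (2 * pi * (vfst \<zeta> \<bullet> s)) * F (join s (- vsnd \<zeta>)) \<partial>lborel)"
proof -
  have \<Phi>: "partial_inv_fourier F \<in> schwartz" by (rule schwartz_partial_inv_fourier[OF F])
  have inv: "(\<integral>w. cis (2 * pi * (vsnd \<zeta> \<bullet> w)) * partial_inv_fourier F (join s w) \<partial>lborel) = F (join s (- vsnd \<zeta>))" for s
  proof -
    have eq: "partial_inv_fourier F (join s w) = (\<integral>y. cis (2 * pi * (y \<bullet> w)) * F (join s y) \<partial>lborel)" for w
      by (simp add: partial_inv_fourier_def)
    have S: "(\<lambda>y. F (join s y)) \<in> schwartz" by (rule schwartz_section[OF F])
    obtain M where M: "\<And>y. cmod (F (join s y)) \<le> M" using schwartz_bounded[OF S] by blast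
    have "integrable lborel (\<lambda>w. \<integral>y. cis (2 * pi * (y \<bullet> w)) * F (join s y) \<partial>lborel)"
      using schwartz_integrable[OF schwartz_section[OF \<Phi>, of s]] unfolding eq .
    from fourier_inversion[OF schwartz_integrable[OF S] smooth_continuous[OF schwartz_smooth[OF S]] M this]
    show ?thesis unfolding eq .
  qed
  have "(\<integral>z. cis (2 * pi * (\<zeta> \<bullet> z)) * partial_inv_fourier F z \<partial>lborel) =
      (\<integral>s. \<integral>w. cis (2 * pi * (\<zeta> \<bullet> join s w)) * partial_inv_fourier F (join s w) \<partial>lborel \<partial>lborel)"
    by (rule integral_join) (intro schwartz_integrable schwartz_modulation \<Phi>)
  also have "\<dots> = (\<integral>s. \<integral>w. cis (2 * pi * (vfst \<zeta> \<bullet> s)) *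
      (cis (2 * pi * (vsnd \<zeta> \<bullet> w)) * partial_inv_fourier F (join s w)) \<partial>lborel \<partial>lborel)"
    by (simp only: inner_join distrib_left cis_mult[symmetric] mult.assoc)
  also have "\<dots> = (\<integral>s. cis (2 * pi * (vfst \<zeta> \<bullet> s)) * F (join s (- vsnd \<zeta>)) \<partial>lborel)"
    by (simp only: integral_mult_right_zero inv)
  finally show ?thesis .
qed

text \<open>
  By Fourier inversion in the frequency variable, the symbol \<open>exp (2 \<pi> i \<langle>\<zeta>, \<cdot>\<rangle>)\<close> gives a
  time-frequency shift by \<open>J \<zeta>\<close> up to a factor of modulus 1, and the operator with periodic symbol is a
  superposition of these.
\<close>

lemma Op_series:
  fixes L :: "real ^ ('d::finite + 'd) ^ ('d + 'd)"
  assumes L: "invertible L" and f: "f \<in> schwartz" and \<phi>: "\<phi> \<in> schwartz"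
  defines "\<zeta> \<equiv> \<lambda>\<kappa>. inv_transpose L *v int_vec \<kappa>"
  shows "Op \<tau> (lattice.series L c) f \<phi> =
    (\<Sum>\<^sub>\<infinity>\<kappa>. c \<kappa> * cis (2 * pi * (\<tau> * (vfst (\<zeta> \<kappa>) \<bullet> vsnd (\<zeta> \<kappa>)))) *
      tf_shift (symplectic_mat *v \<zeta> \<kappa>) (schwartz_dist f) \<phi>)"
proof -
  interpret lattice L by unfold_locales (rule L)
  have \<zeta>: "dual \<kappa> = \<zeta> \<kappa>" for \<kappa> by (simp add: dual_def \<zeta>_def)
  let ?B' = "block (mat 1) (mat \<tau>) (mat 1) (mat (\<tau> - 1)) :: real ^ ('d + 'd) ^ ('d + 'd)"
  define F where "F z = \<phi> (vfst (?B' *v z)) * f (vsnd (?B' *v z))" for z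
  have F: "F \<in> schwartz"
    using schwartz_affine[OF schwartz_tensor[OF \<phi> f] kernel_mat_inverse(2)[of \<tau>], of 0]
    unfolding F_def[abs_def] by simp
  have F_join: "F (join s t) = \<phi> (s + \<tau> *\<^sub>R t) * f (s + (\<tau> - 1) *\<^sub>R t)" for s t
    by (simp add: F_def block_apply mat_scaleR)
  have "Op \<tau> (series c) f \<phi> = series c (partial_inv_fourier F)"
    using \<phi> F unfolding Op_def op_kernel_def compose_dist_def matrix_inv_kernel_mat abs_det_kernel_mat
      partial_inv_fourier_dist_def F_def[symmetric, abs_def] by simp
  also have "\<dots> = (\<Sum>\<^sub>\<infinity>\<kappa>. c \<kappa> * (\<integral>z. chr \<kappa> z * partial_inv_fourier F z \<partial>lborel))"
    using schwartz_partial_inv_fourier[OF F] by (simp add: series_def)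
  also have "\<dots> = (\<Sum>\<^sub>\<infinity>\<kappa>. c \<kappa> * cis (2 * pi * (\<tau> * (vfst (\<zeta> \<kappa>) \<bullet> vsnd (\<zeta> \<kappa>)))) *
      tf_shift (symplectic_mat *v \<zeta> \<kappa>) (schwartz_dist f) \<phi>)"
  proof (rule infsum_cong)
    fix \<kappa>
    let ?a = "vfst (\<zeta> \<kappa>)" and ?b = "vsnd (\<zeta> \<kappa>)"
    let ?g = "\<lambda>s. cis (2 * pi * (?a \<bullet> s)) * F (join s (- ?b))"
    have F_shift: "F (join (\<tau> *\<^sub>R ?b + x) (- ?b)) = \<phi> x * f (?b + x)" for x
      by (simp add: F_join scaleR_diff_left algebra_simps)
    have "smooth (\<lambda>s. F (join s (- ?b)))"
      unfolding F_join
      using smooth_translation[OF schwartz_smooth[OF \<phi>], of "\<tau> *\<^sub>R - ?b"]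
        smooth_translation[OF schwartz_smooth[OF f], of "(\<tau> - 1) *\<^sub>R - ?b"]
      by (rule smooth_mult)
    then have m: "?g \<in> borel_measurable borel" by (intro smooth_measurable smooth_mult smooth_cis)
    have "(\<integral>z. chr \<kappa> z * partial_inv_fourier F z \<partial>lborel) = (\<integral>s. ?g s \<partial>lborel)"
      unfolding chr_def \<zeta> by (rule integral_cis_partial_inv_fourier[OF F])
    also have "\<dots> = (\<integral>x. ?g (\<tau> *\<^sub>R ?b + x) \<partial>lborel)"
      by (rule integral_lborel_shift[OF m, symmetric])
    also have "\<dots> = (\<integral>x. cis (2 * pi * (\<tau> * (?a \<bullet> ?b))) * (cis (2 * pi * (?a \<bullet> x)) * \<phi> x * f (?b + x)) \<partial>lborel)"
      unfolding F_shift by (simp add: inner_add_right distrib_left cis_mult[symmetric] mult_ac)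
    also have "\<dots> = cis (2 * pi * (\<tau> * (?a \<bullet> ?b))) * tf_shift (symplectic_mat *v \<zeta> \<kappa>) (schwartz_dist f) \<phi>"
      by (simp only: integral_mult_right_zero tf_shift_schwartz_dist[OF f \<phi>])
    finally show "c \<kappa> * (\<integral>z. chr \<kappa> z * partial_inv_fourier F z \<partial>lborel) =
        c \<kappa> * cis (2 * pi * (\<tau> * (?a \<bullet> ?b))) * tf_shift (symplectic_mat *v \<zeta> \<kappa>) (schwartz_dist f) \<phi>"
      by (simp add: mult.assoc)
  qed
  finally show ?thesis .
qed

section \<open>Absolutely convergent series of time-frequency shifts\<close>

locale function_banach =
  fixes X :: "('a \<Rightarrow> complex) set" and nrm :: "('a \<Rightarrow> complex) \<Rightarrow> real"
  assumes banach: "complex_banach X nrm"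
begin

lemma zero_mem: "(\<lambda>_. 0) \<in> X"
  and add_mem: "u \<in> X \<Longrightarrow> w \<in> X \<Longrightarrow> (\<lambda>\<phi>. u \<phi> + w \<phi>) \<in> X"
  and cmult_mem: "u \<in> X \<Longrightarrow> (\<lambda>\<phi>. a * u \<phi>) \<in> X"
  and nrm_nonneg: "u \<in> X \<Longrightarrow> 0 \<le> nrm u"
  and nrm_eq_0: "u \<in> X \<Longrightarrow> nrm u = 0 \<longleftrightarrow> u = (\<lambda>_. 0)"
  and nrm_add: "u \<in> X \<Longrightarrow> w \<in> X \<Longrightarrow> nrm (\<lambda>\<phi>. u \<phi> + w \<phi>) \<le> nrm u + nrm w"
  and nrm_cmult: "u \<in> X \<Longrightarrow> nrm (\<lambda>\<phi>. a * u \<phi>) = cmod a * nrm u"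
  and complete: "Metric_space.mcomplete X (norm_dist X nrm)"
  using banach unfolding complex_banach_def by blast+

lemma nrm_zero: "nrm (\<lambda>_. 0) = 0"
  using nrm_eq_0[OF zero_mem] by simp

lemma diff_mem: "u \<in> X \<Longrightarrow> w \<in> X \<Longrightarrow> (\<lambda>\<phi>. u \<phi> - w \<phi>) \<in> X"
  using add_mem[OF _ cmult_mem[of w "- 1"], of u] by simp

lemma nrm_minus_commute: "u \<in> X \<Longrightarrow> w \<in> X \<Longrightarrow> nrm (\<lambda>\<phi>. u \<phi> - w \<phi>) = nrm (\<lambda>\<phi>. w \<phi> - u \<phi>)"
  using nrm_cmult[OF diff_mem[of w u], of "- 1"] by simp

lemma nrm_diff: "u \<in> X \<Longrightarrow> w \<in> X \<Longrightarrow> nrm (\<lambda>\<phi>. u \<phi> - w \<phi>) \<le> nrm u + nrm w"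
  using nrm_add[OF _ cmult_mem[of w "- 1"], of u] nrm_cmult[of w "- 1"] by simp

lemma sum_mem: "(\<And>i. i \<in> I \<Longrightarrow> u i \<in> X) \<Longrightarrow> (\<lambda>\<phi>. \<Sum>i\<in>I. u i \<phi>) \<in> X"
  by (induction I rule: infinite_finite_induct) (auto intro: zero_mem add_mem)

lemma nrm_sum: "(\<And>i. i \<in> I \<Longrightarrow> u i \<in> X) \<Longrightarrow> nrm (\<lambda>\<phi>. \<Sum>i\<in>I. u i \<phi>) \<le> (\<Sum>i\<in>I. nrm (u i))"
proof (induction I rule: infinite_finite_induct)
  case (insert i I)
  have "nrm (\<lambda>\<phi>. u i \<phi> + (\<Sum>i\<in>I. u i \<phi>)) \<le> nrm (u i) + nrm (\<lambda>\<phi>. \<Sum>i\<in>I. u i \<phi>)"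
    using insert.prems by (intro nrm_add sum_mem) auto
  then show ?case using insert by simp
qed (simp_all add: nrm_zero)

sublocale Metric_space X "norm_dist X nrm"
proof
  show "0 \<le> norm_dist X nrm u w" for u w by (simp add: norm_dist_def nrm_nonneg diff_mem)
  show "norm_dist X nrm u w = norm_dist X nrm w u" for u w
    using nrm_minus_commute[of u w] by (auto simp: norm_dist_def)
  show "(norm_dist X nrm u w = 0) = (u = w)" if "u \<in> X" "w \<in> X" for u w
    using that nrm_eq_0[OF diff_mem[OF that]] by (auto simp: norm_dist_def fun_eq_iff)
  show "norm_dist X nrm u z \<le> norm_dist X nrm u w + norm_dist X nrm w z"
    if "u \<in> X" "w \<in> X" "z \<in> X" for u w z
    using that nrm_add[OF diff_mem[of u w] diff_mem[of w z]] by (simp add: norm_dist_def)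
qed

text \<open>
  The partial sums form a Cauchy sequence because the tails of the series of norms are small, and their norm
  bound passes to the limit.
\<close>

lemma absolutely_convergent_series:
  assumes u: "\<And>j. u j \<in> X" and sum: "summable (\<lambda>j. nrm (u j))"
  obtains w where "limitin mtopology (\<lambda>n \<phi>. \<Sum>j<n. u j \<phi>) w sequentially"
    and "nrm w \<le> (\<Sum>j. nrm (u j))"
proof -
  define s where "s n = (\<lambda>\<phi>. \<Sum>j<n. u j \<phi>)" for n :: nat
  have s: "s n \<in> X" for n unfolding s_def by (rule sum_mem) (rule u)
  have tail: "norm_dist X nrm (s m) (s n) \<le> (\<Sum>j\<in>{m..<n}. nrm (u j))" if "m \<le> n" for m n
  proof -
    have "norm_dist X nrm (s m) (s n) = nrm (\<lambda>\<phi>. s n \<phi> - s m \<phi>)"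
      using nrm_minus_commute[OF s s, of m n] by (simp add: norm_dist_def s)
    also have "(\<lambda>\<phi>. s n \<phi> - s m \<phi>) = (\<lambda>\<phi>. \<Sum>j\<in>{m..<n}. u j \<phi>)"
      unfolding s_def lessThan_atLeast0 by (rule ext) (rule sum_diff_nat_ivl[OF le0 that])
    also have "nrm \<dots> \<le> (\<Sum>j\<in>{m..<n}. nrm (u j))" by (rule nrm_sum) (rule u)
    finally show ?thesis .
  qed
  have "MCauchy s"
    unfolding MCauchy_def
  proof (intro conjI allI impI)
    show "range s \<subseteq> X" using s by blast
    fix e :: real
    assume "0 < e"
    then obtain N where N: "\<And>m n. N \<le> m \<Longrightarrow> norm (\<Sum>j\<in>{m..<n}. nrm (u j)) < e"
      using sum unfolding summable_Cauchy by blast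
    have le: "norm_dist X nrm (s m) (s n) < e" if "N \<le> m" "m \<le> n" for m n
    proof -
      have "\<bar>\<Sum>j\<in>{m..<n}. nrm (u j)\<bar> < e" using N[OF that(1), of n] by (simp only: real_norm_def)
      then show ?thesis
        by (rule order_le_less_trans[OF order_trans[OF tail[OF that(2)] abs_ge_self]])
    qed
    have "norm_dist X nrm (s m) (s n) < e" if "N \<le> m" "N \<le> n" for m n
      using le[of m n] le[of n m] that commute[of "s m" "s n"] by (cases "m \<le> n") auto
    then show "\<exists>N. \<forall>n n'. N \<le> n \<longrightarrow> N \<le> n' \<longrightarrow> norm_dist X nrm (s n) (s n') < e" by blast
  qed
  then obtain w where w: "limitin mtopology s w sequentially"
    using complete unfolding mcomplete_def by blast
  have "nrm w \<le> (\<Sum>j. nrm (u j))"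
  proof (rule field_le_epsilon)
    fix e :: real
    assume "0 < e"
    then obtain n where n: "w \<in> X" "norm_dist X nrm (s n) w < e"
      using w unfolding limit_metric_sequentially by blast
    have "nrm w \<le> nrm (s n) + nrm (\<lambda>\<phi>. w \<phi> - s n \<phi>)"
      using nrm_add[OF s[of n] diff_mem[OF n(1) s[of n]]] by simp
    also have "nrm (\<lambda>\<phi>. w \<phi> - s n \<phi>) = norm_dist X nrm (s n) w"
      using nrm_minus_commute[OF n(1) s[of n]] by (simp add: norm_dist_def s n)
    also have "nrm (s n) \<le> (\<Sum>j<n. nrm (u j))" unfolding s_def by (rule nrm_sum) (rule u)
    also have "(\<Sum>j<n. nrm (u j)) \<le> (\<Sum>j. nrm (u j))"
      by (rule sum_le_suminf[OF sum]) (auto simp: nrm_nonneg u)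
    finally show "nrm w \<le> (\<Sum>j. nrm (u j)) + e" using n(2) by simp
  qed
  with w that show ?thesis unfolding s_def by blast
qed

text \<open>
  The difference of the operators is bounded and vanishes on \<open>S\<close>, so its value at \<open>u\<close> is at most a constant
  times the distance of \<open>u\<close> from \<open>S\<close>.
\<close>

lemma bounded_operators_unique:
  assumes A: "A \<in> bounded_operators X nrm" and A': "A' \<in> bounded_operators X nrm"
    and dense: "mtopology closure_of S = X" and S: "S \<subseteq> X" and eq: "\<And>u. u \<in> S \<Longrightarrow> A u = A' u"
  shows "A = A'"
proof -
  have AX: "A \<in> X \<rightarrow>\<^sub>E X" "A' \<in> X \<rightarrow>\<^sub>E X" using A A' by (auto simp: bounded_operators_def)
  have lin: "T (\<lambda>\<phi>. u \<phi> - w \<phi>) = (\<lambda>\<phi>. T u \<phi> - T w \<phi>)"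
    if "T \<in> bounded_operators X nrm" "u \<in> X" "w \<in> X" for T u w
  proof -
    have "T (\<lambda>\<phi>. 1 * u \<phi> + - 1 * w \<phi>) = (\<lambda>\<phi>. 1 * T u \<phi> + - 1 * T w \<phi>)"
      using that unfolding bounded_operators_def by blast
    then show ?thesis by simp
  qed
  have bound: "\<exists>B. \<forall>u\<in>X. nrm (T u) \<le> B * nrm u" if "T \<in> bounded_operators X nrm" for T
    using that unfolding bounded_operators_def by blast
  obtain B B' where B: "\<And>u. u \<in> X \<Longrightarrow> nrm (A u) \<le> B * nrm u" "\<And>u. u \<in> X \<Longrightarrow> nrm (A' u) \<le> B' * nrm u"
    using bound[OF A] bound[OF A'] by blast
  have "A u = A' u" if u: "u \<in> X" for u
  proof -
    have AuX: "A u \<in> X" "A' u \<in> X" using AX u by auto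
    let ?d = "\<lambda>\<phi>. A u \<phi> - A' u \<phi>"
    have "nrm ?d \<le> 0"
    proof (rule field_le_epsilon)
      fix e :: real
      assume e: "0 < e"
      let ?r = "e / (\<bar>B\<bar> + \<bar>B'\<bar> + 1)"
      have r: "0 < ?r" using e by (simp add: add_nonneg_pos)
      have "u \<in> mtopology closure_of S" using u dense by simp
      then obtain y where y: "y \<in> S" "y \<in> mball u ?r"
        using r unfolding metric_closure_of by blast
      then have yX: "y \<in> X" "nrm (\<lambda>\<phi>. u \<phi> - y \<phi>) < ?r" using u S by (auto simp: norm_dist_def)
      let ?h = "\<lambda>\<phi>. u \<phi> - y \<phi>"
      have h: "?h \<in> X" by (rule diff_mem[OF u yX(1)])
      have hX: "A ?h \<in> X" "A' ?h \<in> X" using AX h by auto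
      have "?d = (\<lambda>\<phi>. A ?h \<phi> - A' ?h \<phi>)"
        by (simp add: lin[OF A u yX(1)] lin[OF A' u yX(1)] eq[OF y(1)])
      then have "nrm ?d \<le> nrm (A ?h) + nrm (A' ?h)" using nrm_diff[OF hX] by simp
      also have "\<dots> \<le> \<bar>B\<bar> * nrm ?h + \<bar>B'\<bar> * nrm ?h"
        using nrm_nonneg[OF h]
        by (intro add_mono order_trans[OF B(1)[OF h]] order_trans[OF B(2)[OF h]] mult_right_mono) auto
      also have "\<dots> \<le> (\<bar>B\<bar> + \<bar>B'\<bar> + 1) * nrm ?h" using nrm_nonneg[OF h] by (simp add: algebra_simps)
      also have "\<dots> \<le> (\<bar>B\<bar> + \<bar>B'\<bar> + 1) * ?r" using yX(2) by (intro mult_left_mono) auto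
      also have "\<dots> = e" by (simp add: add_nonneg_pos less_imp_neq[symmetric])
      finally show "nrm ?d \<le> 0 + e" by simp
    qed
    then have "nrm ?d = 0" using nrm_nonneg[OF diff_mem[OF AuX]] by simp
    then have "?d = (\<lambda>_. 0)" using nrm_eq_0[OF diff_mem[OF AuX]] by simp
    then show ?thesis by (simp add: fun_eq_iff)
  qed
  then show ?thesis using AX by (intro PiE_ext[of A X "\<lambda>_. X" A']) auto
qed

end

lemma int_vec_enumeration: "\<exists>e :: nat \<Rightarrow> int ^ 'n::finite. bij e"
proof -
  have "infinite (UNIV :: (int ^ 'n) set)"
  proof
    assume "finite (UNIV :: (int ^ 'n) set)"
    then have "finite (range (\<lambda>k :: int. \<chi> i :: 'n. k))" by (rule finite_subset[rotated]) simp
    moreover have "inj (\<lambda>k :: int. \<chi> i :: 'n. k)" by (auto simp: inj_on_def vec_eq_iff)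
    ultimately show False using finite_imageD infinite_UNIV_int by blast
  qed
  then show ?thesis
    using bij_betw_from_nat_into[of "UNIV :: (int ^ 'n) set"] by auto
qed

lemma polynomial_weight_ge_1: "polynomial_weight v \<Longrightarrow> 1 \<le> v z"
  unfolding polynomial_weight_def by (auto intro!: ge_one_powr_ge_zero)

lemma norm_limit_pointwise:
  fixes X :: "'d::finite functional set"
  assumes cont: "continuous_map (norm_topology X nrm) tempered_topology (\<lambda>u. u)"
    and lim: "limitin (norm_topology X nrm) s w sequentially"
  shows "(\<lambda>n. s n \<phi>) \<longlonglongrightarrow> w \<phi>"
proof -
  have "limitin tempered_topology s w sequentially"
    using continuous_map_limit[OF cont lim] by (simp add: o_def)
  then have "s \<longlonglongrightarrow> w" by (simp add: tempered_topology_def limitin_subtopology)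
  then show ?thesis
    using continuous_on_tendsto_compose[OF continuous_on_product_coordinates[of \<phi>], of s w sequentially]
    by simp
qed

text \<open>
  The weighted summability makes \<open>\<Sum> b \<kappa> \<pi> (z \<kappa>) u\<close> absolutely convergent in \<open>X\<close>. The value of the
  series as a functional can be computed pointwise, since convergence in \<open>X\<close> implies that of tempered
  distributions.
\<close>

lemma shift_series_converges:
  fixes X :: "'d::finite functional set" and z :: "int ^ 'm::finite \<Rightarrow> real ^ ('d + 'd)"
  assumes X: "complex_banach X nrm"
    and cont: "continuous_map (norm_topology X nrm) tempered_topology (\<lambda>u. u)"
    and v: "polynomial_weight v" and C: "C > 0" and shift: "tf_shift_bound X nrm v C"
    and sum: "(\<lambda>\<kappa>. v (z \<kappa>) * cmod (b \<kappa>)) summable_on UNIV"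
    and e: "bij e" and u: "u \<in> X"
  shows "\<exists>w\<in>X. (\<forall>\<phi>. (\<lambda>n. \<Sum>j<n. b (e j) * tf_shift (z (e j)) u \<phi>) \<longlonglongrightarrow> w \<phi>) \<and>
    nrm w \<le> C * (\<Sum>\<^sub>\<infinity>\<kappa>. v (z \<kappa>) * cmod (b \<kappa>)) * nrm u"
proof -
  interpret function_banach X nrm by unfold_locales (rule X)
  let ?S = "\<Sum>\<^sub>\<infinity>\<kappa>. v (z \<kappa>) * cmod (b \<kappa>)"
  let ?u = "\<lambda>j \<phi>. b (e j) * tf_shift (z (e j)) u \<phi>"
  have shiftX: "tf_shift y u \<in> X" "nrm (tf_shift y u) \<le> C * v y * nrm u" for y
    using shift u by (auto simp: tf_shift_bound_def)
  have mem: "?u j \<in> X" for j by (rule cmult_mem[OF shiftX(1)])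
  have le: "nrm (?u j) \<le> C * nrm u * (v (z (e j)) * cmod (b (e j)))" for j
  proof -
    have "nrm (?u j) = cmod (b (e j)) * nrm (tf_shift (z (e j)) u)" by (rule nrm_cmult[OF shiftX(1)])
    also have "\<dots> \<le> cmod (b (e j)) * (C * v (z (e j)) * nrm u)" by (intro mult_left_mono shiftX(2)) simp
    finally show ?thesis by (simp add: mult_ac)
  qed
  have "((\<lambda>\<kappa>. v (z \<kappa>) * cmod (b \<kappa>)) has_sum ?S) UNIV" using sum by (rule has_sum_infsum)
  then have "((\<lambda>j. v (z (e j)) * cmod (b (e j))) has_sum ?S) UNIV"
    using has_sum_reindex_bij_betw[OF e, of "\<lambda>\<kappa>. v (z \<kappa>) * cmod (b \<kappa>)" ?S] by simp
  then have sums: "(\<lambda>j. v (z (e j)) * cmod (b (e j))) sums ?S" by (rule has_sum_imp_sums)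
  then have sums': "(\<lambda>j. C * nrm u * (v (z (e j)) * cmod (b (e j)))) sums (C * nrm u * ?S)"
    by (rule sums_mult)
  have summable: "summable (\<lambda>j. nrm (?u j))"
    by (rule summable_comparison_test'[OF sums_summable[OF sums'], of 0]) (simp add: le nrm_nonneg mem)
  obtain w where w: "limitin mtopology (\<lambda>n \<phi>. \<Sum>j<n. ?u j \<phi>) w sequentially"
      "nrm w \<le> (\<Sum>j. nrm (?u j))"
    by (rule absolutely_convergent_series[OF mem summable])
  have "(\<Sum>j. nrm (?u j)) \<le> (\<Sum>j. C * nrm u * (v (z (e j)) * cmod (b (e j))))"
    by (rule suminf_le[OF le summable sums_summable[OF sums']])
  then have "nrm w \<le> C * ?S * nrm u"
    using w(2) sums_unique[OF sums'] by (simp add: mult_ac)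
  moreover have "w \<in> X" using w(1) by (simp add: limitin_metric)
  moreover have "(\<lambda>n. \<Sum>j<n. ?u j \<phi>) \<longlonglongrightarrow> w \<phi>" for \<phi>
    using norm_limit_pointwise[OF cont, of "\<lambda>n \<phi>. \<Sum>j<n. ?u j \<phi>" w \<phi>] w(1)
    by (simp add: norm_topology_def)
  ultimately show ?thesis by blast
qed

theorem theorem4p1:
  fixes X :: "'d::finite functional set"
    and nrm :: "'d functional \<Rightarrow> real"
    and v :: "real ^ ('d + 'd) \<Rightarrow> real"
    and C \<tau> :: real
    and L :: "real ^ ('d + 'd) ^ ('d + 'd)"
    and p :: "('d + 'd) functional"
  assumes "tfs_invariant_space X nrm"
    and "polynomial_weight v" and "C > 0" and "tf_shift_bound X nrm v C"
    and "invertible L"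
    and "p \<in> periodic_distributions L"
    and "(\<lambda>\<kappa>. v (symplectic_mat *v (inv_transpose L *v int_vec \<kappa>)) * cmod (fourier_coeff L p \<kappa>))
           summable_on UNIV"
    and "0 \<le> \<tau>" and "\<tau> \<le> 1"
  shows "bounded_on X nrm (Op \<tau> (tempered_ext p)) \<and>
    operator_norm X nrm (extension_to X nrm (Op \<tau> (tempered_ext p)))
      \<le> C * (\<Sum>\<^sub>\<infinity>\<kappa>. v (symplectic_mat *v (inv_transpose L *v int_vec \<kappa>)) * cmod (fourier_coeff L p \<kappa>))"
proof -
  have X: "complex_banach X nrm" and temp: "X \<subseteq> tempered"
    and contS: "continuous_map schwartz_topology (norm_topology X nrm) schwartz_dist"
    and cont: "continuous_map (norm_topology X nrm) tempered_topology (\<lambda>u. u)"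
    and dense: "norm_topology X nrm closure_of (schwartz_dist ` schwartz) = X"
    using assms(1) by (auto simp: tfs_invariant_space_def)
  interpret function_banach X nrm by unfold_locales (rule X)
  interpret lattice L by unfold_locales (rule assms(5))
  define \<zeta> where "\<zeta> \<kappa> = inv_transpose L *v int_vec \<kappa>" for \<kappa>
  define c where "c = fourier_coeff L p"
  define z where "z \<kappa> = symplectic_mat *v \<zeta> \<kappa>" for \<kappa>
  define b where "b \<kappa> = c \<kappa> * cis (2 * pi * (\<tau> * (vfst (\<zeta> \<kappa>) \<bullet> vsnd (\<zeta> \<kappa>))))" for \<kappa>
  let ?S = "\<Sum>\<^sub>\<infinity>\<kappa>. v (z \<kappa>) * cmod (c \<kappa>)"
  let ?T = "Op \<tau> (tempered_ext p)"
  have cmod_b: "cmod (b \<kappa>) = cmod (c \<kappa>)" for \<kappa> by (simp add: b_def norm_mult)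
  have sum: "(\<lambda>\<kappa>. v (z \<kappa>) * cmod (c \<kappa>)) summable_on UNIV"
    using assms(7) by (simp add: z_def \<zeta>_def c_def)
  have v1: "1 \<le> v y" for y by (rule polynomial_weight_ge_1[OF assms(2)])
  have sum_c: "(\<lambda>\<kappa>. cmod (c \<kappa>)) summable_on UNIV"
  proof (rule summable_on_comparison_test[OF sum])
    show "cmod (c \<kappa>) \<le> v (z \<kappa>) * cmod (c \<kappa>)" for \<kappa>
      using mult_right_mono[OF v1[of "z \<kappa>"], of "cmod (c \<kappa>)"] by simp
  qed simp
  obtain e :: "nat \<Rightarrow> int ^ ('d + 'd)" where e: "bij e" using int_vec_enumeration by blast
  have S0: "0 \<le> ?S" by (intro infsum_nonneg mult_nonneg_nonneg norm_ge_zero order_trans[OF zero_le_one v1])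
  \<comment> \<open>The extension is given on all of \<open>X\<close> by the series of shifts, in some enumeration of the lattice.\<close>
  have "\<forall>u\<in>X. \<exists>w. w \<in> X \<and> (\<forall>\<phi>. (\<lambda>n. \<Sum>j<n. b (e j) * tf_shift (z (e j)) u \<phi>) \<longlonglongrightarrow> w \<phi>) \<and>
      nrm w \<le> C * ?S * nrm u"
  proof
    fix u
    assume "u \<in> X"
    from shift_series_converges[OF X cont assms(2-4) _ e this, of z b]
    show "\<exists>w. w \<in> X \<and> (\<forall>\<phi>. (\<lambda>n. \<Sum>j<n. b (e j) * tf_shift (z (e j)) u \<phi>) \<longlonglongrightarrow> w \<phi>) \<and>
        nrm w \<le> C * ?S * nrm u"
      using sum unfolding cmod_b Bex_def by simp
  qed
  from bchoice[OF this] obtain A0 where "\<forall>u\<in>X. A0 u \<in> X \<and>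
      (\<forall>\<phi>. (\<lambda>n. \<Sum>j<n. b (e j) * tf_shift (z (e j)) u \<phi>) \<longlonglongrightarrow> A0 u \<phi>) \<and> nrm (A0 u) \<le> C * ?S * nrm u" ..
  then have A0: "u \<in> X \<Longrightarrow> A0 u \<in> X"
    "u \<in> X \<Longrightarrow> (\<lambda>n. \<Sum>j<n. b (e j) * tf_shift (z (e j)) u \<phi>) \<longlonglongrightarrow> A0 u \<phi>"
    "u \<in> X \<Longrightarrow> nrm (A0 u) \<le> C * ?S * nrm u" for u \<phi>
    by simp_all
  define A where "A = restrict A0 X"
  have A_bounded: "A \<in> bounded_operators X nrm"
    unfolding bounded_operators_def
  proof (intro CollectI conjI ballI allI)
    show "A \<in> X \<rightarrow>\<^sub>E X" unfolding A_def using A0(1) by auto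
    show "\<exists>B. \<forall>u\<in>X. nrm (A u) \<le> B * nrm u" unfolding A_def using A0(3) by auto
    fix u w a a'
    assume u: "u \<in> X" and w: "w \<in> X"
    let ?h = "\<lambda>\<phi>. a * u \<phi> + a' * w \<phi>"
    have h: "?h \<in> X" by (intro add_mem cmult_mem u w)
    have "A0 ?h \<phi> = a * A0 u \<phi> + a' * A0 w \<phi>" for \<phi>
    proof (rule LIMSEQ_unique[OF A0(2)[OF h]])
      have "(\<Sum>j<n. b (e j) * tf_shift (z (e j)) ?h \<phi>) =
          a * (\<Sum>j<n. b (e j) * tf_shift (z (e j)) u \<phi>) + a' * (\<Sum>j<n. b (e j) * tf_shift (z (e j)) w \<phi>)" for n
        by (simp add: tf_shift_def modulation_dist_def translation_dist_def sum_distrib_left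
            sum.distrib[symmetric] algebra_simps)
      then show "(\<lambda>n. \<Sum>j<n. b (e j) * tf_shift (z (e j)) ?h \<phi>) \<longlonglongrightarrow> a * A0 u \<phi> + a' * A0 w \<phi>"
        using A0(2)[OF u, of \<phi>] A0(2)[OF w, of \<phi>] by (auto intro!: tendsto_intros)
    qed
    then show "A ?h = (\<lambda>\<phi>. a * A u \<phi> + a' * A w \<phi>)" using u w h by (simp add: A_def fun_eq_iff)
  qed
  \<comment> \<open>The continuity of the embedding includes that it maps into \<open>X\<close>.\<close>
  have dist_X: "schwartz_dist f \<in> X" if "f \<in> schwartz" for f
  proof -
    have "limitin schwartz_topology (\<lambda>_. f) f sequentially"
      unfolding schwartz_topology_def
      by (rule seminorm_topology_limit) (use that in \<open>auto simp: sw_seminorm_def\<close>)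
    then have "f \<in> topspace schwartz_topology" unfolding limitin_def by blast
    then show ?thesis using contS by (auto simp: continuous_map_def norm_topology_def)
  qed
  have ext: "tempered_ext p = series c"
    unfolding c_def by (rule tempered_ext_eq_series[OF assms(6) sum_c[unfolded c_def]])
  \<comment> \<open>Both sides are the sum of the same series, one in the order of the enumeration, the other
    unordered; so absolute summability at each \<open>\<phi>\<close> is needed.\<close>
  have A_Op: "A (schwartz_dist f) = ?T f" if f: "f \<in> schwartz" for f
  proof
    fix \<phi>
    have AX: "A (schwartz_dist f) = A0 (schwartz_dist f)" using dist_X[OF f] by (simp add: A_def)
    show "A (schwartz_dist f) \<phi> = ?T f \<phi>"
    proof (cases "\<phi> \<in> schwartz")
      case True
      let ?t = "\<lambda>\<kappa>. b \<kappa> * tf_shift (z \<kappa>) (schwartz_dist f) \<phi>"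
      have "tf_shift (z \<kappa>) (schwartz_dist f) \<phi> =
          (\<integral>x. cis (2 * pi * (vfst (\<zeta> \<kappa>) \<bullet> x)) * \<phi> x * f (vsnd (\<zeta> \<kappa>) + x) \<partial>lborel)" for \<kappa>
        unfolding z_def by (rule tf_shift_schwartz_dist[OF f True])
      moreover obtain M where M: "\<And>x. cmod (f x) \<le> M" using schwartz_bounded[OF f] by blast
      have "cmod (\<integral>x. cis (2 * pi * (w \<bullet> x)) * \<phi> x * f (y + x) \<partial>lborel) \<le> M * (\<integral>x. cmod (\<phi> x) \<partial>lborel)" for w y
      proof -
        have "cmod (\<integral>x. cis (2 * pi * (w \<bullet> x)) * \<phi> x * f (y + x) \<partial>lborel) \<le>
            (\<integral>x. cmod (cis (2 * pi * (w \<bullet> x)) * \<phi> x * f (y + x)) \<partial>lborel)"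
          by (rule integral_norm_bound)
        also have "\<dots> \<le> (\<integral>x. M * cmod (\<phi> x) \<partial>lborel)"
        proof (rule integral_mono')
          show "integrable lborel (\<lambda>x. M * cmod (\<phi> x))"
            by (intro integrable_mult_right integrable_norm schwartz_integrable True)
          show "cmod (cis (2 * pi * (w \<bullet> x)) * \<phi> x * f (y + x)) \<le> M * cmod (\<phi> x)" for x
            using mult_right_mono[OF M, of "cmod (\<phi> x)" "y + x"] by (simp add: norm_mult mult.commute)
          show "0 \<le> M * cmod (\<phi> x)" for x
            by (intro mult_nonneg_nonneg norm_ge_zero order_trans[OF norm_ge_zero M])
        qed
        finally show ?thesis by simp
      qed
      ultimately have bound: "cmod (tf_shift (z \<kappa>) (schwartz_dist f) \<phi>) \<le> M * (\<integral>x. cmod (\<phi> x) \<partial>lborel)" for \<kappa>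
        by simp
      have "(\<lambda>\<kappa>. cmod (?t \<kappa>)) summable_on UNIV"
        by (rule summable_on_comparison_test[OF summable_on_cmult_left[OF sum_c, of "M * (\<integral>x. cmod (\<phi> x) \<partial>lborel)"]])
           (auto simp: norm_mult cmod_b intro: mult_left_mono bound)
      then have "?t summable_on UNIV" by (rule abs_summable_summable)
      then have "(?t has_sum infsum ?t UNIV) UNIV" by (rule has_sum_infsum)
      then have "((\<lambda>j. ?t (e j)) has_sum infsum ?t UNIV) UNIV"
        using has_sum_reindex_bij_betw[OF e, of ?t "infsum ?t UNIV"] by simp
      then have "(\<lambda>j. ?t (e j)) sums infsum ?t UNIV" by (rule has_sum_imp_sums)
      moreover have "(\<lambda>j. ?t (e j)) sums A0 (schwartz_dist f) \<phi>"
        using A0(2)[OF dist_X[OF f], of \<phi>] by (simp add: sums_def)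
      ultimately have "A0 (schwartz_dist f) \<phi> = infsum ?t UNIV" by (rule sums_unique2[symmetric])
      also have "\<dots> = ?T f \<phi>"
        unfolding ext Op_series[OF assms(5) f True] by (simp add: b_def z_def \<zeta>_def)
      finally show ?thesis by (simp add: AX)
    next
      case False
      have "A (schwartz_dist f) \<in> tempered" using A0(1)[OF dist_X[OF f]] temp AX by auto
      then show ?thesis using False by (simp add: tempered_def Op_def)
    qed
  qed
  have A_ext: "is_bounded_extension X nrm ?T A"
    unfolding is_bounded_extension_def using A_bounded A_Op by blast
  have "extension_to X nrm ?T = A"
    unfolding extension_to_def
  proof (rule the_equality[of "is_bounded_extension X nrm ?T", OF A_ext])
    fix A'
    assume A': "is_bounded_extension X nrm ?T A'"
    show "A' = A"
    proof (rule bounded_operators_unique)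
      show "A' \<in> bounded_operators X nrm" "A \<in> bounded_operators X nrm"
        using A' A_bounded by (auto simp: is_bounded_extension_def)
      show "mtopology closure_of (schwartz_dist ` schwartz) = X" using dense by (simp add: norm_topology_def)
      show "schwartz_dist ` schwartz \<subseteq> X" using dist_X by blast
      show "A' u = A u" if "u \<in> schwartz_dist ` schwartz" for u
        using that A' A_Op by (auto simp: is_bounded_extension_def)
    qed
  qed
  moreover have "operator_norm X nrm A \<le> C * ?S"
    unfolding operator_norm_def
  proof (rule cSUP_least)
    show "{u \<in> X. nrm u \<le> 1} \<noteq> {}" using zero_mem nrm_zero by force
    fix u
    assume u: "u \<in> {u \<in> X. nrm u \<le> 1}"
    then have "nrm (A u) \<le> C * ?S * nrm u" using A0(3) by (simp add: A_def)
    also have "\<dots> \<le> C * ?S * 1"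
      using u assms(3) S0 by (intro mult_left_mono) auto
    finally show "nrm (A u) \<le> C * ?S" by simp
  qed
  moreover have "?T f \<in> X" if "f \<in> schwartz" for f
    using A0(1)[OF dist_X[OF that]] A_Op[OF that] dist_X[OF that] by (simp add: A_def)
  ultimately show ?thesis
    unfolding bounded_on_def using A_ext by (auto simp: z_def \<zeta>_def c_def)
qed

end
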